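(* Let $A$ be a von Neumann algebra, $h:A\to A$ a $\ast$-automorphism, $\psi$ a state on $A$, $a\in A_{sa}$, $\Delta\subseteq\mathbb{R}$ open, and $C\in\mathcal{C}$. The following two forcing conditions (in the presheaf topos $[\mathcal{C}^{op},\mathbf{Set}]$) are equivalent: 1. $C\Vdash\underline{\mu}_{h}(\underline{\Sigma}(\underline{h})^{-1}(\underline{[a\in\Delta]}))=\underline{1}$; 2. $h[C]\Vdash\underline{\mu}(\underline{[h(a)\in\Delta]})=\underline{1}$.
   Context: $\mathcal{C}$ is the poset (under inclusion) of abelian von Neumann subalgebras of $A$ (containing the unit of $A$). $\Sigma_C$ is the Gelfand spectrum of $C$, with restriction maps $\lambda\mapsto\lambda|_D$ for $D\subseteq C$. For a projection $p\in A$, $\delta^o(p)_C=\bigwedge\{q\in\mathrm{Proj}(C)\mid q\geq p\}$. $\Sigma_{\downarrow}=\coprod_{C}\Sigma_C$, with $U$ open iff (1) $(C,\lambda)\in U$, $D\subseteq C$ imply $(D,\lambda|_D)\in U$, and (2) $U_C:=U\cap\Sigma_C$ is open in $\Sigma_C$ for all $C$. It is the external description of the spectral presheaf $\underline{\Sigma}$ ($C\mapsto\Sigma_C$) as an internal space. $\hat{h}:\mathcal{C}\to\mathcal{C}$, $\hat h(C)=h[C]$; the internal space $H^{\ast}\underline{\Sigma}$ ($C\mapsto\Sigma_{h[C]}$) is externally $\hat{h}^{\ast}\Sigma_{\downarrow}=\coprod_{C}\Sigma_{h[C]}$, with $U$ open iff $(C,\lambda)\in U$, $C'\subseteq C$ imply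 $(C',\lambda|_{h[C']})\in U$, and $U_C:=U\cap\Sigma_{h[C]}$ is open in $\Sigma_{h[C]}$ for all $C$. The internal continuous map $\underline{\Sigma}(\underline{h}):H^{\ast}\underline{\Sigma}\to\underline{\Sigma}$ is externally $(C,\lambda)\mapsto(C,\lambda\circ h|_C)$, and $\underline{\Sigma}(\underline{h})^{-1}$ is its inverse image map on opens. The elementary proposition $\underline{[a\in\Delta]}$ is externally the open $[a\in\Delta]=\{(C,\lambda)\in\Sigma_{\downarrow}\mid\lambda(\delta^o(\chi_\Delta(a))_C)=1\}$, where $\chi_\Delta(a)$ is the spectral projection. For $C\in\mathcal{C}$ let $\mu^C:\mathcal{O}\Sigma_C\to[0,1]$ be the probability valuation corresponding to $\psi|_C$ by Riesz–Markov. The internal probability valuations $\underline{\mu}$ on $\underline{\Sigma}$ and $\underline{\mu}_h$ on $H^{\ast}\underline{\Sigma}$ (with values in the lower reals between 0 and 1, i.e. order-reversing functions on contexts) are externally $\mu(U)(C)=\mu^C(U_C)$ for $U\in\mathcal{O}\Sigma_{\downarrow}$, and $\mu_h(U)(C)=\mu^{h[C]}(U_C)$ for $U\in\mathcal{O}\hat{h}^{\ast}\Sigma_{\downarrow}$. By presheaf semantics, $C\Vdash\underline{\mu}(\underline{U})=\underline{1}$ means $\mu(U)(D)=1$ for all $D\subseteq C$, and $C\Vdash\underline{\mu}_h(\underline{U})=\underline{1}$ means $\mu_h(U)(D)=1$ for all $D\subseteq C$. *)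

theory Defs
  imports "HOL-Analysis.Analysis"
begin

section \<open>Complex Hilbert spaces and bounded operators\<close>

text \<open>The inner product is conjugate-linear in its first argument. The underlying real Hilbert
  space carries the real part of the inner product, so that the norms agree. No separability or
  dimension restriction is imposed.\<close>

class chilbert_space = real_inner + banach +
  fixes scaleC :: "complex \<Rightarrow> 'a \<Rightarrow> 'a"  (infixr "*\<^sub>C" 75)
    and cinner :: "'a \<Rightarrow> 'a \<Rightarrow> complex"
  assumes scaleC_add_right: "c *\<^sub>C (x + y) = c *\<^sub>C x + c *\<^sub>C y"
    and scaleC_add_left: "(c + d) *\<^sub>C x = c *\<^sub>C x + d *\<^sub>C x"
    and scaleC_scaleC: "c *\<^sub>C d *\<^sub>C x = (c * d) *\<^sub>C x"
    and scaleR_scaleC: "r *\<^sub>R x = complex_of_real r *\<^sub>C x"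
    and cinner_commute: "cinner x y = cnj (cinner y x)"
    and cinner_add_left: "cinner (x + y) z = cinner x z + cinner y z"
    and cinner_scaleC_left: "cinner (c *\<^sub>C x) y = cnj c * cinner x y"
    and inner_cinner: "inner x y = Re (cinner x y)"

lemma norm_scaleC: "norm (c *\<^sub>C x) = cmod c * norm (x :: 'h::chilbert_space)"
proof -
  have "cinner (c *\<^sub>C x) (c *\<^sub>C x) = cnj c * (c * cinner x x)"
    by (metis cinner_commute cinner_scaleC_left complex_cnj_cnj complex_cnj_mult)
  also have "\<dots> = complex_of_real ((cmod c)\<^sup>2) * cinner x x"
    by (metis complex_norm_square mult.assoc mult.commute)
  finally have "inner (c *\<^sub>C x) (c *\<^sub>C x) = (cmod c)\<^sup>2 * inner x x"
    by (simp add: inner_cinner)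
  then show ?thesis
    by (simp add: norm_eq_sqrt_inner real_sqrt_mult)
qed

lemma bounded_linear_scaleC: "bounded_linear (\<lambda>x :: 'h::chilbert_space. c *\<^sub>C x)"
proof (rule bounded_linear_intro[where K = "cmod c"])
  show "c *\<^sub>C r *\<^sub>R x = r *\<^sub>R c *\<^sub>C x" for r and x :: 'h
    by (simp add: scaleR_scaleC scaleC_scaleC mult.commute)
qed (simp_all add: scaleC_add_right norm_scaleC mult.commute)

text \<open>Bounded operators on \<open>'h\<close> are the complex-linear elements of the library type of bounded
  real-linear maps; \<open>o\<^sub>L\<close> is their product and \<open>id_blinfun\<close> the unit.\<close>

definition bounded_ops :: "('h::chilbert_space \<Rightarrow>\<^sub>L 'h) set" where
  "bounded_ops = {T. \<forall>c x. blinfun_apply T (c *\<^sub>C x) = c *\<^sub>C blinfun_apply T x}"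

definition scale_op :: "complex \<Rightarrow> ('h::chilbert_space \<Rightarrow>\<^sub>L 'h) \<Rightarrow> ('h \<Rightarrow>\<^sub>L 'h)" where
  "scale_op c T = Blinfun (\<lambda>x. c *\<^sub>C blinfun_apply T x)"

lemma scale_op_apply: "blinfun_apply (scale_op c T) x = c *\<^sub>C blinfun_apply T x"
  unfolding scale_op_def
  by (simp add: bounded_linear_Blinfun_apply
      bounded_linear_compose[OF bounded_linear_scaleC blinfun.bounded_linear_right])

definition adj :: "('h::chilbert_space \<Rightarrow>\<^sub>L 'h) \<Rightarrow> ('h \<Rightarrow>\<^sub>L 'h)" where
  "adj T = (THE S. \<forall>x y. cinner (blinfun_apply S x) y = cinner x (blinfun_apply T y))"

definition op_le :: "('h::chilbert_space \<Rightarrow>\<^sub>L 'h) \<Rightarrow> ('h \<Rightarrow>\<^sub>L 'h) \<Rightarrow> bool" where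
  "op_le S T \<longleftrightarrow> (\<forall>x. cinner x (blinfun_apply (T - S) x) \<in> \<real>\<^sub>\<ge>\<^sub>0)"

definition projections :: "('h::chilbert_space \<Rightarrow>\<^sub>L 'h) set \<Rightarrow> ('h \<Rightarrow>\<^sub>L 'h) set" where
  "projections M = {p \<in> M. p o\<^sub>L p = p \<and> adj p = p}"


section \<open>Von Neumann algebras, automorphisms, states\<close>

definition commutant :: "('h::chilbert_space \<Rightarrow>\<^sub>L 'h) set \<Rightarrow> ('h \<Rightarrow>\<^sub>L 'h) set" where
  "commutant M = {S \<in> bounded_ops. \<forall>T\<in>M. S o\<^sub>L T = T o\<^sub>L S}"

text \<open>A commutant is a unital subalgebra, so the bicommutant condition makes \<open>M\<close> a unital
  *-subalgebra of the bounded operators.\<close>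

definition von_neumann_algebra :: "('h::chilbert_space \<Rightarrow>\<^sub>L 'h) set \<Rightarrow> bool" where
  "von_neumann_algebra M \<longleftrightarrow>
     M \<subseteq> bounded_ops \<and> (\<forall>T\<in>M. adj T \<in> M) \<and> commutant (commutant M) = M"

definition contexts :: "('h::chilbert_space \<Rightarrow>\<^sub>L 'h) set \<Rightarrow> ('h \<Rightarrow>\<^sub>L 'h) set set" where
  "contexts A =
     {C. von_neumann_algebra C \<and> C \<subseteq> A \<and> (\<forall>S\<in>C. \<forall>T\<in>C. S o\<^sub>L T = T o\<^sub>L S)}"

text \<open>Maps on an algebra \<open>A\<close> are total functions of which only the values on \<open>A\<close> matter.\<close>

definition star_automorphism ::
  "('h::chilbert_space \<Rightarrow>\<^sub>L 'h) set \<Rightarrow> (('h \<Rightarrow>\<^sub>L 'h) \<Rightarrow> ('h \<Rightarrow>\<^sub>L 'h)) \<Rightarrow> bool" where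
  "star_automorphism A h \<longleftrightarrow>
     bij_betw h A A \<and>
     (\<forall>S\<in>A. \<forall>T\<in>A. h (S + T) = h S + h T) \<and>
     (\<forall>c. \<forall>T\<in>A. h (scale_op c T) = scale_op c (h T)) \<and>
     (\<forall>S\<in>A. \<forall>T\<in>A. h (S o\<^sub>L T) = h S o\<^sub>L h T) \<and>
     (\<forall>T\<in>A. h (adj T) = adj (h T))"

definition state ::
  "('h::chilbert_space \<Rightarrow>\<^sub>L 'h) set \<Rightarrow> (('h \<Rightarrow>\<^sub>L 'h) \<Rightarrow> complex) \<Rightarrow> bool" where
  "state A \<psi> \<longleftrightarrow>
     (\<forall>S\<in>A. \<forall>T\<in>A. \<psi> (S + T) = \<psi> S + \<psi> T) \<and>
     (\<forall>c. \<forall>T\<in>A. \<psi> (scale_op c T) = c * \<psi> T) \<and>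
     (\<forall>T\<in>A. \<psi> (adj T o\<^sub>L T) \<in> \<real>\<^sub>\<ge>\<^sub>0) \<and>
     \<psi> id_blinfun = 1"


section \<open>Spectral projections and outer daseinisation\<close>

text \<open>\<open>E\<close> is the projection-valued Borel measure on the real line with \<open>a = \<integral> t dE(t)\<close>, the
  integral being taken weakly. Compact support makes the scalar integrals exist for every
  vector.\<close>

definition spectral_measure ::
  "('h::chilbert_space \<Rightarrow>\<^sub>L 'h) \<Rightarrow> (real set \<Rightarrow> ('h \<Rightarrow>\<^sub>L 'h)) \<Rightarrow> bool" where
  "spectral_measure a E \<longleftrightarrow>
     E \<in> extensional (sets borel) \<and>
     (\<forall>\<Delta>\<in>sets borel. E \<Delta> \<in> projections bounded_ops) \<and>
     E UNIV = id_blinfun \<and>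
     (\<forall>\<Delta>\<in>sets borel. \<forall>\<Delta>'\<in>sets borel. E (\<Delta> \<inter> \<Delta>') = E \<Delta> o\<^sub>L E \<Delta>') \<and>
     (\<forall>F :: nat \<Rightarrow> real set. range F \<subseteq> sets borel \<longrightarrow> disjoint_family F \<longrightarrow>
        (\<forall>x. (\<lambda>n. blinfun_apply (E (F n)) x) sums blinfun_apply (E (\<Union>n. F n)) x)) \<and>
     (\<exists>r. E {-r..r} = id_blinfun) \<and>
     (\<forall>x. cinner x (blinfun_apply a x) = complex_of_real
        (\<integral>t. t \<partial>measure_of UNIV (sets borel)
           (\<lambda>\<Delta>. ennreal (Re (cinner x (blinfun_apply (E \<Delta>) x))))))"

definition spectral_projection ::
  "('h::chilbert_space \<Rightarrow>\<^sub>L 'h) \<Rightarrow> real set \<Rightarrow> ('h \<Rightarrow>\<^sub>L 'h)" where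
  "spectral_projection a \<Delta> = (THE E. spectral_measure a E) \<Delta>"

text \<open>The meet of the projections of \<open>C\<close> above \<open>p\<close>, taken in the lattice of projections of \<open>C\<close>.\<close>

definition outer_das ::
  "('h::chilbert_space \<Rightarrow>\<^sub>L 'h) set \<Rightarrow> ('h \<Rightarrow>\<^sub>L 'h) \<Rightarrow> ('h \<Rightarrow>\<^sub>L 'h)" where
  "outer_das C p = (THE r. r \<in> projections C \<and>
     (\<forall>q\<in>projections C. op_le p q \<longrightarrow> op_le r q) \<and>
     (\<forall>s\<in>projections C. (\<forall>q\<in>projections C. op_le p q \<longrightarrow> op_le s q) \<longrightarrow> op_le s r))"


section \<open>Gelfand spectra and the external spectral spaces\<close>

text \<open>Characters of \<open>C\<close> are extensional, so that distinct points are distinct functions on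
  \<open>C\<close>; the topology is that of pointwise convergence on \<open>C\<close>.\<close>

definition gelfand_spectrum ::
  "('h::chilbert_space \<Rightarrow>\<^sub>L 'h) set \<Rightarrow> (('h \<Rightarrow>\<^sub>L 'h) \<Rightarrow> complex) set" where
  "gelfand_spectrum C = {\<phi>. \<phi> \<in> extensional C \<and>
     (\<forall>S\<in>C. \<forall>T\<in>C. \<phi> (S + T) = \<phi> S + \<phi> T) \<and>
     (\<forall>c. \<forall>T\<in>C. \<phi> (scale_op c T) = c * \<phi> T) \<and>
     (\<forall>S\<in>C. \<forall>T\<in>C. \<phi> (S o\<^sub>L T) = \<phi> S * \<phi> T) \<and>
     (\<exists>T\<in>C. \<phi> T \<noteq> 0)}"

definition gelfand_topology ::
  "('h::chilbert_space \<Rightarrow>\<^sub>L 'h) set \<Rightarrow> (('h \<Rightarrow>\<^sub>L 'h) \<Rightarrow> complex) topology" where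
  "gelfand_topology C =
     subtopology (product_topology (\<lambda>_. euclidean) C) (gelfand_spectrum C)"

type_synonym 'h point = "('h \<Rightarrow>\<^sub>L 'h) set \<times> (('h \<Rightarrow>\<^sub>L 'h) \<Rightarrow> complex)"

text \<open>For an order-preserving map \<open>k\<close> on contexts, the space \<open>\<Coprod>\<^sub>C \<Sigma>\<^bsub>k C\<^esub>\<close>. The identity gives
  \<open>\<Sigma>\<^sub>\<down>\<close>, and \<open>k C = h[C]\<close> gives the external description of \<open>H\<^sup>*\<Sigma>\<close>. The fibre \<open>U\<^sub>C\<close> of \<open>U\<close>
  is the relational image \<open>U `` {C}\<close>.\<close>

definition bundle_points ::
  "('h::chilbert_space \<Rightarrow>\<^sub>L 'h) set \<Rightarrow> (('h \<Rightarrow>\<^sub>L 'h) set \<Rightarrow> ('h \<Rightarrow>\<^sub>L 'h) set) \<Rightarrow> 'h point set" where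
  "bundle_points A k = (SIGMA C:contexts A. gelfand_spectrum (k C))"

definition bundle_open ::
  "('h::chilbert_space \<Rightarrow>\<^sub>L 'h) set \<Rightarrow> (('h \<Rightarrow>\<^sub>L 'h) set \<Rightarrow> ('h \<Rightarrow>\<^sub>L 'h) set) \<Rightarrow>
    'h point set \<Rightarrow> bool" where
  "bundle_open A k U \<longleftrightarrow>
     U \<subseteq> bundle_points A k \<and>
     (\<forall>C \<phi>. \<forall>D\<in>contexts A. (C, \<phi>) \<in> U \<longrightarrow> D \<subseteq> C \<longrightarrow> (D, restrict \<phi> (k D)) \<in> U) \<and>
     (\<forall>C\<in>contexts A. openin (gelfand_topology (k C)) (U `` {C}))"

lemma istopology_bundle_open: "istopology (bundle_open A k)"
proof -
  have "bundle_open A k (U \<inter> V)" if "bundle_open A k U" "bundle_open A k V" for U V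
  proof -
    have "(U \<inter> V) `` {C} = U `` {C} \<inter> V `` {C}" for C by auto
    with that show ?thesis unfolding bundle_open_def by auto
  qed
  moreover have "bundle_open A k (\<Union>\<K>)" if "\<And>U. U \<in> \<K> \<Longrightarrow> bundle_open A k U" for \<K>
  proof -
    have "(\<Union>\<K>) `` {C} = (\<Union>U\<in>\<K>. U `` {C})" for C by auto
    with that show ?thesis unfolding bundle_open_def by (auto; blast)
  qed
  ultimately show ?thesis unfolding istopology_def by auto
qed

definition bundle_space ::
  "('h::chilbert_space \<Rightarrow>\<^sub>L 'h) set \<Rightarrow> (('h \<Rightarrow>\<^sub>L 'h) set \<Rightarrow> ('h \<Rightarrow>\<^sub>L 'h) set) \<Rightarrow>
    'h point topology" where
  "bundle_space A k = topology (bundle_open A k)"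

definition spectral_map ::
  "(('h::chilbert_space \<Rightarrow>\<^sub>L 'h) \<Rightarrow> ('h \<Rightarrow>\<^sub>L 'h)) \<Rightarrow> 'h point \<Rightarrow> 'h point" where
  "spectral_map h = (\<lambda>(C, \<phi>). (C, restrict (\<phi> \<circ> h) C))"

definition spectral_map_inverse_image ::
  "('h::chilbert_space \<Rightarrow>\<^sub>L 'h) set \<Rightarrow> (('h \<Rightarrow>\<^sub>L 'h) \<Rightarrow> ('h \<Rightarrow>\<^sub>L 'h)) \<Rightarrow>
    'h point set \<Rightarrow> 'h point set" where
  "spectral_map_inverse_image A h U =
     {z \<in> bundle_points A (\<lambda>C. h ` C). spectral_map h z \<in> U}"

definition elementary_prop ::
  "('h::chilbert_space \<Rightarrow>\<^sub>L 'h) set \<Rightarrow> ('h \<Rightarrow>\<^sub>L 'h) \<Rightarrow> real set \<Rightarrow> 'h point set" where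
  "elementary_prop A a \<Delta> =
     {(C, \<phi>) \<in> bundle_points A (\<lambda>C. C). \<phi> (outer_das C (spectral_projection a \<Delta>)) = 1}"


section \<open>Probability valuations and forcing\<close>

text \<open>The regular Borel probability measure on the spectrum that represents \<open>\<psi>|\<^sub>C\<close>.\<close>

definition riesz_markov_measure ::
  "('h::chilbert_space \<Rightarrow>\<^sub>L 'h) set \<Rightarrow> (('h \<Rightarrow>\<^sub>L 'h) \<Rightarrow> complex) \<Rightarrow>
    (('h \<Rightarrow>\<^sub>L 'h) \<Rightarrow> complex) measure \<Rightarrow> bool" where
  "riesz_markov_measure C \<psi> M \<longleftrightarrow>
     sets M = sets (sigma (gelfand_spectrum C) {U. openin (gelfand_topology C) U}) \<and>
     emeasure M (space M) = 1 \<and>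
     (\<forall>B\<in>sets M. emeasure M B =
        (SUP K\<in>{K. compactin (gelfand_topology C) K \<and> K \<subseteq> B}. emeasure M K)) \<and>
     (\<forall>B\<in>sets M. emeasure M B =
        (INF U\<in>{U. openin (gelfand_topology C) U \<and> B \<subseteq> U}. emeasure M U)) \<and>
     (\<forall>T\<in>C. \<psi> T = (\<integral>\<phi>. \<phi> T \<partial>M))"

definition context_valuation ::
  "('h::chilbert_space \<Rightarrow>\<^sub>L 'h) set \<Rightarrow> (('h \<Rightarrow>\<^sub>L 'h) \<Rightarrow> complex) \<Rightarrow>
    (('h \<Rightarrow>\<^sub>L 'h) \<Rightarrow> complex) set \<Rightarrow> real" where
  "context_valuation C \<psi> U = measure (THE M. riesz_markov_measure C \<psi> M) U"

text \<open>The valuation on \<open>bundle_space A k\<close> induced by \<open>\<psi>\<close>, defined on open sets, with values in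
  functions on contexts: \<open>k C = C\<close> gives \<open>\<mu>\<close> and \<open>k C = h[C]\<close> gives \<open>\<mu>\<^sub>h\<close>.\<close>

definition internal_valuation ::
  "('h::chilbert_space \<Rightarrow>\<^sub>L 'h) set \<Rightarrow> (('h \<Rightarrow>\<^sub>L 'h) set \<Rightarrow> ('h \<Rightarrow>\<^sub>L 'h) set) \<Rightarrow>
    (('h \<Rightarrow>\<^sub>L 'h) \<Rightarrow> complex) \<Rightarrow> 'h point set \<Rightarrow> ('h \<Rightarrow>\<^sub>L 'h) set \<Rightarrow> real" where
  "internal_valuation A k \<psi> =
     (\<lambda>U\<in>{U. openin (bundle_space A k) U}. \<lambda>C\<in>contexts A. context_valuation (k C) \<psi> (U `` {C}))"

abbreviation mu ::
  "('h::chilbert_space \<Rightarrow>\<^sub>L 'h) set \<Rightarrow> (('h \<Rightarrow>\<^sub>L 'h) \<Rightarrow> complex) \<Rightarrow>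
    'h point set \<Rightarrow> ('h \<Rightarrow>\<^sub>L 'h) set \<Rightarrow> real" where
  "mu A \<psi> \<equiv> internal_valuation A (\<lambda>C. C) \<psi>"

abbreviation mu_pullback ::
  "('h::chilbert_space \<Rightarrow>\<^sub>L 'h) set \<Rightarrow> (('h \<Rightarrow>\<^sub>L 'h) \<Rightarrow> ('h \<Rightarrow>\<^sub>L 'h)) \<Rightarrow>
    (('h \<Rightarrow>\<^sub>L 'h) \<Rightarrow> complex) \<Rightarrow> 'h point set \<Rightarrow> ('h \<Rightarrow>\<^sub>L 'h) set \<Rightarrow> real" where
  "mu_pullback A h \<psi> \<equiv> internal_valuation A (\<lambda>C. h ` C) \<psi>"

text \<open>\<open>C\<close> forces \<open>f = 1\<close>, for a lower real of the presheaf topos given as a function \<open>f\<close> on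
  contexts.\<close>

definition forces_one ::
  "('h::chilbert_space \<Rightarrow>\<^sub>L 'h) set \<Rightarrow> ('h \<Rightarrow>\<^sub>L 'h) set \<Rightarrow>
    (('h \<Rightarrow>\<^sub>L 'h) set \<Rightarrow> real) \<Rightarrow> bool" where
  "forces_one A C f \<longleftrightarrow> (\<forall>D\<in>contexts A. D \<subseteq> C \<longrightarrow> f D = 1)"

end

theory Submission
  imports Defs "HOL-Probability.Distribution_Functions"
begin

text \<open>Normality of \<open>h\<close> is not assumed, but it is automatic where it is needed: the projection onto the
  common kernel of a subset \<open>F\<close> of \<open>A\<close> is the largest projection of \<open>A\<close> annihilated by \<open>F\<close>, so \<open>h\<close>
  maps it to the corresponding projection for \<open>h[F]\<close>. Hence \<open>h\<close> preserves infima of projections, and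
  also spectral projections, because that of \<open>a\<close> for \<open>{..l}\<close> projects onto the kernel of \<open>\<bar>b\<bar> + b\<close> with
  \<open>b = a - l\<close>. It follows that \<open>h\<close> intertwines daseinisation and that the image of an abelian von
  Neumann algebra, whose projections remain a complete lattice inside those of \<open>A\<close>, is again a von
  Neumann algebra. So \<open>D \<mapsto> h[D]\<close> is an automorphism of the poset of contexts, the pulled-back open set
  has over \<open>D\<close> the same fibre as \<open>[h(a) \<in> \<Delta>]\<close> has over \<open>h[D]\<close>, and both forcing conditions say
  the same about the same numbers.\<close>


section \<open>Orthogonal projections and adjoints\<close>

text \<open>Since \<open>spectral_projection\<close> and \<open>outer_das\<close> are definite
  descriptions, the spectral theorem and the lattice meets have to be established before anything
  can be said about them. The cuts for half-lines come first, because they are fixed by conditions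
  that an automorphism transports; operator identities are then obtained by subdividing the line
  into cut increments instead of by a functional calculus. The main obstacle is the bicommutant of
  h[D]: commutants involve operators outside A, where h says nothing, and h need not be implemented
  by a unitary. For a projection P of the bicommutant, von Neumann's density argument gives only
  approximations at given vectors; cuts and a limes inferior turn them into exact projections of
  h[D], and completeness of the lattice recovers P. A self-adjoint operator of the bicommutant is
  reached by pulling its cuts back to D, which is its own bicommutant. Openness of the two sets has
  to be shown because \<open>internal_valuation\<close> is unspecified off the open sets.\<close>

lemma riesz_closed_subspace:
  fixes K :: "'a::{real_inner,banach} set"
  assumes K: "subspace K" "closed K" and f: "bounded_linear f"
  shows "\<exists>w\<in>K. \<forall>y\<in>K. inner w y = f y"
proof -
  interpret f: bounded_linear f by fact
  obtain B where B: "\<And>x. norm (f x) \<le> norm x * B" using f.bounded by blast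
  \<comment> \<open>If v represents f on K, then J w = |w - v|^2 - |v|^2 for w in K, so v is found
    as the minimiser of J. With f = inner x this gives orthogonal projections, with f = inner x o T
    adjoints.\<close>
  define J where "J w = inner w w - 2 * f w" for w
  have lower: "- B\<^sup>2 \<le> J w" for w
  proof -
    have "f w \<le> norm w * B" using B[of w] by simp
    moreover have "0 \<le> (norm w - B)\<^sup>2" by simp
    ultimately show ?thesis
      by (simp add: J_def power2_norm_eq_inner[symmetric] power2_diff)
  qed
  define m where "m = Inf (J ` K)"
  have K0: "0 \<in> K" using K(1) subspace_0 by blast
  have bdd: "bdd_below (J ` K)" using lower by (meson bdd_belowI2)
  have m_le: "m \<le> J w" if "w \<in> K" for w
    unfolding m_def by (rule cInf_lower[OF _ bdd]) (use that in auto)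
  have "\<exists>w\<in>K. J w < m + 1 / Suc n" for n
    using cInf_lessD[of "J ` K" "m + 1 / Suc n"] K0 unfolding m_def by auto
  then obtain w where wK: "\<And>n. w n \<in> K" and w: "\<And>n. J (w n) < m + 1 / Suc n" by metis
  \<comment> \<open>Parallelogram law: the midpoint of w i and w j lies in K, so J is at least m
    there.\<close>
  have est: "(norm (w i - w j))\<^sup>2 \<le> 2 / Suc i + 2 / Suc j" for i j
  proof -
    have mid: "(1/2) *\<^sub>R (w i + w j) \<in> K"
      using K(1) wK by (simp add: subspace_add subspace_scale)
    have "(norm (w i - w j))\<^sup>2 = 2 * J (w i) + 2 * J (w j) - 4 * J ((1/2) *\<^sub>R (w i + w j))"
      by (simp add: J_def power2_norm_eq_inner f.add f.scaleR inner_commute inner_diff_left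
          inner_diff_right inner_add_left inner_add_right algebra_simps)
    moreover have "2 * (1 / Suc k) = 2 / Suc k" for k by simp
    ultimately show ?thesis using w[of i] w[of j] m_le[OF mid] by (smt (verit))
  qed
  have "Cauchy w"
  proof (rule metric_CauchyI)
    fix e :: real assume e: "0 < e"
    obtain N :: nat where N: "4 / e\<^sup>2 < N" using reals_Archimedean2 by blast
    have "dist (w i) (w j) < e" if "N \<le> i" "N \<le> j" for i j
    proof -
      have small: "2 / Suc k < e\<^sup>2 / 2" if "N \<le> k" for k
      proof -
        have "4 / e\<^sup>2 < Suc k" using N that by (simp add: less_le_trans)
        then show ?thesis using e by (simp add: field_simps)
      qed
      have "(norm (w i - w j))\<^sup>2 < e\<^sup>2" using est[of i j] small[OF that(1)] small[OF that(2)] by simp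
      then show ?thesis using e by (simp add: dist_norm power2_less_imp_less)
    qed
    then show "\<exists>M. \<forall>m\<ge>M. \<forall>n\<ge>M. dist (w m) (w n) < e" by blast
  qed
  then obtain u where u: "w \<longlonglongrightarrow> u" using Cauchy_convergent_iff convergent_def by blast
  have uK: "u \<in> K" using closed_sequentially[OF K(2) wK u] .
  have "(\<lambda>n. J (w n)) \<longlonglongrightarrow> J u"
    unfolding J_def using f.tendsto[OF u] by (intro tendsto_intros u)
  moreover have "(\<lambda>n. J (w n)) \<longlonglongrightarrow> m"
  proof (rule tendsto_sandwich[of "\<lambda>_. m" _ _ "\<lambda>n. m + 1 / Suc n"])
    show "(\<lambda>n. m + 1 / real (Suc n)) \<longlonglongrightarrow> m"
      using tendsto_add[OF tendsto_const LIMSEQ_inverse_real_of_nat, of m] by (simp add: inverse_eq_divide)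
  qed (use m_le wK less_imp_le[OF w] in \<open>auto intro!: always_eventually\<close>)
  ultimately have Ju: "J u = m" using LIMSEQ_unique by blast
  have "inner u y = f y" if y: "y \<in> K" for y
  proof (rule ccontr)
    define d where "d = inner u y - f y"
    assume "inner u y \<noteq> f y"
    then have d: "d \<noteq> 0" by (simp add: d_def)
    then have yy: "0 < inner y y" using d_def f.zero by (cases "y = 0") auto
    \<comment> \<open>The minimiser of the quadratic polynomial J (u + t y) in t; it would push J
      below m by d^2 / |y|^2.\<close>
    define t where "t = - d / inner y y"
    have "m \<le> J (u + t *\<^sub>R y)" using K(1) uK y by (intro m_le) (simp add: subspace_add subspace_scale)
    also have "J (u + t *\<^sub>R y) = J u + 2 * t * d + t\<^sup>2 * inner y y"
      by (simp add: J_def d_def f.add f.scaleR inner_add_left inner_add_right inner_commute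
          power2_eq_square algebra_simps)
    also have "\<dots> = m - d\<^sup>2 / inner y y"
      using yy Ju by (simp add: t_def power2_eq_square field_simps)
    finally show False using d yy by (simp add: field_simps)
  qed
  then show ?thesis using uK by blast
qed

text \<open>Symmetry for the real inner product only. On \<open>bounded_ops\<close> this amounts to
  \<open>adj T = T\<close>, since complex linearity recovers the imaginary part.\<close>

definition selfadjoint :: "('a::real_inner \<Rightarrow>\<^sub>L 'a) \<Rightarrow> bool" where
  "selfadjoint T \<longleftrightarrow> (\<forall>x y. inner (T x) y = inner x (T y))"

text \<open>The projection of the underlying real Hilbert space; it is complex linear as soon as K
  is closed under complex scalars.\<close>

definition orth_proj :: "'a::{real_inner,banach} set \<Rightarrow> ('a \<Rightarrow>\<^sub>L 'a)" where
  "orth_proj K = (SOME P. \<forall>x. blinfun_apply P x \<in> K \<and> (\<forall>y\<in>K. inner (P x) y = inner x y))"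

lemma selfadjointD: "selfadjoint T \<Longrightarrow> inner (blinfun_apply T x) y = inner x (T y)"
  by (simp add: selfadjoint_def)

lemma subspace_eqI:
  fixes K :: "'a::real_inner set"
  assumes "subspace K" "u \<in> K" "v \<in> K" "\<And>y. y \<in> K \<Longrightarrow> inner u y = inner v y"
  shows "u = v"
proof -
  have "u - v \<in> K" using assms subspace_diff by blast
  then have "inner (u - v) (u - v) = 0" using assms(4) by (simp add: inner_diff_left)
  then show ?thesis by simp
qed

context
  fixes K :: "'a::{real_inner,banach} set"
  assumes K: "subspace K" "closed K"
begin

lemma orth_proj_exists: "\<exists>P. \<forall>x. blinfun_apply P x \<in> K \<and> (\<forall>y\<in>K. inner (P x) y = inner x y)"
proof -
  have "\<exists>w\<in>K. \<forall>y\<in>K. inner w y = inner x y" for x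
    by (rule riesz_closed_subspace[OF K bounded_linear_inner_right])
  then obtain g where gK: "\<And>x. g x \<in> K" and g: "\<And>x y. y \<in> K \<Longrightarrow> inner (g x) y = inner x y"
    by metis
  have "bounded_linear g"
  proof (rule bounded_linear_intro[where K = 1])
    show "g (x + y) = g x + g y" for x y
      by (rule subspace_eqI[OF K(1)]) (use gK g subspace_add[OF K(1)] in \<open>auto simp: inner_add_left\<close>)
    show "g (r *\<^sub>R x) = r *\<^sub>R g x" for r x
      by (rule subspace_eqI[OF K(1)]) (use gK g subspace_scale[OF K(1)] in auto)
    show "norm (g x) \<le> norm x * 1" for x
    proof -
      have "norm (g x) * norm (g x) = inner x (g x)"
        using g[OF gK, of x x] by (simp add: power2_eq_square[symmetric] power2_norm_eq_inner)
      also have "\<dots> \<le> norm x * norm (g x)" by (rule norm_cauchy_schwarz)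
      finally show ?thesis by (cases "norm (g x) = 0") (auto simp: mult_le_cancel_right)
    qed
  qed
  then show ?thesis using gK g by (intro exI[of _ "Blinfun g"]) (simp add: bounded_linear_Blinfun_apply)
qed

lemma orth_proj_mem: "orth_proj K x \<in> K"
  and orth_proj_inner: "y \<in> K \<Longrightarrow> inner (orth_proj K x) y = inner x y"
  using someI_ex[OF orth_proj_exists] unfolding orth_proj_def[symmetric] by auto

lemma orth_proj_fix: "orth_proj K x = x \<longleftrightarrow> x \<in> K"
  using orth_proj_mem[of x] subspace_eqI[OF K(1) orth_proj_mem _ orth_proj_inner] by metis

lemma orth_proj_selfadjoint: "selfadjoint (orth_proj K)"
  unfolding selfadjoint_def by (metis inner_commute orth_proj_inner orth_proj_mem)

lemma orth_proj_idem: "orth_proj K o\<^sub>L orth_proj K = orth_proj K"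
  by (rule blinfun_eqI) (simp add: orth_proj_fix orth_proj_mem)

text \<open>K is invariant under both members of an adjoint pair, hence so is its orthogonal
  complement. T and S are plain functions, so that multiplication by a complex scalar and by its
  conjugate is an instance too.\<close>

lemma orth_proj_commute:
  assumes "\<And>x y. inner (T x) y = inner x (S y)" "T ` K \<subseteq> K" "S ` K \<subseteq> K"
  shows "orth_proj K (T x) = T (orth_proj K x)"
proof (rule subspace_eqI[OF K(1)])
  show "T (orth_proj K x) \<in> K" using assms(2) orth_proj_mem by blast
  fix y assume y: "y \<in> K"
  then have "S y \<in> K" using assms(3) by blast
  then show "inner (orth_proj K (T x)) y = inner (T (orth_proj K x)) y"
    using y assms(1) orth_proj_inner by metis
qed (rule orth_proj_mem)

end

section \<open>Adjoints, and their reduction to the real inner product\<close>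

lemma adjoint_exists:
  fixes T :: "'a::{real_inner,banach} \<Rightarrow>\<^sub>L 'a"
  shows "\<exists>S. \<forall>x y. inner (blinfun_apply S x) y = inner x (T y)"
proof -
  have "\<exists>w. \<forall>y. inner w y = inner x (T y)" for x
    using riesz_closed_subspace[OF subspace_UNIV closed_UNIV
        bounded_linear_compose[OF bounded_linear_inner_right blinfun.bounded_linear_right]] by auto
  then obtain g where g: "\<And>x y. inner (g x) y = inner x (T y)" by metis
  have "bounded_linear g"
  proof (rule bounded_linear_intro[where K = "norm T"])
    show "g (x + y) = g x + g y" for x y
      by (rule subspace_eqI[OF subspace_UNIV]) (auto simp: g inner_add_left)
    show "g (r *\<^sub>R x) = r *\<^sub>R g x" for r x
      by (rule subspace_eqI[OF subspace_UNIV]) (auto simp: g)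
    show "norm (g x) \<le> norm x * norm T" for x
    proof -
      have "norm (g x) * norm (g x) = inner x (T (g x))"
        using g[of x "g x"] by (simp add: power2_eq_square[symmetric] power2_norm_eq_inner)
      also have "\<dots> \<le> norm x * norm (T (g x))" by (rule norm_cauchy_schwarz)
      also have "\<dots> \<le> norm x * (norm T * norm (g x))" by (intro mult_left_mono norm_blinfun) simp
      finally show ?thesis by (cases "norm (g x) = 0") (auto simp: mult_le_cancel_right)
    qed
  qed
  then show ?thesis using g by (intro exI[of _ "Blinfun g"]) (simp add: bounded_linear_Blinfun_apply)
qed

lemma cinner_scaleC_right: "cinner x (c *\<^sub>C y) = c * cinner x (y :: 'h::chilbert_space)"
  by (metis cinner_commute cinner_scaleC_left complex_cnj_cnj complex_cnj_mult)

lemma inner_scaleC: "inner (c *\<^sub>C x) y = inner x (cnj c *\<^sub>C (y :: 'h::chilbert_space))"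
  by (simp add: inner_cinner cinner_scaleC_left cinner_scaleC_right)

lemma cinner_inner: "cinner x y = Complex (inner x y) (inner (\<i> *\<^sub>C x) (y :: 'h::chilbert_space))"
  by (simp add: complex_eq_iff inner_cinner cinner_scaleC_left)

lemma bounded_opsD: "T \<in> bounded_ops \<Longrightarrow> blinfun_apply T (c *\<^sub>C x) = c *\<^sub>C T x"
  by (simp add: bounded_ops_def)

text \<open>The real identity at i x is the imaginary part of the complex identity at x. This lets
  all later arguments use the real inner product.\<close>

lemma cinner_adjoint_iff:
  fixes S T :: "'h::chilbert_space \<Rightarrow>\<^sub>L 'h"
  assumes "T \<in> bounded_ops"
  shows "(\<forall>x y. cinner (S x) y = cinner x (T y)) \<longleftrightarrow>
    (\<forall>x y. inner (S x) y = inner x (T y))" (is "?L \<longleftrightarrow> ?R")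
proof
  show "?L \<Longrightarrow> ?R" by (simp add: inner_cinner)
  assume R: ?R
  show ?L
  proof (intro allI)
    fix x y
    have "inner (\<i> *\<^sub>C S x) y = inner (\<i> *\<^sub>C x) (T y)"
      using R by (simp add: inner_scaleC bounded_opsD[OF assms])
    then show "cinner (S x) y = cinner x (T y)" using R by (simp add: cinner_inner)
  qed
qed

lemma blinfun_inner_eqI:
  fixes S T :: "'a::real_inner \<Rightarrow>\<^sub>L 'b::real_inner"
  assumes "\<And>x y. inner (S x) y = inner (T x) y"
  shows "S = T"
  by (rule blinfun_eqI, rule subspace_eqI[OF subspace_UNIV]) (auto simp: assms)

lemma adj_unique:
  fixes S T :: "'h::chilbert_space \<Rightarrow>\<^sub>L 'h"
  assumes "T \<in> bounded_ops" "\<And>x y. inner (S x) y = inner x (T y)"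
  shows "adj T = S"
  unfolding adj_def cinner_adjoint_iff[OF assms(1)]
  by (rule the_equality) (use assms(2) in \<open>auto intro!: blinfun_inner_eqI\<close>)

lemma adj_inner:
  fixes T :: "'h::chilbert_space \<Rightarrow>\<^sub>L 'h"
  assumes "T \<in> bounded_ops"
  shows "inner (adj T x) y = inner x (T y)"
  using adjoint_exists[of T] adj_unique[OF assms] by metis

lemma adj_inner': "T \<in> bounded_ops \<Longrightarrow> inner (T x) y = inner x (adj T y)"
  by (metis adj_inner inner_commute)

lemma adj_bounded_ops: "T \<in> bounded_ops \<Longrightarrow> adj T \<in> bounded_ops"
  unfolding bounded_ops_def
proof (safe)
  fix c x assume *: "\<forall>c x. T (c *\<^sub>C x) = c *\<^sub>C T x"
  then have T: "T \<in> bounded_ops" by (simp add: bounded_ops_def)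
  show "adj T (c *\<^sub>C x) = c *\<^sub>C adj T x"
    by (rule subspace_eqI[OF subspace_UNIV]) (auto simp: adj_inner[OF T] inner_scaleC *)
qed

lemma adj_eq_self_iff: "T \<in> bounded_ops \<Longrightarrow> adj T = T \<longleftrightarrow> selfadjoint T"
  unfolding selfadjoint_def using adj_inner[of T] adj_unique[of T T] by metis

lemma orth_proj_bounded_ops:
  assumes "subspace K" "closed K" "\<And>c x. x \<in> K \<Longrightarrow> c *\<^sub>C x \<in> K"
  shows "orth_proj K \<in> bounded_ops"
  unfolding bounded_ops_def
  using orth_proj_commute[OF assms(1,2), of "\<lambda>x. c *\<^sub>C x" "\<lambda>x. cnj c *\<^sub>C x" for c] assms(3)
  by (auto simp: inner_scaleC image_subset_iff)


section \<open>Commutants\<close>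

lemma blinfun_eq_iff: "S = T \<longleftrightarrow> (\<forall>x. blinfun_apply S x = blinfun_apply T x)"
  using blinfun_eqI by metis

lemma commutant_iff:
  "S \<in> commutant M \<longleftrightarrow> S \<in> bounded_ops \<and> (\<forall>T\<in>M. \<forall>x. blinfun_apply S (T x) = T (S x))"
  by (simp add: commutant_def blinfun_eq_iff)

lemma commutant_apply: "S \<in> commutant M \<Longrightarrow> T \<in> M \<Longrightarrow> blinfun_apply S (T x) = T (S x)"
  by (simp add: commutant_iff)

lemma commutant_bounded_ops: "commutant M \<subseteq> bounded_ops"
  by (auto simp: commutant_def)

lemma scaleC_real_scale: "c *\<^sub>C r *\<^sub>R x = r *\<^sub>R c *\<^sub>C (x :: 'h::chilbert_space)"
  by (simp add: scaleR_scaleC scaleC_scaleC mult.commute)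

lemma scaleC_minus_right: "c *\<^sub>C (x - y) = c *\<^sub>C x - c *\<^sub>C (y :: 'h::chilbert_space)"
  by (metis add_diff_cancel diff_add_cancel scaleC_add_right)

lemma scaleC_one [simp]: "1 *\<^sub>C x = (x :: 'h::chilbert_space)"
  by (metis of_real_1 scaleR_one scaleR_scaleC)

lemma scaleC_zero_right [simp]: "c *\<^sub>C 0 = (0 :: 'h::chilbert_space)"
  using scaleC_minus_right[of c 0 0] by simp

lemma bounded_ops_id: "id_blinfun \<in> bounded_ops"
  and bounded_ops_zero: "0 \<in> bounded_ops"
  and bounded_ops_add: "S \<in> bounded_ops \<Longrightarrow> T \<in> bounded_ops \<Longrightarrow> S + T \<in> bounded_ops"
  and bounded_ops_diff: "S \<in> bounded_ops \<Longrightarrow> T \<in> bounded_ops \<Longrightarrow> S - T \<in> bounded_ops"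
  and bounded_ops_compose: "S \<in> bounded_ops \<Longrightarrow> T \<in> bounded_ops \<Longrightarrow> S o\<^sub>L T \<in> bounded_ops"
  and bounded_ops_scaleR: "S \<in> bounded_ops \<Longrightarrow> r *\<^sub>R S \<in> bounded_ops"
  and bounded_ops_scale_op: "S \<in> bounded_ops \<Longrightarrow> scale_op c S \<in> bounded_ops"
  by (simp_all add: bounded_ops_def blinfun.add_left blinfun.diff_left blinfun.scaleR_left
      scaleC_add_right scaleC_minus_right scaleC_real_scale scale_op_apply scaleC_scaleC mult.commute)

lemma bounded_ops_tendsto:
  fixes T :: "nat \<Rightarrow> ('h::chilbert_space \<Rightarrow>\<^sub>L 'h)"
  assumes "\<And>n. T n \<in> bounded_ops" "T \<longlonglongrightarrow> S"
  shows "S \<in> bounded_ops"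
  unfolding bounded_ops_def
proof safe
  fix c x
  have lim: "(\<lambda>n. T n z) \<longlonglongrightarrow> S z" for z
    using blinfun.tendsto[OF assms(2) tendsto_const] .
  have "(\<lambda>n. c *\<^sub>C T n x) \<longlonglongrightarrow> c *\<^sub>C S x"
    by (rule bounded_linear.tendsto[OF bounded_linear_scaleC lim])
  then show "S (c *\<^sub>C x) = c *\<^sub>C S x"
    using lim[of "c *\<^sub>C x"] LIMSEQ_unique by (simp add: bounded_opsD[OF assms(1)])
qed

lemma commutant_add: "S \<in> commutant M \<Longrightarrow> T \<in> commutant M \<Longrightarrow> S + T \<in> commutant M"
  and commutant_diff: "S \<in> commutant M \<Longrightarrow> T \<in> commutant M \<Longrightarrow> S - T \<in> commutant M"
  and commutant_compose: "S \<in> commutant M \<Longrightarrow> T \<in> commutant M \<Longrightarrow> S o\<^sub>L T \<in> commutant M"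
  and commutant_scaleR: "S \<in> commutant M \<Longrightarrow> r *\<^sub>R S \<in> commutant M"
  and commutant_id: "id_blinfun \<in> commutant M"
  and commutant_zero: "0 \<in> commutant M"
  by (simp_all add: commutant_iff bounded_ops_add bounded_ops_diff bounded_ops_compose
      bounded_ops_scaleR bounded_ops_id bounded_ops_zero blinfun.bilinear_simps)

lemma commutant_scale_op:
  "M \<subseteq> bounded_ops \<Longrightarrow> S \<in> commutant M \<Longrightarrow> scale_op c S \<in> commutant M"
  by (auto simp add: commutant_iff bounded_ops_scale_op scale_op_apply bounded_opsD subset_iff)

lemma commutant_tendsto:
  fixes T :: "nat \<Rightarrow> ('h::chilbert_space \<Rightarrow>\<^sub>L 'h)"
  assumes "\<And>n. T n \<in> commutant M" "T \<longlonglongrightarrow> S"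
  shows "S \<in> commutant M"
  unfolding commutant_iff
proof safe
  show "S \<in> bounded_ops"
    using bounded_ops_tendsto[OF _ assms(2)] assms(1) commutant_bounded_ops by blast
  fix R x assume R: "R \<in> M"
  have lim: "(\<lambda>n. T n z) \<longlonglongrightarrow> S z" for z
    using blinfun.tendsto[OF assms(2) tendsto_const] .
  have "(\<lambda>n. R (T n x)) \<longlonglongrightarrow> R (S x)"
    by (rule blinfun.tendsto[OF tendsto_const lim])
  then show "S (R x) = R (S x)"
    using lim[of "R x"] LIMSEQ_unique by (simp add: commutant_apply[OF assms(1) R])
qed

lemma commutant_adj:
  fixes M :: "('h::chilbert_space \<Rightarrow>\<^sub>L 'h) set"
  assumes "M \<subseteq> bounded_ops" "\<And>T. T \<in> M \<Longrightarrow> adj T \<in> M" "S \<in> commutant M"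
  shows "adj S \<in> commutant M"
  unfolding commutant_iff
proof safe
  have S: "S \<in> bounded_ops" using assms(3) commutant_bounded_ops by blast
  then show "adj S \<in> bounded_ops" by (rule adj_bounded_ops)
  fix T x assume T: "T \<in> M"
  then have T': "T \<in> bounded_ops" using assms(1) by blast
  show "adj S (T x) = T (adj S x)"
  proof (rule subspace_eqI[OF subspace_UNIV])
    fix y
    have "inner (adj S (T x)) y = inner x (adj T (S y))" by (simp add: adj_inner[OF S] adj_inner'[OF T'])
    also have "\<dots> = inner (T (adj S x)) y"
      by (simp add: adj_inner[OF S] adj_inner'[OF T'] commutant_apply[OF assms(3) assms(2)[OF T]])
    finally show "inner (adj S (T x)) y = inner (T (adj S x)) y" .
  qed auto
qed

lemma commutant_antimono: "M \<subseteq> N \<Longrightarrow> commutant N \<subseteq> commutant M"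
  by (auto simp: commutant_def)

lemma subset_bicommutant: "M \<subseteq> bounded_ops \<Longrightarrow> M \<subseteq> commutant (commutant M)"
  by (auto simp: commutant_def)

lemma commutant3:
  assumes "M \<subseteq> bounded_ops" shows "commutant (commutant (commutant M)) = commutant M"
  using subset_bicommutant[OF commutant_bounded_ops] commutant_antimono[OF subset_bicommutant[OF assms]]
  by blast

lemma bicommutant_least:
  assumes "N \<subseteq> commutant M" "M \<subseteq> bounded_ops"
  shows "commutant (commutant N) \<subseteq> commutant M"
  using commutant_antimono[OF commutant_antimono[OF assms(1)]] commutant3[OF assms(2)] by simp

lemma orth_proj_commutant:
  fixes K :: "'h::chilbert_space set"
  assumes K: "subspace K" "closed K" "\<And>c x. x \<in> K \<Longrightarrow> c *\<^sub>C x \<in> K"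
    and M: "M \<subseteq> bounded_ops" "\<And>T. T \<in> M \<Longrightarrow> adj T \<in> M"
    and inv: "\<And>T x. T \<in> M \<Longrightarrow> x \<in> K \<Longrightarrow> blinfun_apply T x \<in> K"
  shows "orth_proj K \<in> commutant M"
  unfolding commutant_iff
proof (intro conjI ballI allI)
  show "orth_proj K \<in> bounded_ops" by (rule orth_proj_bounded_ops[OF K])
  fix T x assume "T \<in> M"
  then show "orth_proj K (T x) = T (orth_proj K x)"
    by (intro orth_proj_commute[OF K(1,2), where S = "adj T"])
      (use M inv in \<open>auto simp: adj_inner' subset_iff\<close>)
qed

lemma projections_iff:
  "M \<subseteq> bounded_ops \<Longrightarrow> p \<in> projections M \<longleftrightarrow> p \<in> M \<and> (\<forall>x. blinfun_apply p (p x) = p x) \<and> selfadjoint p"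
  using adj_eq_self_iff[of p] blinfun_eq_iff[of "p o\<^sub>L p" p] by (auto simp: projections_def)

lemma projection_apply:
  assumes "p \<in> projections bounded_ops"
  shows "blinfun_apply p (p x) = p x" "inner (p x) y = inner x (p y)" "p \<in> bounded_ops"
    "inner x (p x) = (norm (p x))\<^sup>2"
  using assms selfadjointD[of p x "p x"] selfadjointD[of p]
  by (auto simp: projections_iff power2_norm_eq_inner)

lemma orth_proj_projection:
  assumes "subspace K" "closed K" "orth_proj K \<in> bounded_ops"
  shows "orth_proj K \<in> projections bounded_ops"
  using orth_proj_idem[OF assms(1,2)] orth_proj_selfadjoint[OF assms(1,2)] assms(3)
  by (auto simp: projections_def adj_eq_self_iff)

lemma selfadjoint_id: "selfadjoint id_blinfun"
  and selfadjoint_add: "selfadjoint S \<Longrightarrow> selfadjoint T \<Longrightarrow> selfadjoint (S + T)"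
  and selfadjoint_diff: "selfadjoint S \<Longrightarrow> selfadjoint T \<Longrightarrow> selfadjoint (S - T)"
  and selfadjoint_scaleR: "selfadjoint S \<Longrightarrow> selfadjoint (r *\<^sub>R S)"
  and selfadjoint_square: "selfadjoint S \<Longrightarrow> selfadjoint (S o\<^sub>L S)"
  and selfadjoint_zero: "selfadjoint 0"
  by (simp_all add: selfadjoint_def blinfun.bilinear_simps inner_add_left inner_add_right
      inner_diff_left inner_diff_right)

text \<open>For self-adjoint a this is the von Neumann algebra generated by a. Membership plays the
  role of being a function of a: such operators commute with each other and lie in every von Neumann
  algebra containing a.\<close>

abbreviation bicommutant :: "('h::chilbert_space \<Rightarrow>\<^sub>L 'h) \<Rightarrow> ('h \<Rightarrow>\<^sub>L 'h) set" where
  "bicommutant a \<equiv> commutant (commutant {a})"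

lemma bicommutant_self: "a \<in> bounded_ops \<Longrightarrow> a \<in> bicommutant a"
  using subset_bicommutant[of "{a}"] by auto

lemma bicommutant_commute:
  assumes "a \<in> bounded_ops" "S \<in> bicommutant a" "T \<in> bicommutant a"
  shows "blinfun_apply S (T x) = T (S x)"
proof -
  have "T \<in> commutant {a}"
    using assms(1,3) commutant_antimono[of "{a}" "commutant {a}"] by (auto simp: commutant_iff)
  then show ?thesis using commutant_apply[OF assms(2)] by blast
qed

lemma bicommutant_trans: "b \<in> bicommutant a \<Longrightarrow> c \<in> bicommutant b \<Longrightarrow> c \<in> bicommutant a"
  using bicommutant_least[of "{b}" "commutant {a}"] commutant_bounded_ops by blast

lemma commutant_sa_adj:
  "a \<in> bounded_ops \<Longrightarrow> selfadjoint a \<Longrightarrow> T \<in> commutant {a} \<Longrightarrow> adj T \<in> commutant {a}"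
  by (rule commutant_adj) (auto simp: adj_eq_self_iff)

section \<open>Square roots\<close>

text \<open>The operator iteration below, run with the scalar 1 in place of X. It tends to 1 more
  slowly than any geometric rate, so convergence comes from monotonicity.\<close>

lemma sqrt_majorant:
  fixes y :: "nat \<Rightarrow> real"
  assumes y0: "y 0 = 0" and ySuc: "\<And>n. y (Suc n) = (1 + (y n)\<^sup>2) / 2"
  shows "0 \<le> y n \<and> y n \<le> 1" "Cauchy y"
proof -
  show b: "0 \<le> y n \<and> y n \<le> 1" for n
    by (induction n) (auto simp: y0 ySuc power_le_one)
  have "y n \<le> y (Suc n)" for n
    using zero_le_power2[of "1 - y n"] by (simp add: ySuc power2_diff)
  then have "incseq y" by (rule incseq_SucI)
  then have "convergent y"
    using b by (metis incseq_convergent convergent_def)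
  then show "Cauchy y" by (rule convergent_Cauchy)
qed

text \<open>With Y = 1 - sqrt (1 - X) the required equation reads Y = (X + Y^2) / 2, which is
  iterated from 0. For norm X = 1 the iteration need not be a contraction, so its increments are
  dominated by those of the scalar sequence y.\<close>

lemma sqrt_near_id:
  fixes X :: "'h::chilbert_space \<Rightarrow>\<^sub>L 'h"
  assumes X: "X \<in> bounded_ops" "selfadjoint X" "norm X \<le> 1"
  shows "\<exists>Y\<in>bicommutant X. selfadjoint Y \<and> norm Y \<le> 1 \<and>
    (id_blinfun - Y) o\<^sub>L (id_blinfun - Y) = id_blinfun - X"
proof -
  define Y where "Y = rec_nat (0 :: 'h \<Rightarrow>\<^sub>L 'h) (\<lambda>_ Z. (1/2) *\<^sub>R (X + (Z o\<^sub>L Z)))"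
  define y where "y = rec_nat (0 :: real) (\<lambda>_ z. (1 + z\<^sup>2) / 2)"
  have Y0: "Y 0 = 0" and YSuc: "Y (Suc n) = (1/2) *\<^sub>R (X + (Y n o\<^sub>L Y n))" for n by (auto simp: Y_def)
  have y0: "y 0 = 0" and ySuc: "y (Suc n) = (1 + (y n)\<^sup>2) / 2" for n by (auto simp: y_def)
  have YX: "Y n \<in> bicommutant X" for n
    by (induction n) (auto simp: Y0 YSuc intro!: commutant_zero commutant_scaleR commutant_add
        commutant_compose bicommutant_self X)
  have Ysa: "selfadjoint (Y n)" for n
    by (induction n) (auto simp: Y0 YSuc intro!: selfadjoint_zero selfadjoint_scaleR selfadjoint_add
        selfadjoint_square X)
  have y01: "0 \<le> y n \<and> y n \<le> 1" for n using sqrt_majorant(1)[of y] y0 ySuc by blast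
  have Yy: "norm (Y n) \<le> y n" for n
  proof (induction n)
    case (Suc n)
    have "norm (X + (Y n o\<^sub>L Y n)) \<le> norm X + norm (Y n) * norm (Y n)"
      using norm_triangle_ineq[of X "Y n o\<^sub>L Y n"] norm_blinfun_compose[of "Y n" "Y n"] by linarith
    also have "\<dots> \<le> 1 + (y n)\<^sup>2"
      using X(3) Suc mult_mono[OF Suc Suc] y01[of n] by (simp add: power2_eq_square)
    finally show ?case by (simp add: YSuc ySuc)
  qed (simp add: Y0 y0)
  have step: "norm (Y (Suc n) - Y n) \<le> y (Suc n) - y n" for n
  proof (induction n)
    case 0 show ?case using X(3) by (simp add: YSuc ySuc Y0 y0)
  next
    case (Suc n)
    \<comment> \<open>A difference of squares factors because all iterates lie in the bicommutant of
      X and hence commute; y satisfies the same identity, which closes the induction.\<close>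
    have "Y (Suc (Suc n)) - Y (Suc n) = (1/2) *\<^sub>R ((Y (Suc n) - Y n) o\<^sub>L (Y (Suc n) + Y n))"
      unfolding arg_cong2[OF YSuc[of "Suc n"] YSuc[of n], of minus]
      by (rule blinfun_eqI) (simp add: blinfun.bilinear_simps algebra_simps
          bicommutant_commute[OF X(1) YX[of "Suc n"] YX[of n]])
    then have "norm (Y (Suc (Suc n)) - Y (Suc n)) \<le>
        (1/2) * (norm (Y (Suc n) - Y n) * norm (Y (Suc n) + Y n))"
      using norm_blinfun_compose[of "Y (Suc n) - Y n" "Y (Suc n) + Y n"] by simp
    also have "\<dots> \<le> (1/2) * ((y (Suc n) - y n) * (y (Suc n) + y n))"
      using Suc.IH order_trans[OF norm_ge_zero Suc.IH] Yy[of "Suc n"] Yy[of n]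
        norm_triangle_ineq[of "Y (Suc n)" "Y n"]
      by (intro mult_left_mono mult_mono) (auto intro: order_trans[OF norm_ge_zero] order_trans[OF norm_ge_zero Suc.IH])
    also have "\<dots> = y (Suc (Suc n)) - y (Suc n)"
      unfolding arg_cong2[OF ySuc[of "Suc n"] ySuc[of n], of minus]
      by (simp add: power2_eq_square field_simps)
    finally show ?case .
  qed
  have diff: "norm (Y (n + k) - Y n) \<le> y (n + k) - y n" for n k
  proof (induction k)
    case (Suc k)
    have "norm (Y (n + Suc k) - Y n) \<le> norm (Y (Suc (n + k)) - Y (n + k)) + norm (Y (n + k) - Y n)"
      using norm_triangle_ineq[of "Y (Suc (n + k)) - Y (n + k)" "Y (n + k) - Y n"] by simp
    then show ?case using step[of "n + k"] Suc.IH by simp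
  qed simp
  have "Cauchy Y"
  proof (rule CauchyI')
    fix e :: real assume "0 < e"
    then obtain M where M: "\<And>m n. M \<le> m \<Longrightarrow> M \<le> n \<Longrightarrow> norm (y m - y n) < e"
      using CauchyD[OF sqrt_majorant(2)[of y]] y0 ySuc by blast
    have "dist (Y m) (Y n) < e" if "M \<le> m" "m < n" for m n
      using diff[of m "n - m"] M[of n m] that by (simp add: dist_norm norm_minus_commute)
    then show "\<exists>M. \<forall>m\<ge>M. \<forall>n>m. dist (Y m) (Y n) < e" by blast
  qed
  then obtain Z where Z: "Y \<longlonglongrightarrow> Z" using Cauchy_convergent_iff convergent_def by blast
  have lim: "(\<lambda>n. Y n x) \<longlonglongrightarrow> Z x" for x using blinfun.tendsto[OF Z tendsto_const] .
  have "(\<lambda>n. Y (Suc n)) \<longlonglongrightarrow> (1/2) *\<^sub>R (X + (Z o\<^sub>L Z))"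
    unfolding YSuc
    by (intro tendsto_scaleR tendsto_add tendsto_const Z
        bounded_bilinear.tendsto[OF bounded_bilinear_blinfun_compose])
  then have Zeq: "Z = (1/2) *\<^sub>R (X + (Z o\<^sub>L Z))" using LIMSEQ_Suc[OF Z] LIMSEQ_unique by blast
  have "(id_blinfun - Z) o\<^sub>L (id_blinfun - Z) = id_blinfun - X"
  proof (rule blinfun_eqI)
    fix x
    have "Z x = (1/2) *\<^sub>R (X x + Z (Z x))" using arg_cong[OF Zeq, of "\<lambda>T. T x"] by (simp add: blinfun.bilinear_simps)
    then have "2 *\<^sub>R Z x = 2 *\<^sub>R ((1/2) *\<^sub>R (X x + Z (Z x)))" by (rule arg_cong)
    then have "Z x + Z x = X x + Z (Z x)" by (simp only: scaleR_2 scaleR_half_double scaleR_add_right[symmetric])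
    then have "X x = Z x + Z x - Z (Z x)" by simp
    then show "((id_blinfun - Z) o\<^sub>L (id_blinfun - Z)) x = (id_blinfun - X) x"
      by (simp add: blinfun.bilinear_simps)
  qed
  moreover have "Z \<in> bicommutant X" by (rule commutant_tendsto[OF YX Z])
  moreover have "selfadjoint Z"
    unfolding selfadjoint_def
  proof (intro allI)
    fix u v
    have "(\<lambda>n. inner (Y n u) v) \<longlonglongrightarrow> inner (Z u) v" "(\<lambda>n. inner u (Y n v)) \<longlonglongrightarrow> inner u (Z v)"
      by (intro tendsto_intros lim)+
    then show "inner (Z u) v = inner u (Z v)" using LIMSEQ_unique selfadjointD[OF Ysa] by simp
  qed
  moreover have "norm Z \<le> 1"
    by (rule LIMSEQ_le_const2[OF tendsto_norm[OF Z]]) (use Yy y01 order_trans in blast)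
  ultimately show ?thesis by blast
qed

text \<open>Writing \<open>\<bar>b\<bar>\<close> as the square of a self-adjoint \<open>d\<close> expresses its positivity algebraically, so
  that automorphisms visibly preserve it.\<close>

lemma abs_operator_exists:
  fixes b :: "'h::chilbert_space \<Rightarrow>\<^sub>L 'h"
  assumes b: "b \<in> bounded_ops" "selfadjoint b"
  shows "\<exists>d\<in>bicommutant b. selfadjoint d \<and> (d o\<^sub>L d) o\<^sub>L (d o\<^sub>L d) = b o\<^sub>L b"
proof -
  \<comment> \<open>The summand 1 keeps s positive when b = 0.\<close>
  define s where "s = norm b + 1"
  have s: "0 < s" using norm_ge_zero[of b] by (simp add: s_def add_nonneg_pos)
  define b' where "b' = (1 / s) *\<^sub>R b"
  have b': "b' \<in> bicommutant b" "selfadjoint b'" "norm b' \<le> 1"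
    using b s by (auto simp: b'_def s_def intro!: commutant_scaleR bicommutant_self selfadjoint_scaleR)
  define X where "X = id_blinfun - (b' o\<^sub>L b')"
  have X: "X \<in> bicommutant b" "selfadjoint X"
    using b' by (auto simp: X_def intro!: commutant_diff commutant_id commutant_compose selfadjoint_diff
        selfadjoint_id selfadjoint_square)
  have "norm X \<le> 1"
  proof (rule norm_blinfun_bound)
    fix x
    have "norm (b' (b' x)) \<le> norm (b' x)"
      using norm_blinfun[of b' "b' x"] mult_right_mono[OF b'(3) norm_ge_zero[of "b' x"]] by simp
    then have "inner (b' (b' x)) (b' (b' x)) \<le> inner (b' x) (b' x)" by (simp add: norm_le)
    moreover have "inner (X x) (X x) = inner x x - 2 * inner (b' x) (b' x) + inner (b' (b' x)) (b' (b' x))"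
      using selfadjointD[OF b'(2), of x "b' x"] selfadjointD[OF b'(2), of "b' x" x]
      by (simp add: X_def blinfun.bilinear_simps inner_diff_left inner_diff_right inner_commute)
    moreover have "0 \<le> inner (b' x) (b' x)" by simp
    ultimately have "inner (X x) (X x) \<le> inner x x" by linarith
    then show "norm (X x) \<le> 1 * norm x" by (simp add: norm_le)
  qed simp
  then obtain Y where Y: "Y \<in> bicommutant X" "selfadjoint Y" "norm Y \<le> 1"
    "(id_blinfun - Y) o\<^sub>L (id_blinfun - Y) = id_blinfun - X"
    using sqrt_near_id[of X] X commutant_bounded_ops by blast
  \<comment> \<open>Here 1 - X is the square of b', so 1 - Y is its absolute value. The bound on the
    norm of Y permits a second root, 1 - Z, which becomes d after rescaling.\<close>
  obtain Z where Z: "Z \<in> bicommutant Y" "selfadjoint Z"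
    "(id_blinfun - Z) o\<^sub>L (id_blinfun - Z) = id_blinfun - Y"
    using sqrt_near_id[of Y] Y commutant_bounded_ops by blast
  define d where "d = sqrt s *\<^sub>R (id_blinfun - Z)"
  have "Z \<in> bicommutant b" using X(1) Y(1) Z(1) bicommutant_trans by blast
  then have "d \<in> bicommutant b" by (simp add: d_def commutant_scaleR commutant_diff commutant_id)
  moreover have "selfadjoint d" by (simp add: d_def selfadjoint_scaleR selfadjoint_diff selfadjoint_id Z)
  moreover have dd: "d o\<^sub>L d = s *\<^sub>R (id_blinfun - Y)"
  proof (rule blinfun_eqI)
    fix x
    have "(d o\<^sub>L d) x = s *\<^sub>R ((id_blinfun - Z) o\<^sub>L (id_blinfun - Z)) x"
      using s by (simp add: d_def blinfun.bilinear_simps scaleR_diff_right)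
    then show "(d o\<^sub>L d) x = (s *\<^sub>R (id_blinfun - Y)) x" unfolding Z(3) by (simp add: blinfun.bilinear_simps)
  qed
  moreover have "(d o\<^sub>L d) o\<^sub>L (d o\<^sub>L d) = b o\<^sub>L b"
  proof (rule blinfun_eqI)
    fix x
    have "((d o\<^sub>L d) o\<^sub>L (d o\<^sub>L d)) x = (s * s) *\<^sub>R ((id_blinfun - Y) o\<^sub>L (id_blinfun - Y)) x"
      unfolding dd by (simp add: blinfun.bilinear_simps scaleR_diff_right)
    also have "\<dots> = (s * s) *\<^sub>R b' (b' x)" unfolding Y(4) by (simp add: X_def blinfun.bilinear_simps)
    also have "\<dots> = b (b x)" using s by (simp add: b'_def blinfun.bilinear_simps)
    finally show "((d o\<^sub>L d) o\<^sub>L (d o\<^sub>L d)) x = (b o\<^sub>L b) x" by simp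
  qed
  ultimately show ?thesis by blast
qed


section \<open>Spectral cuts\<close>

lemma kernel_subspace: "subspace {x. blinfun_apply T x = 0}"
  by (simp add: subspace_def blinfun.bilinear_simps)

lemma kernel_closed: "closed {x. blinfun_apply T x = 0}"
  by (intro closed_Collect_eq continuous_intros)

text \<open>\<open>p\<close> is the spectral projection of \<open>a\<close> for \<open>{..l}\<close>. The strict inequality makes the cut unique
  and right continuous in \<open>l\<close>.\<close>

definition spectral_cut :: "('h::chilbert_space \<Rightarrow>\<^sub>L 'h) \<Rightarrow> real \<Rightarrow> ('h \<Rightarrow>\<^sub>L 'h) \<Rightarrow> bool" where
  "spectral_cut a l p \<longleftrightarrow> p \<in> projections bounded_ops \<and> (\<forall>x. p (a x) = a (p x)) \<and>
     (\<forall>x. p x = x \<longrightarrow> inner x (a x) \<le> l * inner x x) \<and>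
     (\<forall>x. p x = 0 \<longrightarrow> x \<noteq> 0 \<longrightarrow> l * inner x x < inner x (a x))"

definition cut :: "('h::chilbert_space \<Rightarrow>\<^sub>L 'h) \<Rightarrow> real \<Rightarrow> ('h \<Rightarrow>\<^sub>L 'h)" where
  "cut a l = (THE p. p \<in> bicommutant a \<and> spectral_cut a l p)"

lemma spectral_cut_kernel:
  fixes a b d :: "'h::chilbert_space \<Rightarrow>\<^sub>L 'h"
  defines "K \<equiv> {x. blinfun_apply ((d o\<^sub>L d) + b) x = 0}"
  assumes a: "a \<in> bounded_ops" "selfadjoint a" and b: "b = a - l *\<^sub>R id_blinfun"
    and d: "d \<in> bounded_ops" "selfadjoint d" "\<And>x. d (a x) = a (d x)"
      "(d o\<^sub>L d) o\<^sub>L (d o\<^sub>L d) = b o\<^sub>L b"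
  shows "spectral_cut a l (orth_proj K)"
proof -
  have K: "subspace K" "closed K" unfolding K_def by (rule kernel_subspace kernel_closed)+
  have memK: "x \<in> K \<longleftrightarrow> d (d x) + b x = 0" for x by (simp add: K_def blinfun.bilinear_simps)
  have bb: "b \<in> bounded_ops" unfolding b by (intro bounded_ops_diff bounded_ops_scaleR bounded_ops_id a)
  have bsa: "selfadjoint b" unfolding b by (intro selfadjoint_diff selfadjoint_scaleR selfadjoint_id a)
  have db: "d (b x) = b (d x)" for x by (simp add: b blinfun.bilinear_simps d(3))
  have d4: "d (d (d (d x))) = b (b x)" for x using d(4)[THEN arg_cong, of "\<lambda>T. T x"] by simp
  have KC: "c *\<^sub>C x \<in> K" if "x \<in> K" for c x
    using that by (simp add: memK bounded_opsD[OF d(1)] bounded_opsD[OF bb] scaleC_add_right[symmetric])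
  have Ka: "a ` K \<subseteq> K"
  proof clarify
    fix x assume "x \<in> K"
    then have "a (d (d x) + b x) = 0" by (simp add: memK)
    then show "a x \<in> K" by (simp add: memK d(3) b blinfun.bilinear_simps)
  qed
  have bx: "inner x (b x) = inner x (a x) - l * inner x x" for x
    by (simp add: b blinfun.bilinear_simps inner_diff_right)
  have dx: "inner x (d (d x)) = inner (d x) (d x)" for x using selfadjointD[OF d(2)] by metis
  show ?thesis
    unfolding spectral_cut_def
  proof (intro conjI allI impI)
    show "orth_proj K \<in> projections bounded_ops"
      by (rule orth_proj_projection[OF K orth_proj_bounded_ops[OF K KC]])
    show "orth_proj K (a x) = a (orth_proj K x)" for x
      by (rule orth_proj_commute[OF K selfadjointD[OF a(2)] Ka Ka])
  next
    fix x assume "orth_proj K x = x"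
    then have "d (d x) + b x = 0" using orth_proj_fix[OF K] memK by blast
    then have "inner x (b x) = - inner x (d (d x))" by (metis add_eq_0_iff inner_minus_right)
    then show "inner x (a x) \<le> l * inner x x"
      using bx[of x] dx[of x] inner_ge_zero[of "d x"] by (smt (verit))
  next
    fix x assume px: "orth_proj K x = 0" and x0: "x \<noteq> 0"
    \<comment> \<open>The product of d^2 + b and d^2 - b is d^4 - b^2 = 0, so d^2 - b maps into K;
      being symmetric, it vanishes on the orthogonal complement of K.\<close>
    have K_diff: "d (d z) - b z \<in> K" for z
      by (simp add: memK blinfun.bilinear_simps d4 db)
    have "d (d x) - b x = 0"
    proof (rule subspace_eqI[OF K(1) K_diff])
      show "0 \<in> K" by (simp add: memK)
      fix y
      have "inner (d (d x) - b x) y = inner x (d (d y) - b y)"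
        by (simp add: inner_diff_left inner_diff_right selfadjointD[OF d(2)] selfadjointD[OF bsa])
      also have "\<dots> = inner (orth_proj K x) (d (d y) - b y)" using orth_proj_inner[OF K K_diff] by simp
      finally show "inner (d (d x) - b x) y = inner 0 y" using px by simp
    qed
    then have eq: "b x = d (d x)" by simp
    have "d x \<noteq> 0"
    proof
      assume "d x = 0"
      then have "x \<in> K" using eq by (simp add: memK)
      then show False using px x0 orth_proj_fix[OF K] by metis
    qed
    then have "0 < inner (d x) (d x)" by simp
    then show "l * inner x x < inner x (a x)" using bx[of x] dx[of x] eq by (smt (verit))
  qed
qed

text \<open>The cut p commutes with a, hence with the element p' of the bicommutant. If they
  differed, a nonzero vector would lie in the range of one and the kernel of the other, where the
  form of a is both at most l and above l. As only p' has to lie in the bicommutant, a cut obtained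
  by transport or from another spectral measure is identified as well.\<close>

lemma spectral_cut_unique:
  fixes a p p' :: "'h::chilbert_space \<Rightarrow>\<^sub>L 'h"
  assumes p: "spectral_cut a l p" and p': "spectral_cut a l p'" "p' \<in> bicommutant a"
  shows "p = p'"
proof -
  have "p \<in> commutant {a}" using p by (auto simp: spectral_cut_def commutant_iff projection_apply(3))
  then have comm: "p' (p x) = p (p' x)" for x using commutant_apply[OF p'(2)] by blast
  have pp: "p (p x) = p x" and pp': "p' (p' x) = p' x" for x
    using p p' projection_apply(1) by (auto simp: spectral_cut_def)
  have strict: False if "x \<noteq> 0" "u x = x" "v x = 0" "spectral_cut a l u" "spectral_cut a l v"
    for u v :: "'h \<Rightarrow>\<^sub>L 'h" and x
    using that by (fastforce simp: spectral_cut_def)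
  have 1: "p' (p x) = p x" for x
  proof (rule ccontr)
    assume "p' (p x) \<noteq> p x"
    then show False
      using strict[of "p x - p' (p x)" p p'] p p'(1) by (auto simp: blinfun.diff_right pp pp' comm)
  qed
  have 2: "p (p' x) = p' x" for x
  proof (rule ccontr)
    assume "p (p' x) \<noteq> p' x"
    then show False
      using strict[of "p' x - p (p' x)" p' p] p p'(1) by (auto simp: blinfun.diff_right pp pp' comm)
  qed
  show ?thesis using 1 2 comm by (metis blinfun_eqI)
qed

text \<open>The witnesses b and d are exposed because an automorphism has to be applied to
  them.\<close>

lemma spectral_cut_exists:
  fixes a :: "'h::chilbert_space \<Rightarrow>\<^sub>L 'h"
  assumes a: "a \<in> bounded_ops" "selfadjoint a"
  obtains b d where "b = a - l *\<^sub>R id_blinfun" "d \<in> bicommutant a" "selfadjoint d"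
    "(d o\<^sub>L d) o\<^sub>L (d o\<^sub>L d) = b o\<^sub>L b"
    "orth_proj {x. blinfun_apply ((d o\<^sub>L d) + b) x = 0} \<in> bicommutant a"
    "spectral_cut a l (orth_proj {x. blinfun_apply ((d o\<^sub>L d) + b) x = 0})"
proof -
  define b where "b = a - l *\<^sub>R id_blinfun"
  have b: "b \<in> bicommutant a" "selfadjoint b"
    unfolding b_def by (intro commutant_diff commutant_scaleR commutant_id bicommutant_self
        selfadjoint_diff selfadjoint_scaleR selfadjoint_id a)+
  then obtain d where d: "d \<in> bicommutant b" "selfadjoint d" "(d o\<^sub>L d) o\<^sub>L (d o\<^sub>L d) = b o\<^sub>L b"
    using abs_operator_exists[of b] commutant_bounded_ops by blast
  have da: "d \<in> bicommutant a" using bicommutant_trans b(1) d(1) by blast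
  have comm: "d (a x) = a (d x)" for x
    using bicommutant_commute[OF a(1) da bicommutant_self[OF a(1)]] .
  define S where "S = (d o\<^sub>L d) + b"
  have S: "S \<in> bicommutant a" unfolding S_def by (intro commutant_add commutant_compose da b)
  have "orth_proj {x. S x = 0} \<in> bicommutant a"
  proof (rule orth_proj_commutant[OF kernel_subspace kernel_closed])
    fix T x assume "T \<in> commutant {a}" "x \<in> {x. S x = 0}"
    then show "T x \<in> {x. S x = 0}" using commutant_apply[OF S] by simp
  next
    fix c x assume "x \<in> {x. S x = 0}"
    moreover have "S \<in> bounded_ops" using S commutant_bounded_ops by blast
    ultimately show "c *\<^sub>C x \<in> {x. S x = 0}" by (simp add: bounded_opsD)
  qed (use commutant_sa_adj[OF a] commutant_bounded_ops in auto)
  moreover have "spectral_cut a l (orth_proj {x. S x = 0})"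
    unfolding S_def using spectral_cut_kernel[OF a b_def _ d(2) comm d(3)] da commutant_bounded_ops by blast
  ultimately show ?thesis using that[OF b_def da d(2,3)] unfolding S_def by blast
qed

text \<open>By Pythagoras the squared distance of two terms is the drop of |p n x|^2, a bounded
  monotone sequence. The convergence is pointwise, not in operator norm.\<close>

lemma convergent_decseq_projections:
  fixes p :: "nat \<Rightarrow> ('h::chilbert_space \<Rightarrow>\<^sub>L 'h)"
  assumes p: "\<And>n. p n \<in> projections bounded_ops"
    and dec: "\<And>m n x. m \<le> n \<Longrightarrow> p m (p n x) = p n x"
  obtains w where "(\<lambda>n. p n x) \<longlonglongrightarrow> w" "\<And>n. p n w = w"
proof -
  define u where "u n = (norm (p n x))\<^sup>2" for n
  have dist: "(norm (p m x - p n x))\<^sup>2 = u m - u n" if "m \<le> n" for m n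
  proof -
    have "inner (p m x) (p n x) = u n"
      using projection_apply(2)[OF p, of m x "p n x"] dec[OF that] projection_apply(4)[OF p, of x n]
      by (simp add: u_def)
    then show ?thesis by (simp add: u_def power2_norm_eq_inner inner_diff_left inner_diff_right inner_commute)
  qed
  have "decseq u"
    unfolding decseq_def using dist zero_le_power2 by (metis diff_ge_0_iff_ge)
  moreover have "0 \<le> u n" for n by (simp add: u_def)
  ultimately have "Cauchy u"
    using decseq_convergent[of u 0] convergent_def convergent_Cauchy by metis
  have "Cauchy (\<lambda>n. p n x)"
  proof (rule CauchyI')
    fix e :: real assume e: "0 < e"
    then obtain M where M: "\<And>m n. M \<le> m \<Longrightarrow> M \<le> n \<Longrightarrow> norm (u m - u n) < e\<^sup>2"
      using CauchyD[OF \<open>Cauchy u\<close>, of "e\<^sup>2"] by auto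
    have "dist (p m x) (p n x) < e" if "M \<le> m" "m < n" for m n
    proof -
      have "(norm (p m x - p n x))\<^sup>2 < e\<^sup>2" using dist[of m n] M[of m n] that by simp
      then show ?thesis using e by (simp add: dist_norm power2_less_imp_less)
    qed
    then show "\<exists>M. \<forall>m\<ge>M. \<forall>n>m. dist (p m x) (p n x) < e" by blast
  qed
  then obtain w where w: "(\<lambda>n. p n x) \<longlonglongrightarrow> w" using Cauchy_convergent_iff convergent_def by blast
  have "p n w = w" for n
  proof (rule LIMSEQ_unique[OF _ w])
    have "(\<lambda>m. p n (p m x)) \<longlonglongrightarrow> p n w" by (rule blinfun.tendsto[OF tendsto_const w])
    moreover have "\<forall>\<^sub>F m in sequentially. p n (p m x) = p m x"
      using eventually_ge_at_top[of n] by eventually_elim (rule dec)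
    ultimately show "(\<lambda>m. p m x) \<longlonglongrightarrow> p n w" by (rule Lim_transform_eventually)
  qed
  then show ?thesis using that w by blast
qed

lemma norm_projection_le: "p \<in> projections bounded_ops \<Longrightarrow> norm (blinfun_apply p x) \<le> norm x"
proof -
  assume p: "p \<in> projections bounded_ops"
  have "(norm (p x))\<^sup>2 \<le> norm x * norm (p x)"
    using projection_apply(4)[OF p, of x] norm_cauchy_schwarz[of x "p x"] by simp
  then show ?thesis by (cases "norm (p x) = 0") (auto simp: power2_eq_square mult_le_cancel_right)
qed

text \<open>After n bisections each piece has width (t - s) / 2^n and the increments of m telescope,
  so the total bound tends to 0. As m may jump, this takes the place of differentiating g. Operator
  identities are reduced to it by letting g compare both sides cut off at t.\<close>

lemma eq_if_increments_quadratic: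
  fixes g m :: "real \<Rightarrow> real"
  assumes "\<And>s t. s \<le> t \<Longrightarrow> \<bar>g t - g s\<bar> \<le> (t - s) * (m t - m s)" "s \<le> t"
  shows "g t = g s"
proof -
  have halve: "\<bar>g t - g s\<bar> \<le> (t - s) / 2 ^ n * (m t - m s)" if "s \<le> t" for n s t
    using that
  proof (induction n arbitrary: s t)
    case 0 then show ?case using assms(1) by simp
  next
    case (Suc n)
    define u where "u = (s + t) / 2"
    have u: "s \<le> u" "u \<le> t" "u - s = (t - s) / 2" "t - u = (t - s) / 2"
      using Suc.prems by (auto simp: u_def field_simps)
    have "\<bar>g t - g s\<bar> \<le> \<bar>g t - g u\<bar> + \<bar>g u - g s\<bar>" by simp
    also have "\<dots> \<le> (t - s) / 2 / 2 ^ n * (m t - m u) + (t - s) / 2 / 2 ^ n * (m u - m s)"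
      using Suc.IH[OF u(1)] Suc.IH[OF u(2)] u(3,4) by simp
    also have "\<dots> = (t - s) / 2 ^ Suc n * (m t - m s)" by (simp add: field_simps)
    finally show ?case .
  qed
  have "(\<lambda>n. (t - s) / 2 ^ n * (m t - m s)) \<longlonglongrightarrow> 0"
    by (intro tendsto_mult_left_zero LIMSEQ_divide_realpow_zero) simp
  then have "\<bar>g t - g s\<bar> \<le> 0"
    by (rule LIMSEQ_le_const) (use halve[OF assms(2)] in auto)
  then show ?thesis by simp
qed

section \<open>The family of cuts of one self-adjoint operator\<close>

context
  fixes a :: "'h::chilbert_space \<Rightarrow>\<^sub>L 'h"
  assumes a: "a \<in> bounded_ops" "selfadjoint a"
begin

lemma cut: "cut a l \<in> bicommutant a" "spectral_cut a l (cut a l)"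
proof -
  have "\<exists>!p. p \<in> bicommutant a \<and> spectral_cut a l p"
    using spectral_cut_exists[OF a] spectral_cut_unique by metis
  from theI'[OF this] show "cut a l \<in> bicommutant a" "spectral_cut a l (cut a l)"
    unfolding cut_def by auto
qed

lemma cut_eqI: "spectral_cut a l p \<Longrightarrow> cut a l = p"
  using spectral_cut_unique[OF _ cut(2,1)] by metis

lemma cut_projection: "cut a l \<in> projections bounded_ops"
  and cut_commute: "cut a l (a x) = a (cut a l x)"
  and cut_le: "cut a l x = x \<Longrightarrow> inner x (a x) \<le> l * inner x x"
  and cut_gt: "cut a l x = 0 \<Longrightarrow> x \<noteq> 0 \<Longrightarrow> l * inner x x < inner x (a x)"
  using cut(2)[of l] by (auto simp: spectral_cut_def)

lemma cut_ge: "cut a l x = 0 \<Longrightarrow> l * inner x x \<le> inner x (a x)"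
  using cut_gt by (cases "x = 0") force+

lemma cut_cut_commute: "cut a l (cut a m x) = cut a m (cut a l x)"
  by (rule bicommutant_commute[OF a(1) cut(1) cut(1)])

lemma cut_mono: "l \<le> m \<Longrightarrow> cut a m (cut a l x) = cut a l x"
proof (rule ccontr)
  assume lm: "l \<le> m" and ne: "cut a m (cut a l x) \<noteq> cut a l x"
  define z where "z = cut a l x - cut a m (cut a l x)"
  have z0: "z \<noteq> 0" using ne by (simp add: z_def)
  have "cut a l z = z" "cut a m z = 0"
    by (auto simp: z_def blinfun.diff_right projection_apply(1)[OF cut_projection] cut_cut_commute[of l m])
  then have "m * inner z z < l * inner z z" using cut_gt[OF _ z0] cut_le by force
  moreover have "0 < inner z z" using z0 by simp
  ultimately show False using lm by (simp add: mult_less_cancel_right)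
qed

lemma cut_mono': "l \<le> m \<Longrightarrow> cut a l (cut a m x) = cut a l x"
  using cut_mono cut_cut_commute by simp

lemma quad_form_bound: "\<bar>inner x (a x)\<bar> \<le> norm a * inner x x"
proof -
  have "\<bar>inner x (a x)\<bar> \<le> norm x * norm (a x)" by (rule Cauchy_Schwarz_ineq2)
  also have "\<dots> \<le> norm x * (norm a * norm x)" by (intro mult_left_mono norm_blinfun) simp
  finally show ?thesis by (simp add: power2_norm_eq_inner[symmetric] power2_eq_square algebra_simps)
qed

text \<open>The inequality is strict because - norm a may be an eigenvalue; at the upper end l =
  norm a already suffices. Hence the base point - norm a - 1 further on.\<close>

lemma cut_low: "l < - norm a \<Longrightarrow> cut a l = 0"
proof (rule blinfun_eqI, rule ccontr)
  fix x assume l: "l < - norm a" and ne: "cut a l x \<noteq> (0 :: 'h \<Rightarrow>\<^sub>L 'h) x"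
  define z where "z = cut a l x"
  have "0 < inner z z" using ne by (simp add: z_def)
  moreover have "inner z (a z) \<le> l * inner z z"
    by (rule cut_le) (simp add: z_def projection_apply(1)[OF cut_projection])
  ultimately show False using quad_form_bound[of z] l mult_strict_right_mono[of l "- norm a" "inner z z"]
    by linarith
qed

lemma cut_high: "norm a \<le> l \<Longrightarrow> cut a l = id_blinfun"
proof (rule blinfun_eqI, rule ccontr)
  fix x assume l: "norm a \<le> l" and ne: "cut a l x \<noteq> id_blinfun x"
  define z where "z = x - cut a l x"
  have z0: "z \<noteq> 0" using ne by (simp add: z_def)
  have "l * inner z z < inner z (a z)"
    by (rule cut_gt) (use z0 in \<open>auto simp: z_def blinfun.diff_right projection_apply(1)[OF cut_projection]\<close>)
  then show False using quad_form_bound[of z] l mult_right_mono[of "norm a" l "inner z z"] by auto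
qed

text \<open>The operator q is the spectral projection for {s<..t}. On its range a lies between s and
  t, the source of the factor t - s in every application of
  \<open>eq_if_increments_quadratic\<close>.\<close>

lemma cut_increment:
  assumes "s \<le> t"
  defines "q \<equiv> cut a t - cut a s"
  shows "q (q x) = q x" "inner (q x) y = inner x (q y)"
    "(norm (q x))\<^sup>2 = (norm (cut a t x))\<^sup>2 - (norm (cut a s x))\<^sup>2"
    "q z = z \<Longrightarrow> s * inner z z \<le> inner z (a z)" "q z = z \<Longrightarrow> inner z (a z) \<le> t * inner z z"
proof -
  note pr = projection_apply[OF cut_projection]
  show idem: "q (q x) = q x" for x
    by (simp add: q_def blinfun.bilinear_simps pr(1) cut_mono[OF assms(1)] cut_mono'[OF assms(1)])
  show sa: "inner (q x) y = inner x (q y)" for x y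
    by (simp add: q_def blinfun.bilinear_simps inner_diff_left inner_diff_right pr(2))
  show "(norm (q x))\<^sup>2 = (norm (cut a t x))\<^sup>2 - (norm (cut a s x))\<^sup>2"
    using sa[of x "q x"] by (simp add: power2_norm_eq_inner idem)
      (simp add: q_def blinfun.bilinear_simps inner_diff_right pr(4) power2_norm_eq_inner)
  show "s * inner z z \<le> inner z (a z)" if "q z = z"
  proof (rule cut_ge)
    have "cut a s (q z) = 0" by (simp add: q_def blinfun.bilinear_simps pr(1) cut_mono'[OF assms(1)])
    then show "cut a s z = 0" using that by simp
  qed
  show "inner z (a z) \<le> t * inner z z" if "q z = z"
  proof (rule cut_le)
    have "cut a t (q z) = q z" by (simp add: q_def blinfun.bilinear_simps pr(1) cut_mono[OF assms(1)])
    then show "cut a t z = z" using that by simp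
  qed
qed

lemma cut_right_continuous: "((\<lambda>m. (norm (cut a m x))\<^sup>2) \<longlongrightarrow> (norm (cut a l x))\<^sup>2) (at_right l)"
proof (rule tendsto_at_right_sequentially[of l "l + 1"])
  fix S :: "nat \<Rightarrow> real"
  assume S: "\<And>n. l < S n" "decseq S" "S \<longlonglongrightarrow> l"
  obtain w where w: "(\<lambda>n. cut a (S n) x) \<longlonglongrightarrow> w" "\<And>n. cut a (S n) w = w"
    by (rule convergent_decseq_projections[of "\<lambda>n. cut a (S n)" x])
      (use S(2) cut_projection cut_mono in \<open>auto simp: decseq_def\<close>)
  \<comment> \<open>The part of w cut off at l is fixed by all cuts at S n, so its form is at most l
    |z|^2 in the limit. The strict inequality on the kernel of the cut then leaves only z =
    0.\<close>
  define z where "z = w - cut a l w"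
  have zl: "cut a l z = 0" by (simp add: z_def blinfun.diff_right projection_apply(1)[OF cut_projection])
  have "cut a (S n) z = z" for n
    using w(2) S(1)[of n] by (simp add: z_def blinfun.diff_right cut_mono)
  then have "inner z (a z) \<le> S n * inner z z" for n using cut_le by blast
  moreover have "(\<lambda>n. S n * inner z z) \<longlonglongrightarrow> l * inner z z" by (intro tendsto_intros S(3))
  ultimately have "inner z (a z) \<le> l * inner z z" by (intro LIMSEQ_le_const) auto
  then have "z = 0" using cut_gt[OF zl] by force
  then have "cut a l w = w" by (simp add: z_def)
  moreover have "cut a l w = cut a l x"
  proof (rule LIMSEQ_unique)
    show "(\<lambda>n. cut a l (cut a (S n) x)) \<longlonglongrightarrow> cut a l w" by (rule blinfun.tendsto[OF tendsto_const w(1)])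
    show "(\<lambda>n. cut a l (cut a (S n) x)) \<longlonglongrightarrow> cut a l x" 
      by (simp add: cut_mono'[OF less_imp_le[OF S(1)]])
  qed
  ultimately show "(\<lambda>n. (norm (cut a (S n) x))\<^sup>2) \<longlonglongrightarrow> (norm (cut a l x))\<^sup>2"
    using w(1) by (auto intro!: tendsto_intros)
qed simp

text \<open>The commutator W commutes with each increment q, and on the range of q the operator a
  equals s up to t - s. The matrix entries of W, cut off at t, thus have quadratically small
  increments and vanish.\<close>

lemma commute_if_commute_cuts:
  assumes R: "R \<in> bounded_ops" and comm: "\<And>l x. R (cut a l x) = cut a l (R x)"
  shows "R (a x) = a (R x)"
proof (rule subspace_eqI[OF subspace_UNIV])
  fix y
  define W where "W = (R o\<^sub>L a) - (a o\<^sub>L R)"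
  define g where "g t = inner y (W (cut a t x))" for t
  define n where "n t z = (norm (cut a t z))\<^sup>2" for t z
  \<comment> \<open>The four squared norms come from the two mixed terms of the commutator, each
    bounded by half a sum of squares.\<close>
  define m where "m t = (n t (adj R y) + n t x + (n t y + n t (R x))) / 2" for t
  have adj_comm: "adj R (cut a l z) = cut a l (adj R z)" for l z
    by (rule subspace_eqI[OF subspace_UNIV])
      (simp_all add: adj_inner[OF R] projection_apply(2)[OF cut_projection] comm)
  have "\<bar>g t - g s\<bar> \<le> (t - s) * (m t - m s)" if st: "s \<le> t" for s t
  proof -
    define q where "q = cut a t - cut a s"
    note q = cut_increment[OF st, folded q_def]
    \<comment> \<open>Subtracting the scalar s leaves the commutator unchanged and confines the form
      to between 0 and t - s on the range of q.\<close>
    define b where "b = a - s *\<^sub>R id_blinfun"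
    have Wq: "W (q z) = q (W z)" for z
      by (simp add: W_def q_def blinfun.diff_left blinfun.diff_right comm cut_commute[symmetric])
    have qR: "q (R z) = R (q z)" "q (adj R z) = adj R (q z)" for z
      by (simp_all add: q_def blinfun.bilinear_simps comm adj_comm)
    have Wb: "W z = R (b z) - b (R z)" for z by (simp add: W_def b_def blinfun.bilinear_simps)
    have bsym: "inner (b u) v = inner u (b v)" for u v
      by (simp add: b_def blinfun.bilinear_simps inner_diff_left inner_diff_right selfadjointD[OF a(2)])
    have quad: "0 \<le> inner z (b z)" "inner z (b z) \<le> (t - s) * inner z z" if "q z = z" for z
      using q(4,5)[OF that] by (auto simp: b_def blinfun.bilinear_simps inner_diff_right algebra_simps)
    \<comment> \<open>Polarisation: both quadratic values lie between 0 and their bounds, so their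
      difference is at most the larger bound, and the parallelogram law evaluates the sum of the
      bounds.\<close>
    have form: "\<bar>inner u (b v)\<bar> \<le> (t - s) / 2 * (inner u u + inner v v)" if "q u = u" "q v = v" for u v
    proof -
      have 1: "q (u + v) = u + v" "q (u - v) = u - v" using that by (auto simp: blinfun.bilinear_simps)
      have "4 * inner u (b v) = inner (u + v) (b (u + v)) - inner (u - v) (b (u - v))"
        using bsym[of v u]
        by (simp add: blinfun.add_right blinfun.diff_right inner_add_left inner_add_right
            inner_diff_left inner_diff_right inner_commute[of u "b v"])
      moreover have "(t - s) * inner (u + v) (u + v) + (t - s) * inner (u - v) (u - v) =
          2 * ((t - s) * (inner u u + inner v v))"
        by (simp add: inner_add_left inner_add_right inner_diff_left inner_diff_right algebra_simps)
      ultimately show ?thesis using quad[OF 1(1)] quad[OF 1(2)] by linarith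
    qed
    have "g t - g s = inner y (W (q x))"
      by (simp add: g_def q_def blinfun.bilinear_simps inner_diff_right)
    also have "\<dots> = inner (q y) (W (q x))" using Wq[of "q x"] q(2)[of y "W (q x)"] by (simp add: q(1))
    also have "\<dots> = inner (q (adj R y)) (b (q x)) - inner (q y) (b (q (R x)))"
      by (simp add: Wb inner_diff_right qR adj_inner[OF R])
    finally have "\<bar>g t - g s\<bar> \<le> (t - s) / 2 * (inner (q (adj R y)) (q (adj R y)) + inner (q x) (q x)) +
       (t - s) / 2 * (inner (q y) (q y) + inner (q (R x)) (q (R x)))"
      using form[of "q (adj R y)" "q x", OF q(1) q(1)] form[of "q y" "q (R x)", OF q(1) q(1)] by linarith
    also have "\<dots> = (t - s) * (m t - m s)"
      by (simp add: power2_norm_eq_inner[symmetric] q(3) m_def n_def field_simps)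
    finally show ?thesis .
  qed
  moreover have "- norm a - 1 \<le> norm a" using norm_ge_zero[of a] by linarith
  ultimately have "g (norm a) = g (- norm a - 1)" by (rule eq_if_increments_quadratic[of g m])
  then have "inner y (W x) = 0" by (simp add: g_def cut_high cut_low)
  then show "inner (R (a x)) y = inner (a (R x)) y"
    by (simp add: W_def blinfun.bilinear_simps inner_diff_right inner_commute)
qed auto

end


section \<open>The spectral theorem\<close>

text \<open>The half-lines generate the Borel sets and are stable under intersection. Induction over
  disjoint unions suits spectral projections, which are summed only over disjoint families.\<close>

lemma borel_induct_atMost [consumes 1, case_names atMost empty compl union]:
  fixes B :: "real set"
  assumes "B \<in> sets borel"
    and "\<And>l. P {..l}" "P {}" "\<And>A. A \<in> sets borel \<Longrightarrow> P A \<Longrightarrow> P (- A)"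
    and "\<And>F. disjoint_family F \<Longrightarrow> range F \<subseteq> sets borel \<Longrightarrow> (\<And>i::nat. P (F i)) \<Longrightarrow> P (\<Union>i. F i)"
  shows "P B"
proof -
  have borel: "sets borel = sigma_sets UNIV (range (\<lambda>a. {..a::real}))"
    by (simp add: borel_eq_atMost)
  have stable: "Int_stable (range (\<lambda>a. {..a::real}))" by (auto simp: Int_stable_def)
  have closed: "range (\<lambda>a. {..a::real}) \<subseteq> Pow UNIV" by simp
  have "B \<in> sigma_sets UNIV (range (\<lambda>a. {..a::real}))" using assms(1) borel by simp
  with stable closed show ?thesis
  proof (induction rule: sigma_sets_induct_disjoint)
    case (compl A) then show ?case using assms(4)[of A] borel by (simp add: Compl_eq_Diff_UNIV)
  next
    case (union F) then show ?case using assms(5)[of F] borel by blast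
  qed (use assms(2,3) in auto)
qed

text \<open>Expanding the form at x + S x leaves 2 |S x|^2.\<close>

lemma selfadjoint_eq_0I:
  assumes "selfadjoint S" "\<And>x. inner x (blinfun_apply S x) = 0"
  shows "S = 0"
proof (rule blinfun_eqI)
  fix x
  have "inner (x + S x) (S (x + S x)) = 2 * inner (S x) (S x)"
    using assms(2)[of x] assms(2)[of "S x"] selfadjointD[OF assms(1), of x "S x"]
    by (simp add: blinfun.add_right inner_add_left inner_add_right)
  then show "S x = (0 :: 'a \<Rightarrow>\<^sub>L 'a) x" using assms(2) by simp
qed

lemma projection_selfadjoint: "p \<in> projections bounded_ops \<Longrightarrow> selfadjoint p"
  by (simp add: projections_iff)

lemma projection_eqI:
  fixes p q :: "'h::chilbert_space \<Rightarrow>\<^sub>L 'h"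
  assumes p: "p \<in> projections bounded_ops" and q: "q \<in> projections bounded_ops"
    and "\<And>x. (norm (p x))\<^sup>2 = (norm (q x))\<^sup>2"
  shows "p = q"
proof -
  have "p - q = 0"
    by (rule selfadjoint_eq_0I[OF selfadjoint_diff[OF projection_selfadjoint[OF p] projection_selfadjoint[OF q]]])
      (simp add: blinfun.diff_left inner_diff_right projection_apply(4)[OF p] projection_apply(4)[OF q] assms(3))
  then show ?thesis by simp
qed

lemma projection_compl:
  assumes "p \<in> projections bounded_ops"
  shows "id_blinfun - p \<in> projections bounded_ops"
    "(norm ((id_blinfun - p) x))\<^sup>2 = (norm x)\<^sup>2 - (norm (blinfun_apply p x))\<^sup>2"
proof -
  show *: "id_blinfun - p \<in> projections bounded_ops"
    using projection_apply[OF assms] projection_selfadjoint[OF assms]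
    by (simp add: projections_iff bounded_ops_diff bounded_ops_id selfadjoint_diff selfadjoint_id
        blinfun.bilinear_simps)
  show "(norm ((id_blinfun - p) x))\<^sup>2 = (norm x)\<^sup>2 - (norm (blinfun_apply p x))\<^sup>2"
    unfolding projection_apply(4)[OF *, symmetric] projection_apply(4)[OF assms, symmetric]
    by (simp add: blinfun.bilinear_simps inner_diff_right power2_norm_eq_inner)
qed

lemma projections_orthogonal:
  fixes p q :: "'h::chilbert_space \<Rightarrow>\<^sub>L 'h"
  assumes "q \<in> projections bounded_ops"
    and "\<And>x. (norm (p x))\<^sup>2 + (norm (q x))\<^sup>2 \<le> (norm x)\<^sup>2"
  shows "p (q x) = 0"
  using assms(2)[of "q x"] by (simp add: projection_apply(1)[OF assms(1)])

lemma joint_kernel: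
  fixes p :: "'i \<Rightarrow> ('a::real_normed_vector \<Rightarrow>\<^sub>L 'b::real_normed_vector)"
  shows "subspace {x. \<forall>i\<in>I. p i x = 0}" "closed {x. \<forall>i\<in>I. p i x = 0}"
proof -
  have eq: "{x. \<forall>i\<in>I. p i x = 0} = (\<Inter>i\<in>I. {x. p i x = 0})" by auto
  show "closed {x. \<forall>i\<in>I. p i x = 0}" unfolding eq using kernel_closed by blast
qed (simp add: subspace_def blinfun.bilinear_simps)

text \<open>The complements r n of the partial sums are decreasing projections, and their limit is
  the projection onto the joint kernel. Writing the sum through \<open>orth_proj K\<close> gives it
  a form that automorphisms preserve.\<close>

lemma orthogonal_projections_sums:
  fixes p :: "nat \<Rightarrow> ('h::chilbert_space \<Rightarrow>\<^sub>L 'h)"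
  assumes p: "\<And>n. p n \<in> projections bounded_ops"
    and orth: "\<And>m n x. m \<noteq> n \<Longrightarrow> p m (p n x) = 0"
  defines "K \<equiv> {x. \<forall>n\<in>UNIV. p n x = 0}"
  shows "(\<lambda>n. p n x) sums (x - orth_proj K x)"
proof -
  have K: "subspace K" "closed K" unfolding K_def by (rule joint_kernel)+
  define r where "r n = id_blinfun - (\<Sum>i<n. p i)" for n
  have r_apply: "r n x = x - (\<Sum>i<n. p i x)" for n x
    by (simp add: r_def blinfun.diff_left blinfun.sum_left)
  have pr: "p i (r n x) = (if i < n then 0 else p i x)" for i n x
  proof -
    have "(\<Sum>j<n. p i (p j x)) = (\<Sum>j<n. if j = i then p i x else 0)"
      by (rule sum.cong) (auto simp: orth projection_apply(1)[OF p])
    then show ?thesis by (simp add: r_apply blinfun.diff_right blinfun.sum_right)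
  qed
  have rr: "r m (r n x) = r n x" if "m \<le> n" for m n x
    using that by (subst r_apply) (simp add: pr)
  have "r n \<in> bounded_ops" for n
    unfolding r_def
    by (induction n) (auto simp: diff_diff_eq[symmetric] projection_apply(3)[OF p]
        intro!: bounded_ops_id bounded_ops_diff)
  moreover have "selfadjoint (r n)" for n
    using projection_selfadjoint[OF p] by (simp add: selfadjoint_def r_apply inner_diff_left
        inner_diff_right inner_sum_left inner_sum_right)
  ultimately have "r n \<in> projections bounded_ops" for n
    by (simp add: projections_iff rr)
  then obtain w where w: "(\<lambda>n. r n x) \<longlonglongrightarrow> w" "\<And>n. r n w = w"
    using convergent_decseq_projections[of r x] rr by metis
  have "p n w = 0" for n
    using pr[of n "Suc n" w] w(2)[of "Suc n"] by simp
  then have wK: "w \<in> K" by (simp add: K_def)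
  have "orth_proj K (r n x) = orth_proj K x" for n
  proof (rule subspace_eqI[OF K(1)])
    fix y assume y: "y \<in> K"
    then have "inner (p i x) y = 0" for i
      using projection_apply(2)[OF p, of i x y] by (simp add: K_def)
    then show "inner (orth_proj K (r n x)) y = inner (orth_proj K x) y"
      by (simp add: orth_proj_inner[OF K y] r_apply inner_diff_left inner_sum_left)
  qed (rule orth_proj_mem[OF K])+
  then have "orth_proj K w = orth_proj K x"
    using LIMSEQ_unique[OF blinfun.tendsto[OF tendsto_const w(1), of "orth_proj K"]] by simp
  then have "w = orth_proj K x" using orth_proj_fix[OF K, of w] wK by simp
  moreover have "(\<lambda>n. x - r n x) \<longlonglongrightarrow> x - w" by (intro tendsto_intros w)
  ultimately show ?thesis by (simp add: sums_def r_apply)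
qed

text \<open>The measure that maps a Borel set to |E x|^2, with E the spectral projection of that
  set, obtained from its distribution function before E is available.\<close>

definition spectral_distribution :: "('h::chilbert_space \<Rightarrow>\<^sub>L 'h) \<Rightarrow> 'h \<Rightarrow> real measure" where
  "spectral_distribution a x = interval_measure (\<lambda>l. (norm (cut a l x))\<^sup>2)"

text \<open>A projection is determined by the numbers |p x|^2, so scalar measures suffice to single
  out the spectral projection. The bicommutant condition later places it in every von Neumann
  algebra containing a.\<close>

definition represents :: "('h::chilbert_space \<Rightarrow>\<^sub>L 'h) \<Rightarrow> ('h \<Rightarrow>\<^sub>L 'h) \<Rightarrow> real set \<Rightarrow> bool" where
  "represents a p \<Delta> \<longleftrightarrow> p \<in> projections bounded_ops \<and> p \<in> bicommutant a \<and>
     (\<forall>x. (norm (p x))\<^sup>2 = measure (spectral_distribution a x) \<Delta>)"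

definition borel_projection :: "('h::chilbert_space \<Rightarrow>\<^sub>L 'h) \<Rightarrow> real set \<Rightarrow> ('h \<Rightarrow>\<^sub>L 'h)" where
  "borel_projection a = (\<lambda>\<Delta>\<in>sets borel. SOME p. represents a p \<Delta>)"

context
  fixes a :: "'h::chilbert_space \<Rightarrow>\<^sub>L 'h"
  assumes a: "a \<in> bounded_ops" "selfadjoint a"
begin

abbreviation (input) "\<nu> \<equiv> spectral_distribution a"

lemma norm_cut_mono: "l \<le> m \<Longrightarrow> (norm (cut a l x))\<^sup>2 \<le> (norm (cut a m x))\<^sup>2"
  using cut_increment(3)[OF a, of l m x] by (metis diff_ge_0_iff_ge zero_le_power2)

lemma spectral_distribution_Ioc:
  "l \<le> m \<Longrightarrow> measure (\<nu> x) {l<..m} = (norm (cut a m x))\<^sup>2 - (norm (cut a l x))\<^sup>2"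
  unfolding spectral_distribution_def
  by (rule measure_interval_measure_Ioc[OF _ norm_cut_mono])
    (use cut_right_continuous[OF a] in \<open>auto simp: continuous_within\<close>)

lemma sets_spectral_distribution [simp, measurable_cong]: "sets (\<nu> x) = sets borel"
  and space_spectral_distribution [simp]: "space (\<nu> x) = UNIV"
  by (simp_all add: spectral_distribution_def)

lemma spectral_distribution_finite: "finite_borel_measure (\<nu> x)"
  and spectral_distribution_UNIV: "measure (\<nu> x) UNIV = (norm x)\<^sup>2"
proof -
  have low: "\<forall>\<^sub>F l in at_bot. (norm (cut a l x))\<^sup>2 = 0"
    unfolding eventually_at_bot_dense by (rule exI[of _ "- norm a"]) (simp add: cut_low[OF a])
  have high: "\<forall>\<^sub>F l in at_top. (norm (cut a l x))\<^sup>2 = (norm x)\<^sup>2"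
    unfolding eventually_at_top_linorder by (rule exI[of _ "norm a"]) (simp add: cut_high[OF a])
  note lims = tendsto_eventually[OF low] tendsto_eventually[OF high]
  have rc: "continuous (at_right l) (\<lambda>l. (norm (cut a l x))\<^sup>2)" for l
    using cut_right_continuous[OF a] by (simp add: continuous_within)
  show "finite_borel_measure (\<nu> x)"
    unfolding spectral_distribution_def
    by (rule finite_borel_measure_interval_measure[OF norm_cut_mono rc lims]) auto
  have "emeasure (\<nu> x) UNIV = ennreal ((norm x)\<^sup>2)"
    unfolding spectral_distribution_def
    by (rule interval_measure_UNIV[OF norm_cut_mono rc lims]) auto
  then show "measure (\<nu> x) UNIV = (norm x)\<^sup>2" by (simp add: measure_def)
qed

lemma spectral_distribution_support:
  assumes "m < - norm a" "norm a \<le> M"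
  shows "AE t in \<nu> x. t \<in> {m<..M}"
proof -
  interpret finite_borel_measure "\<nu> x" by (rule spectral_distribution_finite)
  have "m \<le> M" using assms norm_ge_zero[of a] by linarith
  then have "measure (\<nu> x) {m<..M} = (norm x)\<^sup>2"
    using assms by (simp add: spectral_distribution_Ioc cut_low[OF a] cut_high[OF a])
  then have "measure (\<nu> x) (space (\<nu> x) - {m<..M}) = 0"
    by (subst finite_measure_compl) (auto simp: spectral_distribution_UNIV)
  then show ?thesis
    by (intro AE_I[of _ _ "space (\<nu> x) - {m<..M}"]) (auto simp: emeasure_eq_measure)
qed

lemma spectral_distribution_atMost: "measure (\<nu> x) {..l} = (norm (cut a l x))\<^sup>2"
proof -
  interpret finite_borel_measure "\<nu> x" by (rule spectral_distribution_finite)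
  define m where "m = min l (- norm a - 1)"
  have m: "m < - norm a" "m \<le> l" by (auto simp: m_def)
  have "measure (\<nu> x) {..l} = measure (\<nu> x) {m<..l}"
    by (rule finite_measure_eq_AE)
      (use spectral_distribution_support[OF m(1) order_refl, of x] in \<open>auto elim: eventually_mono\<close>)
  then show ?thesis using m by (simp add: spectral_distribution_Ioc cut_low[OF a])
qed

lemma represents_unique: "represents a p \<Delta> \<Longrightarrow> represents a q \<Delta> \<Longrightarrow> p = q"
  unfolding represents_def by (intro projection_eqI) auto

lemma represents_compl:
  assumes "represents a p \<Delta>" "\<Delta> \<in> sets borel"
  shows "represents a (id_blinfun - p) (- \<Delta>)"
proof -
  have "measure (\<nu> x) (- \<Delta>) = (norm x)\<^sup>2 - measure (\<nu> x) \<Delta>" for x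
  proof -
    interpret finite_borel_measure "\<nu> x" by (rule spectral_distribution_finite)
    show ?thesis using finite_measure_compl[of \<Delta>] assms(2) by (simp add: spectral_distribution_UNIV Compl_eq_Diff_UNIV)
  qed
  then show ?thesis
    using assms(1) by (auto simp: represents_def projection_compl commutant_diff commutant_id)
qed

text \<open>Additivity of the scalar measures bounds |p x|^2 + |q x|^2 by |x|^2; at vectors of the
  range of q this leaves nothing for p.\<close>

lemma represents_disjoint_orthogonal:
  assumes "represents a p \<Delta>" "represents a q \<Delta>'" "\<Delta> \<inter> \<Delta>' = {}" "\<Delta> \<in> sets borel" "\<Delta>' \<in> sets borel"
  shows "p (q x) = 0"
proof (rule projections_orthogonal)
  fix x
  interpret finite_borel_measure "\<nu> x" by (rule spectral_distribution_finite)
  have "measure (\<nu> x) \<Delta> + measure (\<nu> x) \<Delta>' = measure (\<nu> x) (\<Delta> \<union> \<Delta>')"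
    using assms(3-5) by (subst finite_measure_Union) auto
  also have "\<dots> \<le> (norm x)\<^sup>2" using bounded_measure[of "\<Delta> \<union> \<Delta>'"] by (simp add: spectral_distribution_UNIV)
  finally show "(norm (p x))\<^sup>2 + (norm (q x))\<^sup>2 \<le> (norm x)\<^sup>2" using assms by (simp add: represents_def)
qed (use assms(2) in \<open>simp add: represents_def\<close>)

lemma represents_UN:
  fixes F :: "nat \<Rightarrow> real set"
  assumes F: "disjoint_family F" "range F \<subseteq> sets borel" and p: "\<And>n. represents a (p n) (F n)"
  obtains q where "represents a q (\<Union>n. F n)" "\<And>x. (\<lambda>n. p n x) sums q x"
proof -
  define K where "K = {x. \<forall>n\<in>UNIV. p n x = 0}"
  have K: "subspace K" "closed K" unfolding K_def by (rule joint_kernel)+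
  have pp: "p n \<in> projections bounded_ops" and pc: "p n \<in> bicommutant a" for n
    using p by (auto simp: represents_def)
  have "orth_proj K \<in> bicommutant a"
    by (rule orth_proj_commutant[OF K]) (use commutant_bounded_ops commutant_sa_adj[OF a] in
        \<open>auto simp: K_def commutant_apply[OF pc] bounded_opsD[OF projection_apply(3)[OF pp]]\<close>)
  moreover from this have "orth_proj K \<in> projections bounded_ops"
    using orth_proj_projection[OF K] commutant_bounded_ops by blast
  ultimately have q: "id_blinfun - orth_proj K \<in> bicommutant a" "id_blinfun - orth_proj K \<in> projections bounded_ops"
    by (auto intro!: commutant_diff commutant_id projection_compl)
  have orth: "p m (p n x) = 0" if "m \<noteq> n" for m n x
    by (rule represents_disjoint_orthogonal[OF p p])
      (use F that in \<open>auto simp: disjoint_family_on_def\<close>)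
  have sums: "(\<lambda>n. p n x) sums (id_blinfun - orth_proj K) x" for x
    using orthogonal_projections_sums[where p = p and x = x, OF pp orth] by (simp add: K_def blinfun.diff_left)
  have "(norm ((id_blinfun - orth_proj K) x))\<^sup>2 = measure (\<nu> x) (\<Union>n. F n)" for x
  proof (rule sums_unique2)
    have "(\<lambda>n. inner x (p n x)) sums inner x ((id_blinfun - orth_proj K) x)"
      by (rule bounded_linear.sums[OF bounded_linear_inner_right sums])
    then show "(\<lambda>n. (norm (p n x))\<^sup>2) sums (norm ((id_blinfun - orth_proj K) x))\<^sup>2"
      by (simp only: projection_apply(4)[OF pp] projection_apply(4)[OF q(2)])
    interpret finite_borel_measure "\<nu> x" by (rule spectral_distribution_finite)
    show "(\<lambda>n. (norm (p n x))\<^sup>2) sums measure (\<nu> x) (\<Union>n. F n)"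
      using finite_measure_UNION[of F] F p by (simp add: represents_def)
  qed
  then show ?thesis using that q sums by (auto simp: represents_def)
qed

lemma borel_projection: "\<Delta> \<in> sets borel \<Longrightarrow> represents a (borel_projection a \<Delta>) \<Delta>"
proof -
  assume \<Delta>: "\<Delta> \<in> sets borel"
  then have "\<exists>p. represents a p \<Delta>"
  proof (induction rule: borel_induct_atMost)
    case (atMost l)
    have "represents a (cut a l) {..l}"
      using cut_projection[OF a] cut(1)[OF a] by (simp add: represents_def spectral_distribution_atMost)
    then show ?case by blast
  next
    case empty
    have "0 \<in> projections bounded_ops"
      by (simp add: projections_iff bounded_ops_zero selfadjoint_zero)
    then show ?case by (intro exI[of _ 0]) (simp add: represents_def commutant_zero)
  next
    case (compl A)
    then show ?case using represents_compl by blast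
  next
    case (union F)
    then obtain p where "\<And>n. represents a (p n) (F n)" by metis
    from represents_UN[OF union(1,2) this] show ?case by metis
  qed
  then show ?thesis using \<Delta> someI_ex[of "\<lambda>p. represents a p \<Delta>"] by (simp add: borel_projection_def)
qed

lemma borel_projection_eqI: "\<Delta> \<in> sets borel \<Longrightarrow> represents a p \<Delta> \<Longrightarrow> borel_projection a \<Delta> = p"
  using represents_unique[OF borel_projection] .

lemma borel_projection_projection: "\<Delta> \<in> sets borel \<Longrightarrow> borel_projection a \<Delta> \<in> projections bounded_ops"
  and borel_projection_bicommutant: "\<Delta> \<in> sets borel \<Longrightarrow> borel_projection a \<Delta> \<in> bicommutant a"
  and norm_borel_projection:
    "\<Delta> \<in> sets borel \<Longrightarrow> (norm (borel_projection a \<Delta> x))\<^sup>2 = measure (\<nu> x) \<Delta>"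
  using borel_projection by (auto simp: represents_def)

lemma borel_projection_atMost: "borel_projection a {..l} = cut a l"
  using cut_projection[OF a] cut(1)[OF a]
  by (intro borel_projection_eqI) (auto simp: represents_def spectral_distribution_atMost)

lemma borel_projection_compl:
  "\<Delta> \<in> sets borel \<Longrightarrow> borel_projection a (- \<Delta>) = id_blinfun - borel_projection a \<Delta>"
  using represents_compl[OF borel_projection] by (intro borel_projection_eqI) auto

lemma borel_projection_UN:
  fixes F :: "nat \<Rightarrow> real set"
  assumes F: "disjoint_family F" "range F \<subseteq> sets borel"
  shows "(\<lambda>n. borel_projection a (F n) x) sums borel_projection a (\<Union>n. F n) x"
proof -
  have F': "F n \<in> sets borel" for n using F(2) by auto
  obtain q where q: "represents a q (\<Union>n. F n)" "\<And>x. (\<lambda>n. borel_projection a (F n) x) sums q x"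
    using represents_UN[OF F borel_projection[OF F']] by metis
  moreover have "(\<Union>n. F n) \<in> sets borel" using F' by blast
  ultimately show ?thesis using borel_projection_eqI by metis
qed

lemma borel_projection_Un:
  assumes "A \<in> sets borel" "B \<in> sets borel" "A \<inter> B = {}"
  shows "borel_projection a (A \<union> B) = borel_projection a A + borel_projection a B"
proof -
  let ?E = "borel_projection a"
  have U: "A \<union> B \<in> sets borel" using assms by simp
  note E = borel_projection_projection[OF assms(1)] borel_projection_projection[OF assms(2)]
    borel_projection_projection[OF U]
  have "?E (A \<union> B) - (?E A + ?E B) = 0"
  proof (rule selfadjoint_eq_0I)
    show "selfadjoint (?E (A \<union> B) - (?E A + ?E B))"
      by (intro selfadjoint_diff selfadjoint_add projection_selfadjoint E)
    fix x
    interpret finite_borel_measure "\<nu> x" by (rule spectral_distribution_finite)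
    show "inner x ((?E (A \<union> B) - (?E A + ?E B)) x) = 0"
      using finite_measure_Union[of A B] assms
      by (simp add: blinfun.bilinear_simps inner_diff_right inner_add_right
          projection_apply(4)[OF E(1)] projection_apply(4)[OF E(2)] projection_apply(4)[OF E(3)]
          norm_borel_projection)
  qed
  then show ?thesis by simp
qed

text \<open>Multiplicativity follows from additivity: A and B are split along their intersection,
  and the cross terms vanish because disjoint sets have orthogonal projections.\<close>

lemma borel_projection_Int:
  assumes "A \<in> sets borel" "B \<in> sets borel"
  shows "borel_projection a (A \<inter> B) = borel_projection a A o\<^sub>L borel_projection a B"
proof (rule blinfun_eqI)
  fix x
  let ?E = "borel_projection a"
  have orth: "?E C (?E D y) = 0" if "C \<in> sets borel" "D \<in> sets borel" "C \<inter> D = {}" for C D y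
    using represents_disjoint_orthogonal[OF borel_projection borel_projection] that by blast
  have split: "?E C = ?E (C \<inter> D) + ?E (C - D)" if "C \<in> sets borel" "D \<in> sets borel" for C D
  proof -
    have "?E ((C \<inter> D) \<union> (C - D)) = ?E (C \<inter> D) + ?E (C - D)"
      by (rule borel_projection_Un) (use that in auto)
    moreover have "(C \<inter> D) \<union> (C - D) = C" by blast
    ultimately show ?thesis by simp
  qed
  have orths: "?E (A \<inter> B) (?E (B - A) y) = 0" "?E (A - B) (?E (A \<inter> B) y) = 0" "?E (A - B) (?E (B - A) y) = 0" for y
    by (rule orth; use assms in auto)+
  have "?E A (?E B x) = ?E (A \<inter> B) (?E (A \<inter> B) x)"
    using orths
    unfolding split[OF assms] split[OF assms(2,1)] Int_commute[of B A]
    by (simp add: blinfun.add_left blinfun.add_right)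
  also have "\<dots> = ?E (A \<inter> B) x" using assms by (intro projection_apply(1) borel_projection_projection) auto
  finally show "?E (A \<inter> B) x = (?E A o\<^sub>L ?E B) x" by simp
qed

end


section \<open>Integral representation and uniqueness of the spectral measure\<close>

abbreviation form_measure :: "(real set \<Rightarrow> ('h::chilbert_space \<Rightarrow>\<^sub>L 'h)) \<Rightarrow> 'h \<Rightarrow> real measure" where
  "form_measure E x \<equiv> measure_of UNIV (sets borel) (\<lambda>\<Delta>. ennreal (Re (cinner x (blinfun_apply (E \<Delta>) x))))"

lemma cinner_selfadjoint:
  assumes "T \<in> bounded_ops" "selfadjoint T"
  shows "cinner x (blinfun_apply T x) = complex_of_real (inner x (T x))"
proof -
  have "cinner (T x) x = cinner x (T x)"
    using cinner_adjoint_iff[OF assms(1), of T] selfadjointD[OF assms(2)] by blast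
  then have "cinner x (T x) = cnj (cinner x (T x))" using cinner_commute by metis
  then have "Im (cinner x (T x)) = 0" by (metis complex_cnj_cancel_iff cnj.simps(2) equal_neg_zero)
  then show ?thesis by (simp add: complex_eq_iff inner_cinner)
qed

lemma
  assumes "finite_borel_measure M" "B \<in> sets borel" "AE t in M. \<bar>t\<bar> \<le> r"
  shows integrable_indicator_id: "integrable M (\<lambda>t. indicator B t * t)"
    and integral_indicator_le: "(\<And>t. t \<in> B \<Longrightarrow> t \<le> c) \<Longrightarrow> (\<integral>t. indicator B t * t \<partial>M) \<le> c * measure M B"
    and integral_indicator_ge: "(\<And>t. t \<in> B \<Longrightarrow> c \<le> t) \<Longrightarrow> c * measure M B \<le> (\<integral>t. indicator B t * t \<partial>M)"
proof -
  interpret finite_borel_measure M by fact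
  have B [measurable]: "B \<in> sets M" using assms(2) M_is_borel by simp
  have [measurable]: "(\<lambda>t. t) \<in> borel_measurable M" using M_is_borel by (simp add: measurable_ident_sets)
  show int: "integrable M (\<lambda>t. indicator B t * t)"
    by (rule integrable_const_bound[of _ "\<bar>r\<bar>"])
      (use assms(3) in \<open>auto simp: indicator_def elim: eventually_mono\<close>)
  have int_c: "integrable M (\<lambda>t. indicator B t * c)" for c :: real
    by (rule integrable_const_bound[of _ "\<bar>c\<bar>"]) (auto simp: indicator_def)
  have const: "(\<integral>t. indicator B t * c \<partial>M) = c * measure M B" for c :: real
    using sets.sets_into_space[OF B] by (simp add: Int_absorb2)
  show "(\<integral>t. indicator B t * t \<partial>M) \<le> c * measure M B" if "\<And>t. t \<in> B \<Longrightarrow> t \<le> c"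
    unfolding const[of c, symmetric] by (rule integral_mono[OF int int_c]) (use that in \<open>auto simp: indicator_def\<close>)
  show "c * measure M B \<le> (\<integral>t. indicator B t * t \<partial>M)" if "\<And>t. t \<in> B \<Longrightarrow> c \<le> t"
    unfolding const[of c, symmetric] by (rule integral_mono[OF int_c int]) (use that in \<open>auto simp: indicator_def\<close>)
qed

context
  fixes a :: "'h::chilbert_space \<Rightarrow>\<^sub>L 'h"
  assumes a: "a \<in> bounded_ops" "selfadjoint a"
begin

text \<open>Both sides, cut off at t, grow from s to t by an amount between s and t times the mass
  of {s<..t}. Their difference g is therefore constant, and it vanishes below the spectrum.\<close>

lemma integral_spectral_distribution: "(\<integral>t. t \<partial>spectral_distribution a x) = inner x (a x)"
proof -
  define M where "M = spectral_distribution a x"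
  interpret finite_borel_measure M unfolding M_def by (rule spectral_distribution_finite[OF a])
  define L where "L = - norm a - 1"
  define U where "U = norm a"
  have LU: "L < - norm a" "norm a \<le> U" "L \<le> U" using norm_ge_zero[of a] by (auto simp: L_def U_def simp del: norm_ge_zero)
  have supp: "AE t in M. t \<in> {L<..U}" unfolding M_def by (rule spectral_distribution_support[OF a LU(1,2)])
  then have bound: "AE t in M. \<bar>t\<bar> \<le> norm a + 1"
    by eventually_elim (auto simp: L_def U_def)
  note ind = integrable_indicator_id[OF finite_borel_measure_axioms _ bound]
    integral_indicator_le[OF finite_borel_measure_axioms _ bound]
    integral_indicator_ge[OF finite_borel_measure_axioms _ bound]
  define g where "g t = inner (cut a t x) (a (cut a t x)) - (\<integral>u. indicator {..t} u * u \<partial>M)" for t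
  have "\<bar>g t - g s\<bar> \<le> (t - s) * ((norm (cut a t x))\<^sup>2 - (norm (cut a s x))\<^sup>2)" if st: "s \<le> t" for s t
  proof -
    define q where "q = cut a t - cut a s"
    note q = cut_increment[OF a st, folded q_def]
    have meas: "measure M {s<..t} = (norm (q x))\<^sup>2"
      unfolding q(3) M_def by (rule spectral_distribution_Ioc[OF a st])
    have "(\<integral>u. indicator {..t} u * u \<partial>M) - (\<integral>u. indicator {..s} u * u \<partial>M) =
        (\<integral>u. indicator {..t} u * u - indicator {..s} u * u \<partial>M)"
      by (rule Bochner_Integration.integral_diff[symmetric]) (auto intro!: ind)
    also have "\<dots> = (\<integral>u. indicator {s<..t} u * u \<partial>M)"
      by (rule Bochner_Integration.integral_cong) (use st in \<open>auto simp: indicator_def\<close>)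
    finally have 1: "(\<integral>u. indicator {..t} u * u \<partial>M) - (\<integral>u. indicator {..s} u * u \<partial>M) =
        (\<integral>u. indicator {s<..t} u * u \<partial>M)" .
    have comm: "a (q y) = q (a y)" for y
      by (simp add: q_def blinfun.bilinear_simps cut_commute[OF a])
    have cq: "inner (cut a l x) (a (cut a l x)) = inner x (a (cut a l x))" for l
      by (simp add: projection_apply(1,2)[OF cut_projection[OF a]] cut_commute[OF a])
    have "inner (cut a t x) (a (cut a t x)) - inner (cut a s x) (a (cut a s x)) = inner x (a (q x))"
      unfolding cq by (simp add: q_def blinfun.bilinear_simps inner_diff_right)
    also have "\<dots> = inner (q x) (a (q x))" by (simp add: q(1,2) comm[symmetric])
    finally have "g t - g s = inner (q x) (a (q x)) - (\<integral>u. indicator {s<..t} u * u \<partial>M)"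
      using 1 by (simp add: g_def)
    moreover have "s * measure M {s<..t} \<le> inner (q x) (a (q x))" "inner (q x) (a (q x)) \<le> t * measure M {s<..t}"
      unfolding meas power2_norm_eq_inner using q(4,5)[OF q(1)] by blast+
    moreover have "s * measure M {s<..t} \<le> (\<integral>u. indicator {s<..t} u * u \<partial>M)"
      by (rule ind(3)) auto
    moreover have "(\<integral>u. indicator {s<..t} u * u \<partial>M) \<le> t * measure M {s<..t}"
      by (rule ind(2)) auto
    ultimately have "\<bar>g t - g s\<bar> \<le> (t - s) * measure M {s<..t}"
      by (simp add: left_diff_distrib)
    then show ?thesis unfolding meas q(3) .
  qed
  then have "g U = g L" using LU(3) by (rule eq_if_increments_quadratic)
  moreover have "(\<integral>u. indicator {..L} u * u \<partial>M) = 0"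
    by (rule integral_eq_zero_AE, use supp in eventually_elim) simp
  moreover have "(\<integral>u. indicator {..U} u * u \<partial>M) = (\<integral>u. u \<partial>M)"
  proof (rule integral_cong_AE)
    show "AE u in M. indicator {..U} u * u = u" using supp by eventually_elim simp
  qed (simp_all add: M_is_borel measurable_cong_sets[OF M_is_borel refl])
  ultimately show ?thesis using LU by (simp add: g_def cut_low[OF a] cut_high[OF a] M_def)
qed

lemma spectral_measure_borel_projection: "spectral_measure a (borel_projection a)"
  unfolding spectral_measure_def
proof (intro conjI ballI allI impI)
  show "borel_projection a \<in> extensional (sets borel)" by (simp add: borel_projection_def)
  show "borel_projection a \<Delta> \<in> projections bounded_ops" if "\<Delta> \<in> sets borel" for \<Delta>
    by (rule borel_projection_projection[OF a that])
  have id: "id_blinfun \<in> projections bounded_ops"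
    by (simp add: projections_iff bounded_ops_id selfadjoint_id)
  \<comment> \<open>The left end lies below - norm a because a half-open interval starting there
    would lose an eigenvalue at - norm a.\<close>
  have full: "borel_projection a \<Delta> = id_blinfun"
    if "\<Delta> \<in> sets borel" "{- norm a - 1<..norm a} \<subseteq> \<Delta>" for \<Delta>
  proof (rule borel_projection_eqI[OF a that(1)])
    have "measure (spectral_distribution a x) \<Delta> = (norm x)\<^sup>2" for x
    proof -
      interpret finite_borel_measure "spectral_distribution a x" by (rule spectral_distribution_finite[OF a])
      have "AE t in spectral_distribution a x. t \<in> {- norm a - 1<..norm a}"
        by (rule spectral_distribution_support[OF a]) auto
      then have "AE t in spectral_distribution a x. t \<in> \<Delta> \<longleftrightarrow> t \<in> UNIV"
        by eventually_elim (use that(2) in blast)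
      then have "measure (spectral_distribution a x) \<Delta> = measure (spectral_distribution a x) UNIV"
        using that(1) by (intro finite_measure_eq_AE) (simp_all add: sets_spectral_distribution[OF a])
      then show ?thesis by (simp add: spectral_distribution_UNIV[OF a])
    qed
    then show "represents a id_blinfun \<Delta>" using id by (simp add: represents_def commutant_id)
  qed
  show "borel_projection a UNIV = id_blinfun" by (rule full) auto
  show "\<exists>r. borel_projection a {- r..r} = id_blinfun"
    by (rule exI[of _ "norm a + 1"], rule full) auto
  show "borel_projection a (\<Delta> \<inter> \<Delta>') = borel_projection a \<Delta> o\<^sub>L borel_projection a \<Delta>'"
    if "\<Delta> \<in> sets borel" "\<Delta>' \<in> sets borel" for \<Delta> \<Delta>'
    by (rule borel_projection_Int[OF a that])
  show "(\<lambda>n. borel_projection a (F n) x) sums borel_projection a (\<Union>n. F n) x"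
    if "range F \<subseteq> sets borel" "disjoint_family F" for F :: "nat \<Rightarrow> real set" and x
    by (rule borel_projection_UN[OF a that(2,1)])
  fix x
  have "form_measure (borel_projection a) x =
      measure_of (space (spectral_distribution a x)) (sets (spectral_distribution a x))
        (emeasure (spectral_distribution a x))"
    unfolding sets_spectral_distribution[OF a] space_spectral_distribution[OF a]
  proof (rule measure_of_eq)
    fix \<Delta> :: "real set" assume "\<Delta> \<in> sigma_sets UNIV (sets borel)"
    then have \<Delta>: "\<Delta> \<in> sets borel" using sets.sigma_sets_eq[of "borel :: real measure"] by simp
    interpret finite_borel_measure "spectral_distribution a x" by (rule spectral_distribution_finite[OF a])
    show "ennreal (Re (cinner x (borel_projection a \<Delta> x))) = emeasure (spectral_distribution a x) \<Delta>"
      using projection_apply(4)[OF borel_projection_projection[OF a \<Delta>]]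
      by (simp add: inner_cinner[symmetric] norm_borel_projection[OF a \<Delta>] emeasure_eq_measure)
  qed simp
  then show "cinner x (a x) = complex_of_real (\<integral>t. t \<partial>form_measure (borel_projection a) x)"
    by (simp add: measure_of_of_measure integral_spectral_distribution cinner_selfadjoint[OF a])
qed

text \<open>For any spectral measure E of a, the projections E {..l} are spectral cuts and hence
  equal \<open>cut a l\<close>. So the scalar measures have the same distribution functions, and
  they determine the projections.\<close>

lemma spectral_measure_unique:
  assumes E: "spectral_measure a E"
  shows "E = borel_projection a"
proof -
  have Eext: "E \<in> extensional (sets borel)"
    and Epr: "\<And>\<Delta>. \<Delta> \<in> sets borel \<Longrightarrow> E \<Delta> \<in> projections bounded_ops"
    and EUNIV: "E UNIV = id_blinfun"
    and EInt: "\<And>A B. A \<in> sets borel \<Longrightarrow> B \<in> sets borel \<Longrightarrow> E (A \<inter> B) = E A o\<^sub>L E B"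
    and Esums: "\<And>F x. range F \<subseteq> sets borel \<Longrightarrow> disjoint_family F \<Longrightarrow>
       (\<lambda>n. E (F n) x) sums E (\<Union>n::nat. F n) x"
    and Esupp: "\<exists>r. E {-r..r} = id_blinfun"
    and Eint: "\<And>x. cinner x (a x) = complex_of_real (\<integral>t. t \<partial>form_measure E x)"
    using E unfolding spectral_measure_def by blast+
  obtain r where r: "E {-r..r} = id_blinfun" using Esupp by blast
  have form: "Re (cinner x (E \<Delta> x)) = (norm (E \<Delta> x))\<^sup>2" if "\<Delta> \<in> sets borel" for \<Delta> x
    using projection_apply(4)[OF Epr[OF that]] by (simp add: inner_cinner[symmetric])
  \<comment> \<open>Countable additivity for the constant family of empty sets: a convergent series
    with equal terms has zero terms.\<close>
  have Eempty: "E {} x = 0" for x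
  proof -
    have "(\<lambda>n::nat. E {} x) sums E {} x"
      using Esums[of "\<lambda>_. {}" x] by (simp add: disjoint_family_on_def)
    from summable_LIMSEQ_zero[OF sums_summable[OF this]] show ?thesis by (simp add: LIMSEQ_const_iff)
  qed
  \<comment> \<open>\<open>measure_of\<close> falls back to the zero measure unless the given
    function is a measure, so countable additivity is checked before values of N are read
    off.\<close>
  define N where "N = form_measure E"
  have sets_N: "sets (N x) = sets borel" for x
    using sets.sigma_sets_eq[of "borel :: real measure"] by (simp add: N_def)
  have em_N: "emeasure (N x) \<Delta> = ennreal ((norm (E \<Delta> x))\<^sup>2)" if "\<Delta> \<in> sets borel" for \<Delta> x
  proof -
    have "emeasure (N x) \<Delta> = ennreal (Re (cinner x (E \<Delta> x)))"
      unfolding N_def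
    proof (rule emeasure_measure_of_sigma[OF _ _ _ that])
      show "sigma_algebra UNIV (sets (borel :: real measure))"
        using sets.sigma_algebra_axioms[of "borel :: real measure"] by simp
      show "positive (sets borel) (\<lambda>\<Delta>. ennreal (Re (cinner x (E \<Delta> x))))"
        using form[of "{}" x] by (simp add: positive_def Eempty)
      show "countably_additive (sets borel) (\<lambda>\<Delta>. ennreal (Re (cinner x (E \<Delta> x))))"
        unfolding countably_additive_def
      proof (intro allI impI)
        fix F :: "nat \<Rightarrow> real set"
        assume F: "range F \<subseteq> sets borel" "disjoint_family F" "\<Union> (range F) \<in> sets borel"
        have "(\<lambda>n. inner x (E (F n) x)) sums inner x (E (\<Union>n. F n) x)"
          by (rule bounded_linear.sums[OF bounded_linear_inner_right Esums[OF F(1,2)]])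
        then have "(\<lambda>n. ennreal (Re (cinner x (E (F n) x)))) sums ennreal (Re (cinner x (E (\<Union> (range F)) x)))"
          using F by (subst sums_ennreal) (auto simp: inner_cinner form)
        then show "(\<Sum>n. ennreal (Re (cinner x (E (F n) x)))) = ennreal (Re (cinner x (E (\<Union> (range F)) x)))"
          by (rule sums_unique[symmetric])
      qed
    qed
    then show ?thesis by (simp add: form[OF that])
  qed
  have fin_N: "finite_borel_measure (N x)" for x
    by (intro finite_borel_measure.intro finite_measureI finite_borel_measure_axioms.intro)
      (simp_all add: sets_N em_N sets_eq_imp_space_eq[OF sets_N])
  have meas_N: "measure (N x) \<Delta> = (norm (E \<Delta> x))\<^sup>2" if "\<Delta> \<in> sets borel" for \<Delta> x
    by (simp add: measure_def em_N[OF that])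
  have bound: "AE t in N x. \<bar>t\<bar> \<le> r" for x
  proof -
    interpret finite_borel_measure "N x" by (rule fin_N)
    have space: "space (N x) = UNIV" using sets_eq_imp_space_eq[OF sets_N] by simp
    have B: "{-r..r} \<in> sets (N x)" by (simp add: sets_N)
    have "measure (N x) (space (N x) - {-r..r}) = measure (N x) (space (N x)) - measure (N x) {-r..r}"
      by (rule finite_measure_compl[OF B])
    then have "measure (N x) (space (N x) - {-r..r}) = 0"
      by (simp add: space meas_N r EUNIV)
    then show ?thesis
      using B by (intro AE_I[of _ _ "space (N x) - {-r..r}"]) (auto simp: emeasure_eq_measure)
  qed
  have int_N: "inner x (a x) = (\<integral>t. t \<partial>N x)" for x
    using arg_cong[OF Eint[of x], of Re] by (simp add: inner_cinner N_def)
  \<comment> \<open>By multiplicativity of E, the measure of the vector E B x is that of x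
    restricted to B.\<close>
  have int_ind: "inner (E B x) (a (E B x)) = (\<integral>t. indicator B t * t \<partial>N x)" if B: "B \<in> sets borel" for B x
  proof -
    have "N (E B x) = density (N x) (indicator B)"
    proof (rule measure_eqI)
      show "sets (N (E B x)) = sets (density (N x) (indicator B))" by (simp add: sets_N)
      fix \<Delta> assume "\<Delta> \<in> sets (N (E B x))"
      then have \<Delta>: "\<Delta> \<in> sets borel" by (simp add: sets_N)
      then show "emeasure (N (E B x)) \<Delta> = emeasure (density (N x) (indicator B)) \<Delta>"
        using B by (subst emeasure_restricted) (auto simp: em_N sets_N EInt Int_commute[of B \<Delta>])
    qed
    also have "density (N x) (indicator B) = density (N x) (\<lambda>t. ennreal (indicator B t))"
      by (simp add: ennreal_indicator)
    finally show ?thesis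
      unfolding int_N using B
      by (simp add: integral_density sets_N measurable_cong_sets[OF sets_N refl])
  qed
  have "spectral_cut a l (E {..l})" for l
    unfolding spectral_cut_def
  proof (intro conjI allI impI)
    have B: "{..l} \<in> sets borel" "{l<..} \<in> sets borel" by auto
    have Il: "{l<..} \<inter> {..l} = {}" "{..l} \<inter> {l<..} = {}" by auto
    note P = projection_apply[OF Epr[OF B(1)]]
    define P where "P = E {..l}"
    have norm_gt: "E {l<..} x = x - P x" for x
    proof -
      have F: "range (binaryset {..l} {l<..}) \<subseteq> sets borel" "disjoint_family (binaryset {..l} {l<..})"
        "(\<Union>n. binaryset {..l} {l<..} n) = UNIV"
        using B by (auto simp: binaryset_def disjoint_family_on_def UN_binaryset_eq range_binaryset_eq)
      have "(\<lambda>n. E (binaryset {..l} {l<..} n) x) sums (E {..l} x + E {l<..} x)"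
        using sums_finite[of "{0,1}" "\<lambda>n. E (binaryset {..l} {l<..} n) x"]
        by (auto simp: binaryset_def Eempty)
      moreover have "(\<lambda>n. E (binaryset {..l} {l<..} n) x) sums E UNIV x"
        using Esums[OF F(1,2), of x] unfolding F(3) .
      ultimately have "E UNIV x = E {..l} x + E {l<..} x" using sums_unique2 by blast
      then show ?thesis unfolding EUNIV P_def by (metis add_diff_cancel_left' blinfun_apply_id_blinfun)
    qed
    show "E {..l} \<in> projections bounded_ops" by (rule Epr[OF B(1)])
    note int = integrable_indicator_id[OF fin_N _ bound]
    have decomp: "inner x (a x) = inner (P x) (a (P x)) + inner (x - P x) (a (x - P x))" for x
    proof -
      have "inner (x - P x) (a (x - P x)) = (\<integral>t. indicator {l<..} t * t \<partial>N x)"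
        unfolding norm_gt[symmetric] by (rule int_ind[OF B(2)])
      moreover have "inner (P x) (a (P x)) = (\<integral>t. indicator {..l} t * t \<partial>N x)"
        unfolding P_def by (rule int_ind[OF B(1)])
      ultimately have "inner (P x) (a (P x)) + inner (x - P x) (a (x - P x)) =
        (\<integral>t. indicator {..l} t * t + indicator {l<..} t * t \<partial>N x)"
        by (simp add: Bochner_Integration.integral_add[OF int[OF B(1)] int[OF B(2)]])
      also have "\<dots> = (\<integral>t. t \<partial>N x)"
        by (rule Bochner_Integration.integral_cong) (auto simp: indicator_def)
      finally show ?thesis by (simp add: int_N)
    qed
    have sP: "selfadjoint P" unfolding P_def by (rule projection_selfadjoint[OF Epr[OF B(1)]])
    \<comment> \<open>The off-diagonal part of a with respect to P. Its form vanishes because the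
      integral splits at l, so a commutes with P.\<close>
    define S where "S = a - (P o\<^sub>L a o\<^sub>L P) - ((id_blinfun - P) o\<^sub>L a o\<^sub>L (id_blinfun - P))"
    have "S = 0"
    proof (rule selfadjoint_eq_0I)
      show "selfadjoint S"
        unfolding selfadjoint_def S_def
        by (simp add: blinfun.bilinear_simps inner_diff_left inner_diff_right selfadjointD[OF sP] selfadjointD[OF a(2)])
      show "inner x (S x) = 0" for x
        using decomp[of x] selfadjointD[OF sP]
        by (simp add: S_def blinfun.bilinear_simps inner_diff_left inner_diff_right)
    qed
    then have S0: "S y = 0" for y by simp
    have PP: "P (P y) = P y" for y unfolding P_def by (rule P(1))
    have "P (a x) = P (a (P x))" for x
      using arg_cong[OF S0[of x], of "blinfun_apply P"] by (simp add: S_def blinfun.bilinear_simps PP)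
    moreover have "a (P x) = P (a (P x))" for x
      using S0[of "P x"] by (simp add: S_def blinfun.bilinear_simps PP)
    ultimately have "P (a x) = a (P x)" for x by simp
    then show "E {..l} (a x) = a (E {..l} x)" for x unfolding P_def .
    show "inner x (a x) \<le> l * inner x x" if "E {..l} x = x" for x
      using integral_indicator_le[OF fin_N B(1) bound, of l x] int_ind[OF B(1), of x] that
      by (simp add: meas_N[OF B(1)] power2_norm_eq_inner)
    fix x assume x: "E {..l} x = 0" "x \<noteq> 0"
    have gt: "E {l<..} x = x" using norm_gt x by (simp add: P_def)
    interpret finite_borel_measure "N x" by (rule fin_N)
    have ge: "l * inner x x \<le> inner x (a x)"
      using integral_indicator_ge[OF fin_N B(2) bound, of l x] int_ind[OF B(2), of x] gt
      by (simp add: meas_N[OF B(2)] power2_norm_eq_inner)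
    \<comment> \<open>Equality would make the integral of t - l over {l<..} vanish, hence also the
      mass there, which is |x|^2.\<close>
    moreover have "l * inner x x \<noteq> inner x (a x)"
    proof
      assume eq: "l * inner x x = inner x (a x)"
      have [measurable]: "{l<..} \<in> sets (N x)" using B(2) by (simp add: sets_N)
      have int_l: "integrable (N x) (\<lambda>t. indicator {l<..} t * l)"
        by (rule integrable_const_bound[of _ "\<bar>l\<bar>"]) (auto simp: indicator_def)
      define f where "f t = indicator {l<..} t * t - indicator {l<..} t * l" for t
      have const: "(\<integral>t. indicator {l<..} t * l \<partial>N x) = l * inner x x"
        using gt sets.sets_into_space[of "{l<..}" "N x"]
        by (simp add: Int_absorb2 meas_N[OF B(2)] power2_norm_eq_inner)
      have "(\<integral>t. f t \<partial>N x) = (\<integral>t. indicator {l<..} t * t \<partial>N x) - l * inner x x"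
        unfolding f_def const[symmetric] by (rule Bochner_Integration.integral_diff[OF int[OF B(2)] int_l])
      then have "(\<integral>t. f t \<partial>N x) = 0" using int_ind[OF B(2), of x] gt eq by simp
      moreover have "integrable (N x) f"
        unfolding f_def by (intro Bochner_Integration.integrable_diff int[OF B(2)] int_l)
      moreover have "AE t in N x. 0 \<le> f t" by (rule AE_I2) (simp add: f_def indicator_def)
      ultimately have "AE t in N x. f t = 0" using integral_nonneg_eq_0_iff_AE[of "N x" f] by blast
      then have "AE t in N x. t \<in> {l<..} \<longleftrightarrow> t \<in> {}"
        by eventually_elim (auto simp: f_def indicator_def)
      then have "measure (N x) {l<..} = measure (N x) {}"
        by (rule finite_measure_eq_AE) auto
      then show False using gt x by (simp add: meas_N[OF B(2)])
    qed
    ultimately show "l * inner x x < inner x (a x)" by simp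
  qed
  then have cutE: "E {..l} = cut a l" for l by (rule cut_eqI[OF a, symmetric])
  have N_eq: "N x = spectral_distribution a x" for x
  proof (rule cdf_unique'[OF fin_N spectral_distribution_finite[OF a]], rule ext)
    show "cdf (N x) l = cdf (spectral_distribution a x) l" for l
      unfolding cdf_def spectral_distribution_atMost[OF a] cutE[symmetric] by (rule meas_N) simp
  qed
  show ?thesis
  proof (rule extensionalityI[OF Eext])
    show "borel_projection a \<in> extensional (sets borel)" by (simp add: borel_projection_def)
    fix \<Delta> :: "real set" assume \<Delta>: "\<Delta> \<in> sets borel"
    show "E \<Delta> = borel_projection a \<Delta>"
      by (rule projection_eqI[OF Epr[OF \<Delta>] borel_projection_projection[OF a \<Delta>]])
        (metis norm_borel_projection[OF a \<Delta>] meas_N[OF \<Delta>] N_eq)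
  qed
qed

lemma spectral_projection_eq: "spectral_projection a \<Delta> = borel_projection a \<Delta>"
proof -
  have "(THE E. spectral_measure a E) = borel_projection a"
    by (rule the_equality, rule spectral_measure_borel_projection, rule spectral_measure_unique)
  then show ?thesis by (simp add: spectral_projection_def)
qed

end


section \<open>Von Neumann algebras and their projections\<close>

lemma projection_antisym:
  assumes "p \<in> projections bounded_ops" "q \<in> projections bounded_ops"
    and "\<And>x. q (p x) = blinfun_apply p x" "\<And>x. p (q x) = blinfun_apply q x"
  shows "p = q"
proof (rule blinfun_inner_eqI)
  fix x y
  have "inner (p x) y = inner x (q (p y))" using assms projection_apply(2) by metis
  also have "\<dots> = inner (q x) y" using assms projection_apply(2) by metis
  finally show "inner (p x) y = inner (q x) y" .
qed

text \<open>This turns the order into an algebraic relation, which an automorphism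
  preserves.\<close>

lemma op_le_projection_iff:
  fixes p q :: "'h::chilbert_space \<Rightarrow>\<^sub>L 'h"
  assumes p: "p \<in> projections bounded_ops" and q: "q \<in> projections bounded_ops"
  shows "op_le p q \<longleftrightarrow> q o\<^sub>L p = p"
proof -
  have *: "cinner x ((q - p) x) = complex_of_real ((norm (q x))\<^sup>2 - (norm (p x))\<^sup>2)" for x
    using p q by (subst cinner_selfadjoint)
      (auto simp: projection_apply(3,4) bounded_ops_diff selfadjoint_diff projection_selfadjoint
        blinfun.diff_left inner_diff_right)
  have 1: "op_le p q \<longleftrightarrow> (\<forall>x. norm (p x) \<le> norm (q x))"
    unfolding op_le_def * nonneg_Reals_of_real_iff by simp
  show ?thesis
  proof
    assume le: "op_le p q"
    show "q o\<^sub>L p = p"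
    proof (rule blinfun_eqI)
      fix x
      have "norm (p x) \<le> norm (q (p x))" using le 1 projection_apply(1)[OF p] by metis
      then have "(norm ((id_blinfun - q) (p x)))\<^sup>2 \<le> 0"
        unfolding projection_compl(2)[OF q] by simp
      then show "(q o\<^sub>L p) x = p x" by (simp add: blinfun.diff_left)
    qed
  next
    assume eq: "q o\<^sub>L p = p"
    have "p x = p (q x)" for x
    proof (rule subspace_eqI[OF subspace_UNIV])
      fix y
      have "inner (p x) y = inner x (q (p y))"
        using eq projection_apply(2)[OF p] by (metis blinfun_apply_blinfun_compose)
      then show "inner (p x) y = inner (p (q x)) y"
        by (simp add: projection_apply(2)[OF p] projection_apply(2)[OF q])
    qed auto
    then show "op_le p q" unfolding 1 using norm_projection_le[OF p] by metis
  qed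
qed

section \<open>Kernel projections and meets\<close>

definition kernel_proj :: "('h::chilbert_space \<Rightarrow>\<^sub>L 'h) set \<Rightarrow> ('h \<Rightarrow>\<^sub>L 'h)" where
  "kernel_proj F = orth_proj {x. \<forall>S\<in>F. blinfun_apply S x = 0}"

lemma kernel_proj_apply: "S \<in> F \<Longrightarrow> blinfun_apply S (kernel_proj F x) = 0"
  using orth_proj_mem[OF joint_kernel[where p = "\<lambda>S. S" and I = F]] by (auto simp: kernel_proj_def)

lemma kernel_proj_fix: "kernel_proj F x = x \<longleftrightarrow> (\<forall>S\<in>F. blinfun_apply S x = 0)"
  using orth_proj_fix[OF joint_kernel[where p = "\<lambda>S. S" and I = F]] by (simp add: kernel_proj_def)

lemma von_neumann_algebraD:
  assumes "von_neumann_algebra A"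
  shows "A \<subseteq> bounded_ops" "T \<in> A \<Longrightarrow> adj T \<in> A" "commutant (commutant A) = A"
  using assms by (auto simp: von_neumann_algebra_def)

lemma von_neumann_algebra_closed:
  assumes "von_neumann_algebra A"
  shows "id_blinfun \<in> A" "0 \<in> A"
    "S \<in> A \<Longrightarrow> T \<in> A \<Longrightarrow> S + T \<in> A" "S \<in> A \<Longrightarrow> T \<in> A \<Longrightarrow> S - T \<in> A"
    "S \<in> A \<Longrightarrow> T \<in> A \<Longrightarrow> S o\<^sub>L T \<in> A" "S \<in> A \<Longrightarrow> r *\<^sub>R S \<in> A" "S \<in> A \<Longrightarrow> scale_op c S \<in> A"
  using commutant_id[of "commutant A"] commutant_zero[of "commutant A"] commutant_add[of _ "commutant A"]
    commutant_diff[of _ "commutant A"] commutant_compose[of _ "commutant A"]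
    commutant_scaleR[of _ "commutant A"] commutant_scale_op[OF commutant_bounded_ops, of _ A]
  unfolding von_neumann_algebraD(3)[OF assms] by auto

lemma von_neumann_algebra_bicommutant: "von_neumann_algebra A \<Longrightarrow> a \<in> A \<Longrightarrow> bicommutant a \<subseteq> A"
  using commutant_antimono[OF commutant_antimono[of "{a}" A]] von_neumann_algebraD(3) by blast

text \<open>Stated for commutants because it is also applied to a commutative algebra inside its own
  commutant, before that algebra is known to be a von Neumann algebra.\<close>

lemma kernel_proj_commutant:
  assumes "M \<subseteq> bounded_ops" "\<And>T. T \<in> M \<Longrightarrow> adj T \<in> M" "F \<subseteq> commutant M"
  shows "kernel_proj F \<in> projections (commutant M)"
proof -
  note K = joint_kernel[where p = "\<lambda>S. S" and I = F]
  have FB: "S \<in> bounded_ops" if "S \<in> F" for S using that assms(3) commutant_bounded_ops by blast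
  have "kernel_proj F \<in> commutant M"
    unfolding kernel_proj_def
    by (rule orth_proj_commutant[OF K _ assms(1,2)])
      (use assms(3) in \<open>auto simp: bounded_opsD[OF FB] commutant_apply subset_iff\<close>)
  moreover from this have "kernel_proj F \<in> projections bounded_ops"
    unfolding kernel_proj_def using orth_proj_projection[OF K] commutant_bounded_ops by blast
  ultimately show ?thesis by (simp add: projections_def)
qed

lemma kernel_proj_von_neumann:
  assumes "von_neumann_algebra A" "F \<subseteq> A"
  shows "kernel_proj F \<in> projections A"
  using kernel_proj_commutant[OF commutant_bounded_ops, of A F]
    commutant_adj[OF von_neumann_algebraD(1,2)[OF assms(1)]] assms
  by (simp add: von_neumann_algebraD(3))

lemma projections_mono: "M \<subseteq> N \<Longrightarrow> projections M \<subseteq> projections N"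
  by (auto simp: projections_def)

lemma projections_bounded_ops: "von_neumann_algebra A \<Longrightarrow> p \<in> projections A \<Longrightarrow> p \<in> projections bounded_ops"
  using projections_mono von_neumann_algebraD(1) by blast

text \<open>A vector annihilated by all complements 1 - q is one fixed by all q, so the kernel
  projection of the complements is the meet of the q.\<close>

lemma outer_das_eq:
  assumes D: "von_neumann_algebra D"
  shows "outer_das D p = kernel_proj ((\<lambda>q. id_blinfun - q) ` {q \<in> projections D. op_le p q})"
proof -
  define G where "G = {q \<in> projections D. op_le p q}"
  define r where "r = kernel_proj ((\<lambda>q. id_blinfun - q) ` G)"
  have pb: "q \<in> projections bounded_ops" if "q \<in> projections D" for q
    using that projections_bounded_ops[OF D] by blast
  have "projections D \<subseteq> D" by (auto simp: projections_def)
  then have r: "r \<in> projections D"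
    unfolding r_def G_def
    by (intro kernel_proj_von_neumann[OF D]) (auto intro!: von_neumann_algebra_closed(1,4)[OF D])
  have lower: "op_le r q" if "q \<in> projections D" "op_le p q" for q
  proof -
    have "(id_blinfun - q) (r x) = 0" for x
      unfolding r_def by (rule kernel_proj_apply) (use that in \<open>auto simp: G_def\<close>)
    then show ?thesis
      using op_le_projection_iff[OF pb[OF r] pb[OF that(1)]] by (simp add: blinfun.diff_left blinfun_eq_iff)
  qed
  have greatest: "op_le s r" if "s \<in> projections D" "\<forall>q\<in>projections D. op_le p q \<longrightarrow> op_le s q" for s
  proof -
    have "r (s x) = s x" for x
      unfolding r_def kernel_proj_fix
    proof safe
      fix q assume "q \<in> G"
      then have "q \<in> projections D" "op_le s q" using that(2) by (auto simp: G_def)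
      then have "q o\<^sub>L s = s" using op_le_projection_iff[OF pb[OF that(1)] pb] by blast
      then show "(id_blinfun - q) (s x) = 0" by (simp add: blinfun.diff_left blinfun_eq_iff)
    qed
    then show ?thesis using op_le_projection_iff[OF pb[OF that(1)] pb[OF r]] by (simp add: blinfun_eq_iff)
  qed
  have "outer_das D p = r"
    unfolding outer_das_def
  proof (rule the_equality)
    show "r \<in> projections D \<and> (\<forall>q\<in>projections D. op_le p q \<longrightarrow> op_le r q) \<and>
      (\<forall>s\<in>projections D. (\<forall>q\<in>projections D. op_le p q \<longrightarrow> op_le s q) \<longrightarrow> op_le s r)"
      using r lower greatest by blast
    fix s assume s: "s \<in> projections D \<and> (\<forall>q\<in>projections D. op_le p q \<longrightarrow> op_le s q) \<and>
      (\<forall>t\<in>projections D. (\<forall>q\<in>projections D. op_le p q \<longrightarrow> op_le t q) \<longrightarrow> op_le t s)"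
    then have sp: "s \<in> projections D" and "op_le s r" "op_le r s" using r lower greatest by blast+
    then have "r o\<^sub>L s = s" "s o\<^sub>L r = r" using op_le_projection_iff[OF pb pb] r by blast+
    then show "s = r" by (intro projection_antisym pb sp r) (auto simp: blinfun_eq_iff)
  qed
  then show ?thesis by (simp add: r_def G_def)
qed

lemma outer_das_projection: "von_neumann_algebra D \<Longrightarrow> outer_das D p \<in> projections D"
  unfolding outer_das_eq
  by (rule kernel_proj_von_neumann)
    (auto simp: projections_def intro!: von_neumann_algebra_closed(1,4))

text \<open>D offers fewer projections above p, so its meet is larger. The product form is the one
  to which a character can be applied.\<close>

lemma outer_das_antimono:
  assumes D: "von_neumann_algebra D" and C: "von_neumann_algebra C" "D \<subseteq> C"
  shows "outer_das D p o\<^sub>L outer_das C p = outer_das C p"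
proof (rule blinfun_eqI)
  fix x
  have "outer_das D p (outer_das C p x) = outer_das C p x"
    unfolding outer_das_eq[OF D] kernel_proj_fix
    unfolding outer_das_eq[OF C(1)]
    by (intro ballI kernel_proj_apply) (use projections_mono[OF C(2)] in blast)
  then show "(outer_das D p o\<^sub>L outer_das C p) x = outer_das C p x" by simp
qed

section \<open>Automorphisms\<close>

lemma scale_op_of_real: "scale_op (complex_of_real r) T = r *\<^sub>R T"
  by (rule blinfun_eqI) (simp add: scale_op_apply blinfun.scaleR_left scaleR_scaleC)

lemma star_automorphism_inv:
  assumes A: "von_neumann_algebra A" and h: "star_automorphism A h"
  shows "star_automorphism A (inv_into A h)"
proof -
  have bij: "bij_betw h A A" using h by (simp add: star_automorphism_def)
  note inv = bij_betw_inv_into_right[OF bij] bij_betw_apply[OF bij_betw_inv_into[OF bij]]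
  have eqI: "inv_into A h S = T" if "T \<in> A" "h T = S" for S T
    using that bij_betw_inv_into_left[OF bij] by blast
  note c = von_neumann_algebra_closed[OF A] von_neumann_algebraD(2)[OF A]
  show ?thesis
    unfolding star_automorphism_def
    by (intro conjI ballI allI bij_betw_inv_into[OF bij] eqI)
      (use h in \<open>auto simp: star_automorphism_def inv intro!: c\<close>)
qed

locale algebra_automorphism =
  fixes A :: "('h::chilbert_space \<Rightarrow>\<^sub>L 'h) set" and h
  assumes A: "von_neumann_algebra A" and h: "star_automorphism A h"
begin

lemma bij: "bij_betw h A A"
  and h_mem: "T \<in> A \<Longrightarrow> h T \<in> A"
  and h_add: "S \<in> A \<Longrightarrow> T \<in> A \<Longrightarrow> h (S + T) = h S + h T"
  and h_scale: "T \<in> A \<Longrightarrow> h (scale_op c T) = scale_op c (h T)"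
  and h_compose: "S \<in> A \<Longrightarrow> T \<in> A \<Longrightarrow> h (S o\<^sub>L T) = h S o\<^sub>L h T"
  and h_adj: "T \<in> A \<Longrightarrow> h (adj T) = adj (h T)"
  using h bij_betw_apply[of h A A] by (auto simp: star_automorphism_def)

lemma h_inj: "S \<in> A \<Longrightarrow> T \<in> A \<Longrightarrow> h S = h T \<longleftrightarrow> S = T"
  using bij by (auto simp: bij_betw_def inj_on_def)

lemma h_surj: "T \<in> A \<Longrightarrow> \<exists>S\<in>A. h S = T"
  using bij_betw_imp_surj_on[OF bij] by (metis imageE)

lemma h_scaleR: "T \<in> A \<Longrightarrow> h (r *\<^sub>R T) = r *\<^sub>R h T"
  using h_scale[of T "complex_of_real r"] by (simp add: scale_op_of_real)

lemma h_zero: "h 0 = 0"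
  using h_scaleR[of 0 0] von_neumann_algebra_closed(2)[OF A] by simp

lemma h_diff:
  assumes "S \<in> A" "T \<in> A" shows "h (S - T) = h S - h T"
proof -
  have "h (S - T) + h T = h S"
    using h_add[of "S - T" T] assms von_neumann_algebra_closed(4)[OF A] by simp
  then show ?thesis by (simp add: eq_diff_eq)
qed

lemma h_id: "h id_blinfun = id_blinfun"
proof -
  note id = von_neumann_algebra_closed(1)[OF A]
  obtain S where S: "S \<in> A" "h S = id_blinfun" using h_surj[OF id] by blast
  have "id_blinfun o\<^sub>L S = S" by (simp add: blinfun_eq_iff)
  then have "h id_blinfun o\<^sub>L id_blinfun = id_blinfun" using h_compose[OF id S(1)] S(2) by simp
  then show ?thesis by (simp add: blinfun_eq_iff)
qed

lemma h_projection_iff: "p \<in> A \<Longrightarrow> h p \<in> projections A \<longleftrightarrow> p \<in> projections A"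
  using h_compose[of p p] h_adj[of p] h_inj[of "p o\<^sub>L p" p] h_inj[of "adj p" p]
    von_neumann_algebra_closed(5)[OF A] von_neumann_algebraD(2)[OF A]
  by (auto simp: projections_def h_mem)

lemma h_selfadjoint:
  assumes "a \<in> A" "selfadjoint a" shows "selfadjoint (h a)"
  using assms h_adj[of a] h_mem von_neumann_algebraD(1)[OF A] adj_eq_self_iff by (metis subsetD)

lemma h_apply_eq_0:
  assumes "S \<in> A" "T \<in> A" shows "(\<forall>x. S (T x) = 0) \<longleftrightarrow> (\<forall>x. h S (h T x) = 0)"
proof -
  have "(\<forall>x. S (T x) = 0) \<longleftrightarrow> S o\<^sub>L T = 0" by (simp add: blinfun_eq_iff)
  also have "\<dots> \<longleftrightarrow> h S o\<^sub>L h T = 0"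
    using h_inj[of "S o\<^sub>L T" 0] von_neumann_algebra_closed(2,5)[OF A] assms
    by (simp add: h_zero h_compose)
  finally show ?thesis by (simp add: blinfun_eq_iff)
qed

text \<open>The kernel projection is the largest projection of \<open>A\<close> annihilated by \<open>F\<close>, an algebraic
  characterisation; this is what makes an abstract automorphism compatible with suprema and
  spectral projections.\<close>

lemma h_kernel_proj:
  assumes F: "F \<subseteq> A"
  shows "h (kernel_proj F) = kernel_proj (h ` F)"
proof -
  have hF: "h ` F \<subseteq> A" using F h_mem by blast
  define p where "p = kernel_proj F"
  define r where "r = kernel_proj (h ` F)"
  have p: "p \<in> projections A" unfolding p_def by (rule kernel_proj_von_neumann[OF A F])
  have r: "r \<in> projections A" unfolding r_def by (rule kernel_proj_von_neumann[OF A hF])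
  have pA: "p \<in> A" using p by (simp add: projections_def)
  \<comment> \<open>That h p lies below r is immediate from annihilation by h[F]. For the converse,
    r is pulled back: F annihilates s, so p s = s, and applying h gives h p r = r.\<close>
  obtain s where s: "s \<in> A" "h s = r" using h_surj r by (auto simp: projections_def)
  have "h S (h p x) = 0" if "S \<in> F" for S x
    using h_apply_eq_0[of S p] kernel_proj_apply[OF that] that F pA by (auto simp: p_def)
  then have 1: "r (h p x) = h p x" for x by (simp add: r_def kernel_proj_fix)
  have "S (s x) = 0" if "S \<in> F" for S x
    using h_apply_eq_0[of S s] kernel_proj_apply[of "h S" "h ` F"] that F s by (auto simp: r_def)
  then have "p (s x) = s x" for x by (simp add: p_def kernel_proj_fix)
  then have "p o\<^sub>L s = s" by (simp add: blinfun_eq_iff)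
  then have "h p o\<^sub>L r = r" using h_compose[OF pA s(1)] s(2) by simp
  then have 2: "h p (r x) = r x" for x by (simp add: blinfun_eq_iff)
  have "h p \<in> projections A" using h_projection_iff[OF pA] p by simp
  then show ?thesis
    using projection_antisym[of "h p" r] projections_bounded_ops[OF A] r 1 2
    by (simp add: p_def r_def)
qed

section \<open>Spectral projections under the automorphism\<close>

context
  fixes a
  assumes aA: "a \<in> A" and sa: "selfadjoint a"
begin

lemma aB: "a \<in> bounded_ops" and haB: "h a \<in> bounded_ops" and hsa: "selfadjoint (h a)"
  using aA sa h_mem h_selfadjoint von_neumann_algebraD(1)[OF A] by auto

lemma cut_mem: "cut a l \<in> A"
  using cut(1)[OF aB sa] von_neumann_algebra_bicommutant[OF A aA] by blast

lemma borel_projection_mem: "\<Delta> \<in> sets borel \<Longrightarrow> borel_projection a \<Delta> \<in> A"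
  using borel_projection_bicommutant[OF aB sa] von_neumann_algebra_bicommutant[OF A aA] by blast

text \<open>The operator h d need not be the root that \<open>abs_operator_exists\<close> selects
  for h b. It satisfies the relations demanded by \<open>spectral_cut_kernel\<close>, and uniqueness
  of cuts does the rest.\<close>

lemma h_cut: "h (cut a l) = cut (h a) l"
proof -
  obtain b d where bd: "b = a - l *\<^sub>R id_blinfun" "d \<in> bicommutant a" "selfadjoint d"
    "(d o\<^sub>L d) o\<^sub>L (d o\<^sub>L d) = b o\<^sub>L b"
    "spectral_cut a l (orth_proj {x. blinfun_apply ((d o\<^sub>L d) + b) x = 0})"
    using spectral_cut_exists[OF aB sa] by metis
  note c = von_neumann_algebra_closed[OF A]
  have dA: "d \<in> A" using bd(2) von_neumann_algebra_bicommutant[OF A aA] by blast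
  have bA: "b \<in> A" unfolding bd(1) by (intro c aA)
  have SA: "(d o\<^sub>L d) + b \<in> A" by (intro c dA bA)
  have "cut a l = kernel_proj {(d o\<^sub>L d) + b}"
    using cut_eqI[OF aB sa bd(5)] by (simp add: kernel_proj_def)
  then have "h (cut a l) = kernel_proj {h ((d o\<^sub>L d) + b)}"
    using h_kernel_proj[of "{(d o\<^sub>L d) + b}"] SA by simp
  also have "h ((d o\<^sub>L d) + b) = (h d o\<^sub>L h d) + h b"
    by (simp add: h_add h_compose dA bA c)
  finally have eq: "h (cut a l) = kernel_proj {(h d o\<^sub>L h d) + h b}" .
  have "spectral_cut (h a) l (orth_proj {x. blinfun_apply ((h d o\<^sub>L h d) + h b) x = 0})"
  proof (rule spectral_cut_kernel[OF haB hsa])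
    show "h b = h a - l *\<^sub>R id_blinfun"
      unfolding bd(1) by (simp add: h_diff aA c h_scaleR h_id)
    show "h d \<in> bounded_ops" using h_mem[OF dA] von_neumann_algebraD(1)[OF A] by blast
    show "selfadjoint (h d)" by (rule h_selfadjoint[OF dA bd(3)])
    have "d o\<^sub>L a = a o\<^sub>L d"
      using bicommutant_commute[OF aB bd(2) bicommutant_self[OF aB]] by (simp add: blinfun_eq_iff)
    then have "h d o\<^sub>L h a = h a o\<^sub>L h d" using h_compose aA dA by metis
    then show "h d (h a x) = h a (h d x)" for x by (simp add: blinfun_eq_iff)
    have "h ((d o\<^sub>L d) o\<^sub>L (d o\<^sub>L d)) = h (b o\<^sub>L b)" by (simp only: bd(4))
    then show "(h d o\<^sub>L h d) o\<^sub>L (h d o\<^sub>L h d) = h b o\<^sub>L h b"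
      by (simp add: h_compose dA bA c)
  qed
  then show ?thesis unfolding eq using cut_eqI[OF haB hsa] by (simp add: kernel_proj_def)
qed

text \<open>An abstract automorphism cannot be moved through a pointwise limit of operators; the
  kernel projection is the algebraic substitute for the sum.\<close>

lemma borel_projection_UN_kernel:
  fixes F :: "nat \<Rightarrow> real set"
  assumes F: "disjoint_family F" "range F \<subseteq> sets borel" and b: "b \<in> bounded_ops" "selfadjoint b"
  shows "borel_projection b (\<Union>n. F n) = id_blinfun - kernel_proj (range (\<lambda>n. borel_projection b (F n)))"
proof (rule blinfun_eqI)
  fix x
  have F': "F n \<in> sets borel" for n using F(2) by auto
  have orth: "borel_projection b (F m) (borel_projection b (F n) y) = 0" if "m \<noteq> n" for m n y
    by (rule represents_disjoint_orthogonal[OF b borel_projection[OF b F'] borel_projection[OF b F']])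
      (use that F(1) F' in \<open>auto simp: disjoint_family_on_def\<close>)
  have "(\<lambda>n. borel_projection b (F n) x) sums
      (x - orth_proj {x. \<forall>n\<in>UNIV. borel_projection b (F n) x = 0} x)"
    by (rule orthogonal_projections_sums[OF borel_projection_projection[OF b F'] orth])
  then show "borel_projection b (\<Union>n. F n) x =
      (id_blinfun - kernel_proj (range (\<lambda>n. borel_projection b (F n)))) x"
    using sums_unique2[OF borel_projection_UN[OF b F]] by (simp add: kernel_proj_def blinfun.diff_left)
qed

lemma h_borel_projection:
  assumes "\<Delta> \<in> sets borel"
  shows "h (borel_projection a \<Delta>) = borel_projection (h a) \<Delta>"
  using assms
proof (induction rule: borel_induct_atMost)
  case (atMost l)
  then show ?case by (simp add: borel_projection_atMost[OF aB sa] borel_projection_atMost[OF haB hsa] h_cut)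
next
  case empty
  have "borel_projection b {} = 0" if b: "b \<in> bounded_ops" "selfadjoint b" for b :: "'h \<Rightarrow>\<^sub>L 'h"
    using norm_borel_projection[OF b, of "{}"] by (simp add: blinfun_eq_iff)
  then show ?case using aB haB sa hsa h_zero by simp
next
  case (compl \<Delta>)
  then show ?case
    by (simp add: borel_projection_compl[OF aB sa] borel_projection_compl[OF haB hsa] h_diff h_id
        borel_projection_mem von_neumann_algebra_closed(1)[OF A])
next
  case (union F)
  have F': "F n \<in> sets borel" for n using union(2) by auto
  have mem: "range (\<lambda>n. borel_projection a (F n)) \<subseteq> A" using borel_projection_mem[OF F'] by blast
  have "h ` range (\<lambda>n. borel_projection a (F n)) = range (\<lambda>n. borel_projection (h a) (F n))"
    by (simp add: image_image union(3))
  moreover have "kernel_proj (range (\<lambda>n. borel_projection a (F n))) \<in> A"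
    using kernel_proj_von_neumann[OF A mem] by (simp add: projections_def)
  ultimately show ?case
    unfolding borel_projection_UN_kernel[OF union(1,2) aB sa] borel_projection_UN_kernel[OF union(1,2) haB hsa]
    by (simp add: h_diff h_id von_neumann_algebra_closed(1)[OF A] h_kernel_proj[OF mem])
qed

end

lemma h_op_le_iff:
  assumes "p \<in> projections A" "q \<in> projections A"
  shows "op_le (h p) (h q) \<longleftrightarrow> op_le p q"
proof -
  have pq: "p \<in> A" "q \<in> A" using assms by (auto simp: projections_def)
  then have "h p \<in> projections A" "h q \<in> projections A" using assms h_projection_iff by auto
  then show ?thesis
    using assms pq h_inj[of "q o\<^sub>L p" p] h_compose[of q p] von_neumann_algebra_closed(5)[OF A]
    by (simp add: op_le_projection_iff projections_bounded_ops[OF A])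
qed

lemma h_image_projections: "D \<subseteq> A \<Longrightarrow> projections (h ` D) = h ` projections D"
proof -
  assume D: "D \<subseteq> A"
  have restr: "projections X = {p \<in> X. p \<in> projections A}" if "X \<subseteq> A" for X
    using that by (auto simp: projections_def)
  have "h ` D \<subseteq> A" using D h_mem by blast
  then show ?thesis unfolding restr[OF D] restr[OF \<open>h ` D \<subseteq> A\<close>] using D h_projection_iff by blast
qed

lemma h_outer_das:
  assumes D: "von_neumann_algebra D" "D \<subseteq> A" and hD: "von_neumann_algebra (h ` D)" and p: "p \<in> projections A"
  shows "h (outer_das D p) = outer_das (h ` D) (h p)"
proof -
  define G where "G = {q \<in> projections D. op_le p q}"
  have GA: "G \<subseteq> projections A" unfolding G_def using projections_mono[OF D(2)] by auto
  have "{q \<in> projections (h ` D). op_le (h p) q} = h ` G"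
    unfolding h_image_projections[OF D(2)] G_def
    using h_op_le_iff[OF p] projections_mono[OF D(2)] by blast
  moreover have "(\<lambda>q. id_blinfun - q) ` h ` G = h ` (\<lambda>q. id_blinfun - q) ` G"
    unfolding image_image using GA von_neumann_algebra_closed(1)[OF A]
    by (intro image_cong) (auto simp: h_diff h_id projections_def)
  moreover have "(\<lambda>q. id_blinfun - q) ` G \<subseteq> A"
    using GA von_neumann_algebra_closed(1,4)[OF A] by (auto simp: projections_def)
  ultimately show ?thesis
    unfolding outer_das_eq[OF D(1)] outer_das_eq[OF hD] G_def[symmetric]
    by (simp add: h_kernel_proj)
qed

end


section \<open>Images of contexts are contexts\<close>

lemma contextsD:
  assumes "D \<in> contexts A"
  shows "von_neumann_algebra D" "D \<subseteq> A" "S \<in> D \<Longrightarrow> T \<in> D \<Longrightarrow> S o\<^sub>L T = T o\<^sub>L S"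
  using assms by (auto simp: contexts_def)

lemma subspace_closure:
  fixes V :: "'a::real_normed_vector set"
  assumes "subspace V" shows "subspace (closure V)"
  unfolding subspace_def
proof (intro conjI ballI allI)
  show "0 \<in> closure V" using subspace_0[OF assms] closure_subset by blast
  show "x + y \<in> closure V" if xy: "x \<in> closure V" "y \<in> closure V" for x y
  proof -
    obtain f g where "\<And>n. f n \<in> V" "f \<longlonglongrightarrow> x" "\<And>n. g n \<in> V" "g \<longlonglongrightarrow> y"
      using xy unfolding closure_sequential by blast
    then show ?thesis unfolding closure_sequential
      by (intro exI[of _ "\<lambda>n. f n + g n"]) (auto intro: subspace_add[OF assms] tendsto_add)
  qed
  show "c *\<^sub>R x \<in> closure V" if x: "x \<in> closure V" for c x
  proof -
    obtain f where "\<And>n. f n \<in> V" "f \<longlonglongrightarrow> x" using x unfolding closure_sequential by blast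
    then show ?thesis unfolding closure_sequential
      by (intro exI[of _ "\<lambda>n. c *\<^sub>R f n"]) (auto intro: subspace_scale[OF assms] tendsto_scaleR)
  qed
qed

text \<open>Such an algebra turns out to be its own bicommutant; compare Kadison's theorem on monotone
  closed algebras.\<close>

locale monotone_closed_algebra =
  fixes B :: "('h::chilbert_space \<Rightarrow>\<^sub>L 'h) set"
  assumes B_ops: "B \<subseteq> bounded_ops" and B_adj: "T \<in> B \<Longrightarrow> adj T \<in> B" and B_id: "id_blinfun \<in> B"
    and B_add: "S \<in> B \<Longrightarrow> T \<in> B \<Longrightarrow> S + T \<in> B" and B_diff: "S \<in> B \<Longrightarrow> T \<in> B \<Longrightarrow> S - T \<in> B"
    and B_compose: "S \<in> B \<Longrightarrow> T \<in> B \<Longrightarrow> S o\<^sub>L T \<in> B" and B_scale: "S \<in> B \<Longrightarrow> scale_op c S \<in> B"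
    and B_commute: "S \<in> B \<Longrightarrow> T \<in> B \<Longrightarrow> S o\<^sub>L T = T o\<^sub>L S"
    and B_cut: "T \<in> B \<Longrightarrow> selfadjoint T \<Longrightarrow> cut T l \<in> B"
    and B_kernel: "F \<subseteq> B \<Longrightarrow> kernel_proj F \<in> B"
begin

lemma commute: "S \<in> B \<Longrightarrow> T \<in> B \<Longrightarrow> blinfun_apply S (T x) = T (S x)"
  using B_commute[of S T] by (simp add: blinfun_eq_iff)

lemma B_subset_commutant: "B \<subseteq> commutant B"
  using B_ops commute by (auto simp: commutant_iff)

lemma kernel_projection: "kernel_proj F \<in> projections bounded_ops" if "F \<subseteq> B"
proof -
  have "kernel_proj F \<in> projections (commutant B)"
    by (rule kernel_proj_commutant[OF B_ops B_adj]) (use that B_subset_commutant in auto)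
  then show ?thesis using projections_mono[OF commutant_bounded_ops] by blast
qed

text \<open>Von Neumann's density argument for the single vector z = x + y: the projection onto the
  closure of B z lies in the commutant of B, hence commutes with P, so x = P z lies in that closure.
  One vector controls both conditions, since P also commutes with T and splits T z - x into T x - x
  and T y.\<close>

lemma approximate_separation:
  assumes P: "P \<in> commutant (commutant B)" "P \<in> projections bounded_ops"
    and x: "P x = x" and y: "P y = 0" and e: "0 < e"
  obtains T where "T \<in> B" "norm (T x - x) \<le> e" "norm (blinfun_apply T y) \<le> e"
proof -
  define z where "z = x + y"
  define V where "V = (\<lambda>T. blinfun_apply T z) ` B"
  have V: "subspace V"
    unfolding subspace_def
  proof (intro conjI ballI allI)
    show "0 \<in> V" using B_diff[OF B_id B_id] by (auto simp: V_def image_iff intro!: bexI[of _ 0])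
    show "u + v \<in> V" if uv: "u \<in> V" "v \<in> V" for u v
    proof -
      obtain S T where "S \<in> B" "T \<in> B" "u = S z" "v = T z" using uv unfolding V_def by blast
      then show ?thesis unfolding V_def by (intro image_eqI[of _ _ "S + T"]) (auto simp: blinfun.add_left B_add)
    qed
    show "c *\<^sub>R u \<in> V" if u: "u \<in> V" for c u
    proof -
      obtain S where "S \<in> B" "u = S z" using u unfolding V_def by blast
      then show ?thesis unfolding V_def
        using B_scale[of S "complex_of_real c"]
        by (intro image_eqI[of _ _ "c *\<^sub>R S"]) (simp_all add: scale_op_of_real blinfun.scaleR_left)
    qed
  qed
  have K: "subspace (closure V)" "closed (closure V)"
    using V by (auto intro: subspace_closure)
  have invV: "f ` closure V \<subseteq> closure V" if "bounded_linear f" "f ` V \<subseteq> V" for f :: "'h \<Rightarrow> 'h"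
  proof -
    have "f ` closure V \<subseteq> closure (f ` V)"
      using closure_bounded_linear_image_subset[OF that(1)] .
    also have "\<dots> \<subseteq> closure V" using that(2) by (rule closure_mono)
    finally show ?thesis .
  qed
  have "orth_proj (closure V) \<in> commutant B"
  proof (rule orth_proj_commutant[OF K _ B_ops B_adj])
    fix c u assume "u \<in> closure V"
    moreover have "(\<lambda>u. c *\<^sub>C u) ` V \<subseteq> V"
    proof clarify
      fix u assume "u \<in> V"
      then obtain S where "S \<in> B" "u = S z" by (auto simp: V_def)
      then show "c *\<^sub>C u \<in> V" unfolding V_def
        by (intro image_eqI[of _ _ "scale_op c S"]) (auto simp: B_scale scale_op_apply)
    qed
    ultimately show "c *\<^sub>C u \<in> closure V" using invV[OF bounded_linear_scaleC] by blast
  next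
    fix T u assume T: "T \<in> B" and "u \<in> closure V"
    moreover have "blinfun_apply T ` V \<subseteq> V"
    proof clarify
      fix u assume "u \<in> V"
      then obtain S where "S \<in> B" "u = S z" by (auto simp: V_def)
      then show "T u \<in> V" unfolding V_def
        by (intro image_eqI[of _ _ "T o\<^sub>L S"]) (auto simp: B_compose T)
    qed
    ultimately show "T u \<in> closure V" using invV[OF blinfun.bounded_linear_right] by blast
  qed
  then have comm: "P (orth_proj (closure V) z) = orth_proj (closure V) (P z)"
    using commutant_apply[OF P(1)] by blast
  have "z \<in> V" unfolding V_def by (intro image_eqI[of _ _ id_blinfun]) (auto simp: B_id)
  then have "orth_proj (closure V) z = z" using orth_proj_fix[OF K] closure_subset by blast
  moreover have Pz: "P z = x" by (simp add: z_def blinfun.add_right x y)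
  ultimately have "orth_proj (closure V) x = x" using comm by simp
  then have "x \<in> closure V" using orth_proj_fix[OF K] by blast
  then obtain v where "v \<in> V" "dist v x < e" using e closure_approachable by blast
  then obtain T where T: "T \<in> B" "norm (T z - x) < e" by (auto simp: V_def dist_norm)
  have PT: "P (T u) = T (P u)" for u
    using commutant_apply[OF P(1)] T(1) B_subset_commutant by blast
  have 1: "T x - x = P (T z - x)" by (simp add: blinfun.diff_right PT Pz x)
  have 2: "T y = (id_blinfun - P) (T z - x)"
    by (simp add: blinfun.diff_left blinfun.diff_right PT Pz x) (simp add: z_def blinfun.add_right)
  show ?thesis
  proof
    show "norm (T x - x) \<le> e" unfolding 1 using norm_projection_le[OF P(2)] T(2) by (meson less_imp_le order_trans)
    show "norm (T y) \<le> e" unfolding 2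
      using norm_projection_le[OF projection_compl(1)[OF P(2)]] T(2) by (meson less_imp_le order_trans)
  qed (rule T(1))
qed

lemma approximate_projection:
  assumes P: "P \<in> commutant (commutant B)" "P \<in> projections bounded_ops"
    and x: "P x = x" and y: "P y = 0" and e: "0 < e"
  obtains p where "p \<in> B" "p \<in> projections bounded_ops"
    "norm (blinfun_apply p x) \<le> 2 * e" "norm (y - p y) \<le> 2 * e"
proof -
  obtain T where T: "T \<in> B" "norm (T x - x) \<le> e" "norm (T y) \<le> e"
    using approximate_separation[OF assms] by blast
  have TB: "T \<in> bounded_ops" using T(1) B_ops by blast
  define S where "S = adj T o\<^sub>L T"
  have S: "S \<in> B" "S \<in> bounded_ops" "selfadjoint S"
    using T(1) B_adj B_compose B_ops adj_inner[OF TB] adj_inner'[OF TB]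
    by (auto simp: S_def selfadjoint_def)
  have quad: "inner u (S u) = (norm (T u))\<^sup>2" for u
    using adj_inner'[OF TB, of u "T u"] by (simp add: S_def power2_norm_eq_inner)
  \<comment> \<open>This is the part where |T| is at most 1/2, midway between the approximate values
    1 at x and 0 at y. Below the threshold T x - x cannot be small unless p x is, and above it |T w|
    controls |w|; the factor 2 is the reciprocal of 1/2.\<close>
  define p where "p = cut S (1/4)"
  have p: "p \<in> B" "p \<in> projections bounded_ops"
    unfolding p_def by (rule B_cut[OF S(1,3)], rule cut_projection[OF S(2,3)])
  note pp = projection_apply(1)[OF p(2)]
  have pT: "p (T u) = T (p u)" for u by (rule commute[OF p(1) T(1)])
  have "inner (p x) (S (p x)) \<le> 1/4 * inner (p x) (p x)"
    by (rule cut_le[OF S(2,3)]) (simp add: p_def[symmetric] pp)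
  then have "(norm (T (p x)))\<^sup>2 \<le> (norm (p x) / 2)\<^sup>2"
    by (simp add: quad power2_norm_eq_inner[symmetric] power_divide)
  then have "norm (T (p x)) \<le> norm (p x) / 2" by (rule power2_le_imp_le) simp
  moreover have "norm (p x - T (p x)) \<le> e"
    using norm_projection_le[OF p(2), of "x - T x"] T(2)
    by (simp add: blinfun.diff_right pT norm_minus_commute)
  ultimately have 1: "norm (p x) \<le> 2 * e"
    using norm_triangle_sub[of "p x" "T (p x)"] by linarith
  define w where "w = y - p y"
  have "1/4 * inner w w \<le> inner w (S w)"
    by (rule cut_ge[OF S(2,3)]) (simp add: p_def[symmetric] w_def blinfun.diff_right pp)
  then have "(norm w / 2)\<^sup>2 \<le> (norm (T w))\<^sup>2"
    by (simp add: quad power2_norm_eq_inner[symmetric] power_divide)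
  then have "norm w / 2 \<le> norm (T w)" by (rule power2_le_imp_le) simp
  moreover have "norm (T w) \<le> e"
  proof -
    have "T w = (id_blinfun - p) (T y)" by (simp add: w_def blinfun.diff_left blinfun.diff_right pT)
    then show ?thesis using norm_projection_le[OF projection_compl(1)[OF p(2)], of "T y"] T(3) by simp
  qed
  ultimately have "norm w \<le> 2 * e" by linarith
  then show ?thesis using that p 1 by (simp add: w_def)
qed

lemma compose_projections:
  assumes "p \<in> B" "p \<in> projections bounded_ops" "q \<in> B" "q \<in> projections bounded_ops"
  shows "p o\<^sub>L q \<in> projections bounded_ops"
proof -
  note p = projection_apply[OF assms(2)] and q = projection_apply[OF assms(4)]
  have qp: "q (p x) = p (q x)" for x by (rule commute[OF assms(3,1)])
  have "selfadjoint (p o\<^sub>L q)" by (simp add: selfadjoint_def p(2) q(2) qp)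
  then show ?thesis by (simp add: projections_iff bounded_ops_compose p(1,3) q(1,3) qp)
qed

text \<open>The kernel projection of \<open>{1 - p n}\<close> is the infimum of the \<open>p n\<close>.\<close>

lemma norm_inf_projections:
  fixes p :: "nat \<Rightarrow> ('h \<Rightarrow>\<^sub>L 'h)"
  assumes p: "\<And>n. p n \<in> B" "\<And>n. p n \<in> projections bounded_ops"
    and b: "\<And>n. norm (y - p n y) \<le> b * (1/2) ^ n"
  shows "norm (y - kernel_proj (range (\<lambda>n. id_blinfun - p n)) y) \<le> 2 * b"
proof -
  define R where "R = kernel_proj (range (\<lambda>n. id_blinfun - p n))"
  have sub: "range (\<lambda>n. id_blinfun - p n) \<subseteq> B" using p(1) B_diff[OF B_id] by blast
  have RB: "R \<in> B" and RP: "R \<in> projections bounded_ops"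
    unfolding R_def by (rule B_kernel[OF sub], rule kernel_projection[OF sub])
  have R_fix: "R u = u \<longleftrightarrow> (\<forall>n. p n u = u)" for u
    by (auto simp: R_def kernel_proj_fix blinfun.diff_left)
  have pR: "p n (R u) = R u" for n u using R_fix[of "R u"] projection_apply(1)[OF RP] by blast
  have Rp: "R (p n u) = R u" for n u using pR commute[OF RB p(1)] by simp
  \<comment> \<open>The finite products of the commuting p n decrease to their infimum R, which
    gives access to R through limits of vectors.\<close>
  define Q where "Q = rec_nat id_blinfun (\<lambda>n Z. p n o\<^sub>L Z)"
  have Q0: "Q 0 = id_blinfun" and QSuc: "Q (Suc n) = p n o\<^sub>L Q n" for n by (auto simp: Q_def)
  have idp: "id_blinfun \<in> projections bounded_ops"
    by (simp add: projections_iff bounded_ops_id selfadjoint_id)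
  have Q: "Q n \<in> B \<and> Q n \<in> projections bounded_ops" for n
    by (induction n) (auto simp: Q0 QSuc B_id idp p B_compose compose_projections)
  have QB: "Q n \<in> B" and QP: "Q n \<in> projections bounded_ops" for n using Q by auto
  have dec: "Q m (Q n u) = Q n u" if "m \<le> n" for m n u
    using that
  proof (induction n rule: dec_induct)
    case base then show ?case by (rule projection_apply(1)[OF QP])
  next
    case (step n) then show ?case by (simp add: QSuc commute[OF QB p(1)])
  qed
  obtain w where w: "(\<lambda>n. Q n y) \<longlonglongrightarrow> w" "\<And>n. Q n w = w"
    using convergent_decseq_projections[of Q y] QP dec by metis
  have "p n w = w" for n
    using w(2)[of "Suc n"] by (simp add: QSuc w(2))
  then have "R w = w" using R_fix by blast
  moreover have RQ: "R (Q n y) = R y" for n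
    by (induction n) (auto simp: Q0 QSuc Rp)
  then have "R w = R y"
    using LIMSEQ_unique[OF blinfun.tendsto[OF tendsto_const w(1), of R]] by simp
  ultimately have wR: "w = R y" by simp
  have "norm (y - Q n y) \<le> b * (2 - 2 * (1/2) ^ n)" for n
  proof (induction n)
    case (Suc n)
    \<comment> \<open>One further factor costs at most the error of p n at y; the bound being proved
      is the partial sum of the geometric series.\<close>
    have eq: "y - Q (Suc n) y = (y - Q n y) + Q n (y - p n y)"
      by (simp add: QSuc blinfun.diff_right commute[OF QB p(1)])
    have "norm (y - Q (Suc n) y) \<le> norm (y - Q n y) + norm (y - p n y)"
      unfolding eq using norm_triangle_ineq[of "y - Q n y" "Q n (y - p n y)"] norm_projection_le[OF QP, of n "y - p n y"]
      by linarith
    also have "\<dots> \<le> b * (2 - 2 * (1/2) ^ n) + b * (1/2) ^ n" using Suc.IH b[of n] by simp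
    also have "\<dots> = b * (2 - 2 * (1/2) ^ Suc n)" by (simp add: algebra_simps)
    finally show ?case .
  qed (simp add: Q0)
  moreover have "b \<ge> 0" using order_trans[OF norm_ge_zero b[of 0]] by simp
  then have "b * (2 - 2 * (1/2) ^ n) \<le> 2 * b" for n :: nat
    by (simp add: right_diff_distrib)
  ultimately have "norm (y - Q n y) \<le> 2 * b" for n using order_trans by blast
  moreover have "(\<lambda>n. norm (y - Q n y)) \<longlonglongrightarrow> norm (y - R y)"
    unfolding wR[symmetric] by (intro tendsto_intros w)
  ultimately show ?thesis unfolding R_def[symmetric] by (intro LIMSEQ_le_const2) auto
qed

text \<open>A Borel--Cantelli argument: \<open>q\<close> is the complement of the limes inferior of projections that
  almost separate \<open>x\<close> and \<open>y\<close> with summable errors.\<close>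

lemma separating_projection:
  assumes P: "P \<in> commutant (commutant B)" "P \<in> projections bounded_ops"
    and x: "P x = x" and y: "P y = 0"
  obtains q where "q \<in> B" "q \<in> projections bounded_ops" "q x = x" "blinfun_apply q y = 0"
proof -
  have "\<exists>p. p \<in> B \<and> p \<in> projections bounded_ops \<and>
      norm (blinfun_apply p x) \<le> 2 * (1/2) ^ n \<and> norm (y - p y) \<le> 2 * (1/2) ^ n" for n :: nat
    using approximate_projection[OF P x y, of "(1/2) ^ n"] by fastforce
  then obtain p where pB: "\<And>n. p n \<in> B" and pP: "\<And>n. p n \<in> projections bounded_ops"
    and px: "\<And>n. norm (p n x) \<le> 2 * (1/2) ^ n" and py: "\<And>n. norm (y - p n y) \<le> 2 * (1/2) ^ n"
    by metis
  \<comment> \<open>The infimum of the p n with n at least m. It lies below each of them, so |R m x|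
    is below every later error and vanishes, whereas at y the errors add up to a geometric tail that
    tends to 0 with m.\<close>
  define R where "R m = kernel_proj (range (\<lambda>n. id_blinfun - p (m + n)))" for m
  have sub: "range (\<lambda>n. id_blinfun - p (m + n)) \<subseteq> B" for m using pB B_diff[OF B_id] by blast
  have RB: "R m \<in> B" and RP: "R m \<in> projections bounded_ops" for m
    unfolding R_def by (rule B_kernel[OF sub], rule kernel_projection[OF sub])
  have lim0: "(\<lambda>n. c * (1/2) ^ n) \<longlonglongrightarrow> 0" for c :: real
    by (intro tendsto_mult_right_zero LIMSEQ_power_zero) simp
  have Rx: "R m x = 0" for m
  proof -
    have "norm (R m x) \<le> 2 * (1/2) ^ (m + n)" for n
    proof -
      have "(id_blinfun - p (m + n)) (R m x) = 0"
        unfolding R_def by (rule kernel_proj_apply) blast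
      then have "R m x = R m (p (m + n) x)" by (simp add: blinfun.diff_left commute[OF RB pB])
      then show ?thesis using norm_projection_le[OF RP, of m "p (m + n) x"] px[of "m + n"] by simp
    qed
    then have "norm (R m x) \<le> 2 * (1/2) ^ m * (1/2) ^ n" for n by (simp add: power_add mult.assoc)
    then have "norm (R m x) \<le> 0" by (intro LIMSEQ_le_const[OF lim0]) auto
    then show ?thesis by simp
  qed
  have Ry: "norm (y - R m y) \<le> 4 * (1/2) ^ m" for m
    unfolding R_def
    using norm_inf_projections[of "\<lambda>n. p (m + n)" y "2 * (1/2) ^ m"] pB pP py[of "m + _"]
    by (simp add: power_add mult.assoc)
  define q where "q = kernel_proj (range R)"
  have Rsub: "range R \<subseteq> B" using RB by blast
  have q: "q \<in> B" "q \<in> projections bounded_ops"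
    unfolding q_def by (rule B_kernel[OF Rsub], rule kernel_projection[OF Rsub])
  have "R m (q y) = 0" for m
    unfolding q_def by (rule kernel_proj_apply) blast
  then have "q (R m y) = 0" for m by (simp add: commute[OF q(1) RB])
  then have "norm (q y) \<le> 4 * (1/2) ^ m" for m
    using norm_projection_le[OF q(2), of "y - R m y"] Ry[of m] by (simp add: blinfun.diff_right)
  then have "norm (q y) \<le> 0" by (intro LIMSEQ_le_const[OF lim0]) auto
  then have "q y = 0" by simp
  moreover have "q x = x" by (simp add: q_def kernel_proj_fix Rx)
  ultimately show ?thesis using that q by blast
qed

text \<open>The operator c x is the smallest projection of B that fixes x. For x in the range of P
  it kills the kernel of P, by separation from each single y, and so lies below P. Hence P is the
  supremum of these c x and its complement their kernel projection; the family is uncountable in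
  general, which is why \<open>B_kernel\<close> allows arbitrary subsets.\<close>

lemma bicommutant_projection_mem:
  assumes P: "P \<in> commutant (commutant B)" "P \<in> projections bounded_ops"
  shows "P \<in> B"
proof -
  define G where "G x = {q \<in> B. q \<in> projections bounded_ops \<and> q x = x}" for x
  define c where "c x = kernel_proj ((\<lambda>q. id_blinfun - q) ` G x)" for x
  have sub: "(\<lambda>q. id_blinfun - q) ` G x \<subseteq> B" for x by (auto simp: G_def B_diff B_id)
  have cB: "c x \<in> B" for x unfolding c_def by (rule B_kernel[OF sub])
  have cx: "c x x = x" for x
    by (simp add: c_def kernel_proj_fix G_def blinfun.diff_left)
  have cy: "c x y = 0" if Pxy: "P x = x" "P y = 0" for x y
  proof -
    obtain q where q: "q \<in> B" "q \<in> projections bounded_ops" "q x = x" "q y = 0"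
      using separating_projection[OF P Pxy] .
    have "(id_blinfun - q) (c x y) = 0"
      unfolding c_def by (rule kernel_proj_apply) (use q in \<open>auto simp: G_def\<close>)
    then show ?thesis using commute[OF q(1) cB] q(4) by (simp add: blinfun.diff_left)
  qed
  define R where "R = kernel_proj (c ` {x. P x = x})"
  have Rsub: "c ` {x. P x = x} \<subseteq> B" using cB by blast
  have R: "R \<in> B" "R \<in> projections bounded_ops"
    unfolding R_def by (rule B_kernel[OF Rsub], rule kernel_projection[OF Rsub])
  note PP = projection_apply(1)[OF P(2)]
  have "R = id_blinfun - P"
  proof (rule projection_antisym[OF R(2) projection_compl(1)[OF P(2)]])
    show "R ((id_blinfun - P) z) = (id_blinfun - P) z" for z
    proof -
      have "c x (z - P z) = 0" if "P x = x" for x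
        by (rule cy[OF that]) (simp add: blinfun.diff_right PP)
      then show ?thesis by (auto simp: R_def kernel_proj_fix blinfun.diff_left)
    qed
    show "(id_blinfun - P) (R z) = R z" for z
    proof -
      define u where "u = P (R z)"
      have Pu: "P u = u" by (simp add: u_def PP)
      have "c u (R z) = 0" unfolding R_def by (rule kernel_proj_apply) (use Pu in blast)
      moreover have "c u (R z - u) = 0"
        by (rule cy[OF Pu]) (simp add: blinfun.diff_right Pu u_def[symmetric])
      ultimately have "u = 0" using cx[of u] by (simp add: blinfun.diff_right)
      then show ?thesis by (simp add: blinfun.diff_left u_def)
    qed
  qed
  then have "P = id_blinfun - R" by simp
  then show ?thesis using B_diff[OF B_id R(1)] by simp
qed

end

lemma scaleC_minus_left: "(- c) *\<^sub>C x = - (c *\<^sub>C (x :: 'h::chilbert_space))"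
proof -
  have "(- c) *\<^sub>C x + c *\<^sub>C x = 0 *\<^sub>C x" by (simp add: scaleC_add_left[symmetric])
  also have "\<dots> = 0" using scaleR_scaleC[of 0 x] by simp
  finally show ?thesis by (simp add: eq_neg_iff_add_eq_0)
qed

text \<open>Taking U = i T gives real and imaginary parts the same shape, an operator plus its
  adjoint.\<close>

lemma cartesian_decomposition:
  fixes T :: "'h::chilbert_space \<Rightarrow>\<^sub>L 'h"
  assumes T: "T \<in> bounded_ops"
  defines "U \<equiv> scale_op \<i> T"
  shows "selfadjoint (T + adj T)" "selfadjoint (U + adj U)"
    "T = (1/2) *\<^sub>R ((T + adj T) - scale_op \<i> (U + adj U))"
proof -
  have sym: "selfadjoint (T + adj T)" if "T \<in> bounded_ops" for T :: "'h \<Rightarrow>\<^sub>L 'h"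
    using adj_inner[OF that] adj_inner'[OF that]
    by (simp add: selfadjoint_def blinfun.add_left inner_add_left inner_add_right add.commute)
  from sym[OF T] sym[of U] show "selfadjoint (T + adj T)" "selfadjoint (U + adj U)"
    using bounded_ops_scale_op[OF T] by (simp_all add: U_def)
  have "adj U = scale_op (- \<i>) (adj T)"
    unfolding U_def
    by (rule adj_unique[OF bounded_ops_scale_op[OF T]])
      (simp add: scale_op_apply inner_scaleC adj_inner[OF T] bounded_opsD[OF T])
  then show "T = (1/2) *\<^sub>R ((T + adj T) - scale_op \<i> (U + adj U))"
    by (intro blinfun_eqI) (simp add: U_def blinfun.add_left blinfun.diff_left blinfun.scaleR_left
        scale_op_apply scaleC_add_right scaleC_minus_right scaleC_scaleC scaleC_minus_left)
qed

section \<open>Transfer to images of contexts\<close>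

context algebra_automorphism
begin

text \<open>Preimages are taken in D, where kernel projections and cuts are available because D is a
  von Neumann algebra, and h carries the results back.\<close>

lemma image_monotone_closed:
  assumes D: "D \<in> contexts A"
  shows "monotone_closed_algebra (h ` D)"
proof -
  note vD = contextsD(1)[OF D] and DA = contextsD(2)[OF D]
  note c = von_neumann_algebra_closed[OF vD]
  have mem: "T \<in> A" if "T \<in> D" for T using that DA by blast
  have kernel: "kernel_proj F \<in> h ` D" if F: "F \<subseteq> h ` D" for F
  proof -
    obtain F' where F': "F' \<subseteq> D" "F = h ` F'" using F by (meson subset_imageE)
    then have "kernel_proj F = h (kernel_proj F')" using h_kernel_proj DA by simp
    moreover have "kernel_proj F' \<in> D"
      using kernel_proj_von_neumann[OF vD F'(1)] by (simp add: projections_def)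
    ultimately show ?thesis by blast
  qed
  have cuts: "cut (h T) l \<in> h ` D" if T: "T \<in> D" "selfadjoint (h T)" for T l
  proof -
    have TB: "T \<in> bounded_ops" "h T \<in> bounded_ops"
      using mem[OF T(1)] h_mem von_neumann_algebraD(1)[OF A] by auto
    have "h (adj T) = h T" using h_adj[OF mem[OF T(1)]] adj_eq_self_iff[OF TB(2)] T(2) by simp
    then have "adj T = T"
      using h_inj mem T(1) von_neumann_algebraD(2)[OF vD] by blast
    then have sa: "selfadjoint T" using adj_eq_self_iff[OF TB(1)] by blast
    have "cut T l \<in> D"
      using cut(1)[OF TB(1) sa] von_neumann_algebra_bicommutant[OF vD T(1)] by blast
    then show ?thesis unfolding h_cut[OF mem[OF T(1)] sa, symmetric] by (rule imageI)
  qed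
  show ?thesis
  proof
    show "h ` D \<subseteq> bounded_ops" using mem h_mem von_neumann_algebraD(1)[OF A] by blast
    show "id_blinfun \<in> h ` D" using c(1) h_id by force
    show "adj T \<in> h ` D" if "T \<in> h ` D" for T
      using that von_neumann_algebraD(2)[OF vD] by (auto simp: h_adj[OF mem, symmetric])
    show "S + T \<in> h ` D" if "S \<in> h ` D" "T \<in> h ` D" for S T
      using that c(3) by (auto simp: h_add[OF mem mem, symmetric])
    show "S - T \<in> h ` D" if "S \<in> h ` D" "T \<in> h ` D" for S T
      using that c(4) by (auto simp: h_diff[OF mem mem, symmetric])
    show "S o\<^sub>L T \<in> h ` D" if "S \<in> h ` D" "T \<in> h ` D" for S T
      using that c(5) by (auto simp: h_compose[OF mem mem, symmetric])
    show "scale_op k S \<in> h ` D" if "S \<in> h ` D" for k S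
      using that c(7) by (auto simp: h_scale[OF mem, symmetric])
    show "S o\<^sub>L T = T o\<^sub>L S" if "S \<in> h ` D" "T \<in> h ` D" for S T
      using that by (auto simp: h_compose[OF mem mem, symmetric] contextsD(3)[OF D])
  qed (use kernel cuts in auto)
qed

text \<open>The bicommutant of h[D] stays inside A, so a self-adjoint T in it has a preimage S. The
  cuts of T are projections of the bicommutant, hence in h[D], and pull back to cuts of S in D.
  Whatever commutes with D commutes with these cuts and therefore with S, so S lies in D. Real and
  imaginary parts give the general element.\<close>

lemma image_context:
  assumes D: "D \<in> contexts A"
  shows "h ` D \<in> contexts A"
proof -
  note vD = contextsD(1)[OF D] and DA = contextsD(2)[OF D]
  interpret B: monotone_closed_algebra "h ` D" by (rule image_monotone_closed[OF D])
  let ?B2 = "commutant (commutant (h ` D))"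
  have hDA: "h ` D \<subseteq> A" using DA h_mem by blast
  have B2A: "?B2 \<subseteq> A"
    using commutant_antimono[OF commutant_antimono[OF hDA]] von_neumann_algebraD(3)[OF A] by simp
  have sa_mem: "T \<in> h ` D" if T: "T \<in> ?B2" "selfadjoint T" for T
  proof -
    have TB: "T \<in> bounded_ops" using T(1) commutant_bounded_ops by blast
    obtain S where S: "S \<in> A" "h S = T" using h_surj B2A T(1) by blast
    have SB: "S \<in> bounded_ops" using S(1) von_neumann_algebraD(1)[OF A] by blast
    have "h (adj S) = h S" using h_adj[OF S(1)] adj_eq_self_iff[OF TB] T(2) S(2) by simp
    then have "adj S = S" using h_inj S(1) von_neumann_algebraD(2)[OF A] by blast
    then have sa: "selfadjoint S" using adj_eq_self_iff[OF SB] by blast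
    have cutD: "cut S l \<in> D" for l
    proof -
      have "cut T l \<in> ?B2"
        using cut(1)[OF TB T(2)] bicommutant_least[of "{T}" "commutant (h ` D)"] T(1) commutant_bounded_ops by blast
      then have "cut T l \<in> h ` D" by (rule B.bicommutant_projection_mem[OF _ cut_projection[OF TB T(2)]])
      then obtain R where "R \<in> D" "h (cut S l) = h R" using h_cut[OF S(1) sa] S(2) by auto
      then show ?thesis using h_inj[OF cut_mem[OF S(1) sa], of R] DA by auto
    qed
    have "S \<in> commutant (commutant D)"
      unfolding commutant_iff[of S]
    proof (intro conjI ballI allI SB)
      fix R x assume R: "R \<in> commutant D"
      show "S (R x) = R (S x)"
        by (rule commute_if_commute_cuts[OF SB sa, symmetric])
          (use R commutant_bounded_ops commutant_apply[OF R cutD] in auto)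
    qed
    then show ?thesis using von_neumann_algebraD(3)[OF vD] S(2) by auto
  qed
  have "?B2 \<subseteq> h ` D"
  proof
    fix T assume T: "T \<in> ?B2"
    have B1adj: "adj S \<in> commutant (h ` D)" if "S \<in> commutant (h ` D)" for S
      using commutant_adj[OF B.B_ops B.B_adj that] .
    have adj2: "adj S \<in> ?B2" if "S \<in> ?B2" for S
      using commutant_adj[OF commutant_bounded_ops B1adj that] .
    have U: "scale_op \<i> T \<in> ?B2" by (rule commutant_scale_op[OF commutant_bounded_ops T])
    have TB: "T \<in> bounded_ops" using T commutant_bounded_ops by blast
    note dec = cartesian_decomposition[OF TB]
    have "T + adj T \<in> h ` D" by (rule sa_mem[OF _ dec(1)]) (intro commutant_add T adj2)
    moreover have "scale_op \<i> T + adj (scale_op \<i> T) \<in> h ` D"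
      by (rule sa_mem[OF _ dec(2)]) (intro commutant_add U adj2)
    ultimately have "(1/2) *\<^sub>R ((T + adj T) - scale_op \<i> (scale_op \<i> T + adj (scale_op \<i> T))) \<in> h ` D"
      unfolding scale_op_of_real[symmetric] by (intro B.B_scale B.B_diff)
    then show "T \<in> h ` D" using dec(3) by simp
  qed
  then have "von_neumann_algebra (h ` D)"
    using subset_bicommutant[OF B.B_ops] B.B_ops B.B_adj by (auto simp: von_neumann_algebra_def)
  then show ?thesis using hDA B.B_commute by (simp add: contexts_def)
qed

end

section \<open>The spectral spaces\<close>

lemma gelfand_spectrum_unit:
  assumes "von_neumann_algebra C" "\<phi> \<in> gelfand_spectrum C"
  shows "\<phi> id_blinfun = 1"
proof -
  obtain T where T: "T \<in> C" "\<phi> T \<noteq> 0" using assms(2) by (auto simp: gelfand_spectrum_def)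
  have "T o\<^sub>L id_blinfun = T" by (simp add: blinfun_eq_iff)
  then have "\<phi> T * \<phi> id_blinfun = \<phi> T"
    using assms(2) T(1) von_neumann_algebra_closed(1)[OF assms(1)] by (force simp: gelfand_spectrum_def)
  then show ?thesis using T(2) by simp
qed

lemma gelfand_spectrum_restrict:
  assumes "von_neumann_algebra C" "von_neumann_algebra D" "D \<subseteq> C" "\<phi> \<in> gelfand_spectrum C"
  shows "restrict \<phi> D \<in> gelfand_spectrum D"
proof -
  have "\<exists>T\<in>D. \<phi> T \<noteq> 0"
    using gelfand_spectrum_unit[OF assms(1,4)] von_neumann_algebra_closed(1)[OF assms(2)] by force
  then show ?thesis
    using assms(3,4) von_neumann_algebra_closed[OF assms(2)]
    by (auto simp: gelfand_spectrum_def subset_iff)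
qed

lemma gelfand_spectrum_projection:
  assumes "\<phi> \<in> gelfand_spectrum C" "p \<in> projections C"
  shows "\<phi> p = 0 \<or> \<phi> p = 1"
proof -
  have "p \<in> C" "p o\<^sub>L p = p" using assms(2) by (auto simp: projections_def)
  moreover have "\<phi> (p o\<^sub>L p) = \<phi> p * \<phi> p" using assms(1) \<open>p \<in> C\<close> by (simp add: gelfand_spectrum_def)
  ultimately have "\<phi> p * (\<phi> p - 1) = 0" by (simp add: algebra_simps)
  then show ?thesis by auto
qed

text \<open>A common form for both propositions: the same projection p with k C = C or k C = h[C],
  so that fibres can be compared directly.\<close>

definition das_open ::
  "('h::chilbert_space \<Rightarrow>\<^sub>L 'h) set \<Rightarrow> (('h \<Rightarrow>\<^sub>L 'h) set \<Rightarrow> ('h \<Rightarrow>\<^sub>L 'h) set) \<Rightarrow> ('h \<Rightarrow>\<^sub>L 'h) \<Rightarrow> 'h point set" where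
  "das_open A k p = {(C, \<phi>) \<in> bundle_points A k. \<phi> (outer_das (k C) p) = 1}"

lemma das_open_fibre:
  "C \<in> contexts A \<Longrightarrow> das_open A k p `` {C} = {\<phi> \<in> gelfand_spectrum (k C). \<phi> (outer_das (k C) p) = 1}"
  by (auto simp: das_open_def bundle_points_def)

lemma openin_bundle_space: "openin (bundle_space A k) U \<longleftrightarrow> bundle_open A k U"
  by (simp add: bundle_space_def istopology_bundle_open topology_inverse')

lemma openin_das_open:
  assumes k: "\<And>C. C \<in> contexts A \<Longrightarrow> von_neumann_algebra (k C)"
    and mono: "\<And>C D. C \<in> contexts A \<Longrightarrow> D \<in> contexts A \<Longrightarrow> D \<subseteq> C \<Longrightarrow> k D \<subseteq> k C"
  shows "openin (bundle_space A k) (das_open A k p)"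
  unfolding openin_bundle_space bundle_open_def
proof (intro conjI allI ballI impI)
  show "das_open A k p \<subseteq> bundle_points A k" by (auto simp: das_open_def)
next
  fix C \<phi> D
  assume D: "D \<in> contexts A" and "(C, \<phi>) \<in> das_open A k p" and DC: "D \<subseteq> C"
  then have C: "C \<in> contexts A" and \<phi>: "\<phi> \<in> gelfand_spectrum (k C)" "\<phi> (outer_das (k C) p) = 1"
    by (auto simp: das_open_def bundle_points_def)
  note kDC = mono[OF C D DC]
  have mem: "outer_das (k D) p \<in> k D" "outer_das (k C) p \<in> k C"
    using outer_das_projection[OF k] C D by (auto simp: projections_def)
  then have "\<phi> (outer_das (k D) p o\<^sub>L outer_das (k C) p) = \<phi> (outer_das (k D) p) * \<phi> (outer_das (k C) p)"
    using \<phi>(1) kDC by (auto simp: gelfand_spectrum_def)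
  then have "\<phi> (outer_das (k D) p) = 1"
    using \<phi>(2) outer_das_antimono[OF k[OF D] k[OF C] kDC, of p] by simp
  then show "(D, restrict \<phi> (k D)) \<in> das_open A k p"
    using D mem gelfand_spectrum_restrict[OF k[OF C] k[OF D] kDC \<phi>(1)]
    by (simp add: das_open_def bundle_points_def)
next
  fix C assume C: "C \<in> contexts A"
  define e where "e = outer_das (k C) p"
  have e: "e \<in> projections (k C)" unfolding e_def by (rule outer_das_projection[OF k[OF C]])
  have top: "topspace (gelfand_topology (k C)) = gelfand_spectrum (k C)"
    by (auto simp: gelfand_topology_def gelfand_spectrum_def extensional_def)
  have "continuous_map (gelfand_topology (k C)) euclidean (\<lambda>\<phi>. \<phi> e)"
    unfolding gelfand_topology_def
    by (intro continuous_map_from_subtopology continuous_map_product_projection)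
      (use e in \<open>simp add: projections_def\<close>)
  \<comment> \<open>Characters take only the values 0 and 1 on projections, so the closed condition
    of having value 1 coincides with the open condition of being nonzero.\<close>
  then have "openin (gelfand_topology (k C)) {\<phi> \<in> gelfand_spectrum (k C). \<phi> e \<in> - {0}}"
    unfolding top[symmetric] by (rule openin_continuous_map_preimage) (simp add: open_Compl)
  also have "{\<phi> \<in> gelfand_spectrum (k C). \<phi> e \<in> - {0}} = das_open A k p `` {C}"
    unfolding das_open_fibre[OF C] e_def[symmetric]
    using gelfand_spectrum_projection[OF _ e] by auto
  finally show "openin (gelfand_topology (k C)) (das_open A k p `` {C})" .
qed

text \<open>If \<phi> is a character of h[C], then \<phi> o h is one of C, and its value at the
  daseinisation of p is that of \<phi> at the daseinisation of h p, since h intertwines the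
  two.\<close>

lemma (in algebra_automorphism) pullback_elementary_prop:
  assumes a: "a \<in> A" "selfadjoint a" and \<Delta>: "open \<Delta>"
  shows "spectral_map_inverse_image A h (elementary_prop A a \<Delta>) =
      das_open A (\<lambda>C. h ` C) (spectral_projection (h a) \<Delta>)"
proof -
  have B: "\<Delta> \<in> sets borel" using \<Delta> by simp
  note aB = aB[OF a] haB[OF a] hsa[OF a]
  define p where "p = spectral_projection a \<Delta>"
  have p: "p \<in> projections A"
    using borel_projection_projection[OF aB(1) a(2) B] borel_projection_mem[OF a B]
    by (simp add: p_def spectral_projection_eq[OF aB(1) a(2)] projections_def)
  have hp: "h p = spectral_projection (h a) \<Delta>"
    unfolding p_def spectral_projection_eq[OF aB(1) a(2)] spectral_projection_eq[OF aB(2,3)]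
    by (rule h_borel_projection[OF a B])
  have char: "restrict (\<phi> \<circ> h) C \<in> gelfand_spectrum C"
    if "C \<in> contexts A" "\<phi> \<in> gelfand_spectrum (h ` C)" for C \<phi>
    using that(2) von_neumann_algebra_closed[OF contextsD(1)[OF that(1)]] contextsD(2)[OF that(1)]
    by (auto simp: gelfand_spectrum_def h_add h_compose h_scale subset_iff)
  have mem: "outer_das C p \<in> C" if "C \<in> contexts A" for C
    using outer_das_projection[OF contextsD(1)[OF that]] by (auto simp: projections_def)
  have val: "h (outer_das C p) = outer_das (h ` C) (h p)" if C: "C \<in> contexts A" for C
    by (rule h_outer_das[OF contextsD(1,2)[OF C] contextsD(1)[OF image_context[OF C]] p])
  show ?thesis
    unfolding hp[symmetric]
    by (auto simp: spectral_map_inverse_image_def elementary_prop_def das_open_def bundle_points_def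
        spectral_map_def p_def[symmetric] char val mem)
qed

theorem theorem5p18:
  fixes A :: "('h::chilbert_space \<Rightarrow>\<^sub>L 'h) set"
    and h :: "('h \<Rightarrow>\<^sub>L 'h) \<Rightarrow> ('h \<Rightarrow>\<^sub>L 'h)"
    and \<psi> :: "('h \<Rightarrow>\<^sub>L 'h) \<Rightarrow> complex"
    and a :: "'h \<Rightarrow>\<^sub>L 'h"
    and \<Delta> :: "real set"
    and C :: "('h \<Rightarrow>\<^sub>L 'h) set"
  assumes "von_neumann_algebra A"
    and "star_automorphism A h"
    and "state A \<psi>"
    and "a \<in> A" and "adj a = a"
    and "open \<Delta>"
    and "C \<in> contexts A"
  shows "forces_one A C
           (mu_pullback A h \<psi> (spectral_map_inverse_image A h (elementary_prop A a \<Delta>)))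
     \<longleftrightarrow> forces_one A (h ` C) (mu A \<psi> (elementary_prop A (h a) \<Delta>))"
proof -
  interpret algebra_automorphism A h by unfold_locales fact+
  \<comment> \<open>The inverse is needed because forcing at h[C] quantifies over all contexts below
    h[C]: each such D is h[g[D]], and g[D] must again be a context.\<close>
  define g where "g = inv_into A h"
  interpret inv: algebra_automorphism A g
    unfolding g_def by unfold_locales (fact | rule star_automorphism_inv; fact)+
  have sa: "selfadjoint a"
    using assms(1,4,5) adj_eq_self_iff von_neumann_algebraD(1) by blast
  define p where "p = spectral_projection (h a) \<Delta>"
  have U: "spectral_map_inverse_image A h (elementary_prop A a \<Delta>) = das_open A (\<lambda>C. h ` C) p"
    unfolding p_def by (rule pullback_elementary_prop[OF assms(4) sa assms(6)])
  have V: "elementary_prop A (h a) \<Delta> = das_open A (\<lambda>C. C) p"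
    by (simp add: elementary_prop_def das_open_def p_def)
  have "openin (bundle_space A (\<lambda>C. h ` C)) (das_open A (\<lambda>C. h ` C) p)"
    by (rule openin_das_open) (use image_context contextsD(1) in blast)+
  moreover have "openin (bundle_space A (\<lambda>C. C)) (das_open A (\<lambda>C. C) p)"
    by (rule openin_das_open) (use contextsD(1) in blast)+
  \<comment> \<open>Both sides are the valuation of the context h[D] at one and the same fibre;
    openness lets the restricted functions be evaluated.\<close>
  ultimately have eq: "mu_pullback A h \<psi> (das_open A (\<lambda>C. h ` C) p) D = mu A \<psi> (das_open A (\<lambda>C. C) p) (h ` D)"
    if "D \<in> contexts A" for D
    using that image_context[OF that] by (simp add: internal_valuation_def das_open_fibre)
  have hg: "h ` g ` D = D" and gh: "g ` h ` D = D" if "D \<in> contexts A" for D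
    using image_inv_into_cancel[OF bij_betw_imp_surj_on[OF bij] contextsD(2)[OF that]]
      inv_into_image_cancel[OF bij_betw_imp_inj_on[OF bij] contextsD(2)[OF that]]
    by (simp_all add: g_def)
  show ?thesis
    unfolding U V forces_one_def
  proof (intro iffI ballI impI)
    fix D assume *: "\<forall>D\<in>contexts A. D \<subseteq> C \<longrightarrow> mu_pullback A h \<psi> (das_open A (\<lambda>C. h ` C) p) D = 1"
      and D: "D \<in> contexts A" "D \<subseteq> h ` C"
    have gD: "g ` D \<in> contexts A" by (rule inv.image_context[OF D(1)])
    have "g ` D \<subseteq> C" using image_mono[OF D(2), of g] gh[OF assms(7)] by simp
    then show "mu A \<psi> (das_open A (\<lambda>C. C) p) D = 1" using * gD eq[OF gD] hg[OF D(1)] by simp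
  next
    fix D assume *: "\<forall>D\<in>contexts A. D \<subseteq> h ` C \<longrightarrow> mu A \<psi> (das_open A (\<lambda>C. C) p) D = 1"
      and D: "D \<in> contexts A" "D \<subseteq> C"
    then show "mu_pullback A h \<psi> (das_open A (\<lambda>C. h ` C) p) D = 1"
      using eq[OF D(1)] image_context[OF D(1)] image_mono[OF D(2), of h] by simp
  qed
qed

end
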